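(* Let $G$ be a Lie group of dimension $n\ge2$, $E=E_{H,F}$ a Courant algebroid of type $B_n$ over $G$ with left-invariant $H,F$, $E_-=\{X-g(X)\mid X\in TG\}$ a left-invariant generalized metric on $E$ ($g$ a left-invariant pseudo-Riemannian metric) and $\delta\in\tilde E^*$ a left-invariant divergence operator. Let $(v_a)_{1\le a\le n}$ be a $g$-orthonormal basis of $\mathfrak{g}$ and $(e_A)_{0\le A\le 2n}$ the induced basis of $\tilde E$. Then the components $R^{\delta,+}_{ia}=\mathrm{Ric}^{\delta,+}(e_i,e_a)$, $R^{\delta,-}_{ai}=\mathrm{Ric}^{\delta,-}(e_a,e_i)$ of the Ricci tensor of $(E_-,\delta)$ are given, for $1\le a\le n$ and $n+1\le i\le 2n$ (with $i'=i-n$, $j'=j-n$), by $$R^{\delta,+}_{ia}=\sum_{b=1}^n\Big(\sum_{j=n+1}^{2n}B_{bi}^{j}B_{aj}^{b}+B_{ia}^{b}\delta_b\Big)+F_{i'a}\delta_0-\sum_{b=1}^n\epsilon_bF_{i'b}F_{ab},$$ $$R^{\delta,-}_{ai}=\sum_{b=1}^n\sum_{j=n+1}^{2n}B_{bi}^{j}B_{aj}^{b}+\sum_{j=n+1}^{2n}B_{ai}^{j}\delta_j-\sum_{b=1}^n\epsilon_bF_{i'b}F_{ab},$$ $$R^{\delta,+}_{i0}=-\sum_{b=1}^n\sum_{j=n+1}^{2n}\epsilon_{j'}\epsilon_bF_{j'b}B_{bij}-\sum_{b=1}^nF_{i'b}\epsilon_b\delta_b,$$ $$R^{\delta,-}_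{0i}=-\sum_{b=1}^n\sum_{j=n+1}^{2n}\epsilon_{j'}\epsilon_bF_{j'b}B_{bij}-\sum_{j=n+1}^{2n}F_{i'j'}\epsilon_{j'}\delta_j.$$
   Context: Let $G$ have Lie algebra $\mathfrak{g}$ (left-invariant vector fields) and let $H\in\Omega^3(G)$, $F\in\Omega^2(G)$ be left-invariant with $dF=0$ and $dH+F\wedge F=0$. $E=E_{H,F}$ is the bundle $TG\oplus T^*G\oplus\mathbb{R}$ with anchor $\pi$ the projection to $TG$, scalar product $\langle X+\xi+\lambda,Y+\eta+\mu\rangle=\frac12(\xi(Y)+\eta(X))+\lambda\mu$ and Dorfman bracket $$[X+\xi+\lambda,Y+\eta+\mu]_{H,F}=\mathcal{L}_X(Y+\eta)-i_Yd\xi+2\mu\,d\lambda+i_Xi_YH-2(\mu\, i_XF-\lambda\, i_YF)+X(\mu)-Y(\lambda)+F(X,Y).$$ Left-invariant sections form $\tilde E=\mathfrak{g}\oplus\mathfrak{g}^*\oplus\mathbb{R}$. For $E_-=\{X-g(X)\}$, with $g(X)=g(X,\cdot)$, put $E_+=E_-^\perp$. A generalized connection is a linear map $D:\Gamma(E)\to\Gamma(E^*\otimes E)$ with $D_u(fv)=\pi(u)(f)v+fD_uv$ and $\pi(u)\langle v,w\rangle=\langle D_uv,w\rangle+\langle v,D_uw\rangle$. Its torsion is $T^D(u,v,w)=\langle D_uv-D_vu-[u,v]_{H,F},w\rangle+\langle v,D_wu\rangle$; $D$ is Levi-Civita for $E_-$ if $T^D=0$ and $D_u\Gamma(E_-)\subset\Gamma(E_-)$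 for all $u$. A divergence operator is an additive map $\delta:\Gamma(E)\to C^\infty(G)$ with $\delta(fu)=\pi(u)(f)+f\delta(u)$; left-invariant ones (constant on left-invariant sections) are identified with elements of $\tilde E^*$; $\delta^D(u)=\mathrm{tr}\,Du$. For a Levi-Civita generalized connection $D$ of $E_-$ with $\delta^D=\delta$, put $R^D(u,v)w=D_uD_vw-D_vD_uw-D_{[u,v]_{H,F}}w$ and $\mathrm{Ric}^{\delta,+}(u,v)=\mathrm{tr}(E_+\ni w\mapsto R^D(w,u)v)$ ($u\in E_-,v\in E_+$), $\mathrm{Ric}^{\delta,-}(u,v)=\mathrm{tr}(E_-\ni w\mapsto R^D(w,u)v)$ ($u\in E_+,v\in E_-$). These are tensors depending only on $(E_-,\delta)$. Notation. $\epsilon_a=g(v_a,v_a)\in\{\pm1\}$ for $1\le a\le n$; $\epsilon_0=1$; $\epsilon_{n+a}=-\epsilon_a$. $e_0=1$, $e_a=v_a+g(v_a)$, $e_{n+a}=v_a-g(v_a)$ for $1\le a\le n$, so $\langle e_A,e_B\rangle=\epsilon_A\delta_{AB}$ (Kronecker). $\delta_A=\delta(e_A)$, $F_{ab}=F(v_a,v_b)$, $B_{ABC}=\langle[e_A,e_B]_{H,F},e_C\rangle$, $B_{AB}^C=\epsilon_CB_{ABC}$. *)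

theory Defs
  imports "HOL-Analysis.Analysis" "HOL-Library.Function_Algebras"
begin

text \<open>Functions with values in a real vector space, with pointwise operations; addition is that
  of \<^theory>\<open>HOL-Library.Function_Algebras\<close>.\<close>

instantiation "fun" :: (type, real_vector) real_vector
begin

definition scaleR_fun :: "real \<Rightarrow> ('a \<Rightarrow> 'b) \<Rightarrow> 'a \<Rightarrow> 'b"
  where "scaleR_fun r f = (\<lambda>x. r *\<^sub>R f x)"

instance
  by standard (simp_all add: scaleR_fun_def plus_fun_def fun_eq_iff scaleR_add_right scaleR_add_left)

end

definition restrict0 :: "'a set \<Rightarrow> ('a \<Rightarrow> 'b::zero) \<Rightarrow> 'a \<Rightarrow> 'b"
  where "restrict0 S f = (\<lambda>x. if x \<in> S then f x else 0)"


section \<open>Lie groups\<close>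

text \<open>\<open>Ck_on k S f\<close>: \<open>f\<close> is \<open>k\<close> times continuously differentiable on the open set \<open>S\<close>.\<close>

primrec Ck_on ::
    "nat \<Rightarrow> 'a::euclidean_space set \<Rightarrow> ('a \<Rightarrow> 'b::real_normed_vector) \<Rightarrow> bool" where
  "Ck_on 0 S f \<longleftrightarrow> continuous_on S f"
| "Ck_on (Suc k) S f \<longleftrightarrow> (\<forall>x\<in>S. f differentiable (at x)) \<and>
     (\<forall>w. Ck_on k S (\<lambda>x. frechet_derivative f (at x) w))"

definition smooth_on :: "'a::euclidean_space set \<Rightarrow> ('a \<Rightarrow> 'b::real_normed_vector) \<Rightarrow> bool"
  where "smooth_on S f \<longleftrightarrow> (\<forall>k. Ck_on k S f)"

text \<open>A chart is a pair of a domain and a map defined on it.  Only the values of the map on the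
  domain matter.\<close>

type_synonym ('g, 'e) chart = "'g set \<times> ('g \<Rightarrow> 'e)"

definition smooth_atlas ::
    "('g::{t2_space, second_countable_topology}, 'e::euclidean_space) chart set \<Rightarrow> bool" where
  "smooth_atlas \<A> \<longleftrightarrow>
     (\<forall>(U, \<phi>)\<in>\<A>. open U \<and> open (\<phi> ` U) \<and> homeomorphism U (\<phi> ` U) \<phi> (inv_into U \<phi>)) \<and>
     (\<Union>(U, \<phi>)\<in>\<A>. U) = UNIV \<and>
     (\<forall>(U, \<phi>)\<in>\<A>. \<forall>(V, \<psi>)\<in>\<A>. smooth_on (\<phi> ` (U \<inter> V)) (\<psi> \<circ> inv_into U \<phi>))"

text \<open>The group operation is written additively, as usual for the (in general non-commutative)
  class \<^class>\<open>topological_group_add\<close>; that class already makes both group operations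
  continuous, so the sets on which smoothness is required below are open.\<close>

definition lie_group ::
    "('g::{topological_group_add, t2_space, second_countable_topology}, 'e::euclidean_space) chart set
      \<Rightarrow> bool" where
  "lie_group \<A> \<longleftrightarrow> smooth_atlas \<A> \<and>
     (\<forall>(U, \<phi>)\<in>\<A>. \<forall>(V, \<psi>)\<in>\<A>. \<forall>(W, \<rho>)\<in>\<A>.
        smooth_on {(\<phi> x, \<psi> y) |x y. x \<in> U \<and> y \<in> V \<and> x + y \<in> W}
          (\<lambda>(p, q). \<rho> (inv_into U \<phi> p + inv_into V \<psi> q))) \<and>
     (\<forall>(U, \<phi>)\<in>\<A>. \<forall>(V, \<psi>)\<in>\<A>.
        smooth_on {\<phi> x |x. x \<in> U \<and> - x \<in> V} (\<lambda>p. \<psi> (- inv_into U \<phi> p)))"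


section \<open>Functions, vector fields and differential forms\<close>

type_synonym 'g scal = "'g \<Rightarrow> real"
type_synonym 'g vf = "'g scal \<Rightarrow> 'g scal"
type_synonym 'g cov1 = "'g vf \<Rightarrow> 'g scal"
type_synonym 'g cov2 = "'g vf \<Rightarrow> 'g vf \<Rightarrow> 'g scal"
type_synonym 'g cov3 = "'g vf \<Rightarrow> 'g vf \<Rightarrow> 'g vf \<Rightarrow> 'g scal"

definition smooth_funs :: "('g, 'e::euclidean_space) chart set \<Rightarrow> 'g scal set" where
  "smooth_funs \<A> = {f. \<forall>(U, \<phi>)\<in>\<A>. smooth_on (\<phi> ` U) (f \<circ> inv_into U \<phi>)}"

text \<open>Tangent vectors at \<open>x\<close> are the directional derivatives at \<open>x\<close> in charts, acting on smooth
  functions.  By the chain rule a single chart around \<open>x\<close> already yields all of them.\<close>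

definition tangent_space :: "('g, 'e::euclidean_space) chart set \<Rightarrow> 'g \<Rightarrow> ('g scal \<Rightarrow> real) set" where
  "tangent_space \<A> x =
     {restrict0 (smooth_funs \<A>) (\<lambda>f. frechet_derivative (f \<circ> inv_into U \<phi>) (at (\<phi> x)) w)
      |U \<phi> w. (U, \<phi>) \<in> \<A> \<and> x \<in> U}"

text \<open>Vector fields are identified with the operators that they induce on smooth functions.
  Operators on functions, and tensors as operators on vector fields, are extended by \<open>0\<close> outside
  their domain, so that equality of HOL functions is equality of fields and tensors.\<close>

definition vector_fields :: "('g, 'e::euclidean_space) chart set \<Rightarrow> 'g vf set" where
  "vector_fields \<A> =
     {X. (\<forall>f\<in>smooth_funs \<A>. X f \<in> smooth_funs \<A>) \<and> (\<forall>x. (\<lambda>f. X f x) \<in> tangent_space \<A> x)}"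

definition lie_bracket :: "'g vf \<Rightarrow> 'g vf \<Rightarrow> 'g vf" where
  "lie_bracket X Y = (\<lambda>f. X (Y f) - Y (X f))"

definition vf_smult :: "'g scal \<Rightarrow> 'g vf \<Rightarrow> 'g vf" where
  "vf_smult f X = (\<lambda>h. f * X h)"

definition one_forms :: "('g, 'e::euclidean_space) chart set \<Rightarrow> 'g cov1 set" where
  "one_forms \<A> =
     {\<xi>. (\<forall>X\<in>vector_fields \<A>. \<xi> X \<in> smooth_funs \<A>) \<and>
         (\<forall>X\<in>vector_fields \<A>. \<forall>Y\<in>vector_fields \<A>. \<xi> (X + Y) = \<xi> X + \<xi> Y) \<and>
         (\<forall>f\<in>smooth_funs \<A>. \<forall>X\<in>vector_fields \<A>. \<xi> (vf_smult f X) = f * \<xi> X) \<and>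
         (\<forall>X. X \<notin> vector_fields \<A> \<longrightarrow> \<xi> X = 0)}"

text \<open>Linearity in the other arguments follows from linearity in the last one and
  (skew-)symmetry.\<close>

definition two_forms :: "('g, 'e::euclidean_space) chart set \<Rightarrow> 'g cov2 set" where
  "two_forms \<A> =
     {\<omega>. (\<forall>X\<in>vector_fields \<A>. \<omega> X \<in> one_forms \<A>) \<and>
         (\<forall>X. X \<notin> vector_fields \<A> \<longrightarrow> \<omega> X = 0) \<and>
         (\<forall>X\<in>vector_fields \<A>. \<forall>Y\<in>vector_fields \<A>. \<omega> X Y = - \<omega> Y X)}"

definition three_forms :: "('g, 'e::euclidean_space) chart set \<Rightarrow> 'g cov3 set" where
  "three_forms \<A> =
     {\<omega>. (\<forall>X\<in>vector_fields \<A>. \<omega> X \<in> two_forms \<A>) \<and>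
         (\<forall>X. X \<notin> vector_fields \<A> \<longrightarrow> \<omega> X = 0) \<and>
         (\<forall>X\<in>vector_fields \<A>. \<forall>Y\<in>vector_fields \<A>. \<omega> X Y = - \<omega> Y X)}"

definition pseudo_riemannian_metrics :: "('g, 'e::euclidean_space) chart set \<Rightarrow> 'g cov2 set" where
  "pseudo_riemannian_metrics \<A> =
     {g. (\<forall>X\<in>vector_fields \<A>. g X \<in> one_forms \<A>) \<and>
         (\<forall>X. X \<notin> vector_fields \<A> \<longrightarrow> g X = 0) \<and>
         (\<forall>X\<in>vector_fields \<A>. \<forall>Y\<in>vector_fields \<A>. g X Y = g Y X) \<and>
         (\<forall>X\<in>vector_fields \<A>. \<forall>x. (\<forall>Y\<in>vector_fields \<A>. g X Y x = 0) \<longrightarrow> (\<forall>f. X f x = 0))}"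

text \<open>Exterior derivatives by the invariant (Koszul) formula, and \<open>\<omega> \<and> \<omega>\<close> for a two-form \<open>\<omega>\<close> as
  the signed sum over \<open>(2,2)\<close>-shuffles; both only to be evaluated on vector fields.\<close>

definition ext_d1 :: "'g cov1 \<Rightarrow> 'g cov2" where
  "ext_d1 \<xi> X Y = X (\<xi> Y) - Y (\<xi> X) - \<xi> (lie_bracket X Y)"

definition ext_d2 :: "'g cov2 \<Rightarrow> 'g cov3" where
  "ext_d2 \<omega> X Y Z = X (\<omega> Y Z) - Y (\<omega> X Z) + Z (\<omega> X Y)
     - \<omega> (lie_bracket X Y) Z + \<omega> (lie_bracket X Z) Y - \<omega> (lie_bracket Y Z) X"

definition ext_d3 :: "'g cov3 \<Rightarrow> 'g vf \<Rightarrow> 'g cov3" where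
  "ext_d3 \<omega> X Y Z W = X (\<omega> Y Z W) - Y (\<omega> X Z W) + Z (\<omega> X Y W) - W (\<omega> X Y Z)
     - \<omega> (lie_bracket X Y) Z W + \<omega> (lie_bracket X Z) Y W - \<omega> (lie_bracket X W) Y Z
     - \<omega> (lie_bracket Y Z) X W + \<omega> (lie_bracket Y W) X Z - \<omega> (lie_bracket Z W) X Y"

definition wedge_square :: "'g cov2 \<Rightarrow> 'g vf \<Rightarrow> 'g cov3" where
  "wedge_square \<omega> X Y Z W = \<omega> X Y * \<omega> Z W - \<omega> X Z * \<omega> Y W + \<omega> X W * \<omega> Y Z
     + \<omega> Y Z * \<omega> X W - \<omega> Y W * \<omega> X Z + \<omega> Z W * \<omega> X Y"

definition lie_derivative1 :: "'g vf \<Rightarrow> 'g cov1 \<Rightarrow> 'g cov1" where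
  "lie_derivative1 X \<eta> Z = X (\<eta> Z) - \<eta> (lie_bracket X Z)"


section \<open>Left-invariance\<close>

text \<open>\<open>translate a X\<close> is the push-forward of \<open>X\<close> along the left translation \<open>L\<^sub>a\<close> by \<open>a\<close>; a
  covariant tensor \<open>\<omega>\<close> is left-invariant if \<open>(L\<^sub>a)\<^sup>* \<omega> = \<omega>\<close> for all \<open>a\<close>.\<close>

definition translate :: "'g::group_add \<Rightarrow> 'g vf \<Rightarrow> 'g vf" where
  "translate a X = (\<lambda>f y. X (\<lambda>z. f (a + z)) (- a + y))"

definition lie_algebra :: "('g::group_add, 'e::euclidean_space) chart set \<Rightarrow> 'g vf set" where
  "lie_algebra \<A> = {X \<in> vector_fields \<A>. \<forall>a. translate a X = X}"

definition left_invariant1 :: "('g::group_add, 'e::euclidean_space) chart set \<Rightarrow> 'g cov1 \<Rightarrow> bool" where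
  "left_invariant1 \<A> \<omega> \<longleftrightarrow>
     (\<forall>a. \<forall>X\<in>vector_fields \<A>. \<forall>y. \<omega> (translate a X) (a + y) = \<omega> X y)"

definition left_invariant2 :: "('g::group_add, 'e::euclidean_space) chart set \<Rightarrow> 'g cov2 \<Rightarrow> bool" where
  "left_invariant2 \<A> \<omega> \<longleftrightarrow>
     (\<forall>a. \<forall>X\<in>vector_fields \<A>. \<forall>Y\<in>vector_fields \<A>. \<forall>y.
        \<omega> (translate a X) (translate a Y) (a + y) = \<omega> X Y y)"

definition left_invariant3 :: "('g::group_add, 'e::euclidean_space) chart set \<Rightarrow> 'g cov3 \<Rightarrow> bool" where
  "left_invariant3 \<A> \<omega> \<longleftrightarrow>
     (\<forall>a. \<forall>X\<in>vector_fields \<A>. \<forall>Y\<in>vector_fields \<A>. \<forall>Z\<in>vector_fields \<A>. \<forall>y.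
        \<omega> (translate a X) (translate a Y) (translate a Z) (a + y) = \<omega> X Y Z y)"


section \<open>The Courant algebroid \<open>E\<close> of type \<open>B\<^sub>n\<close>\<close>

text \<open>A section \<open>X + \<xi> + \<lambda>\<close> of \<open>E\<close> is the triple \<open>(X, \<xi>, \<lambda>)\<close>.\<close>

type_synonym 'g sec = "'g vf \<times> 'g cov1 \<times> 'g scal"

definition sections :: "('g, 'e::euclidean_space) chart set \<Rightarrow> 'g sec set" where
  "sections \<A> = vector_fields \<A> \<times> one_forms \<A> \<times> smooth_funs \<A>"

definition smult :: "'g scal \<Rightarrow> 'g sec \<Rightarrow> 'g sec" (infixr "\<odot>" 75) where
  "f \<odot> u = (case u of (X, \<xi>, l) \<Rightarrow> (vf_smult f X, (\<lambda>Y. f * \<xi> Y), f * l))"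

definition anchor :: "'g sec \<Rightarrow> 'g vf" where
  "anchor u = fst u"

definition pairing :: "'g sec \<Rightarrow> 'g sec \<Rightarrow> 'g scal" where
  "pairing u v = (case (u, v) of ((X, \<xi>, l), (Y, \<eta>, m)) \<Rightarrow> (1/2) *\<^sub>R (\<xi> Y + \<eta> X) + l * m)"

text \<open>\<open>H Y X Z\<close> below is \<open>(i\<^sub>X i\<^sub>Y H)(Z)\<close>.\<close>

definition dorfman ::
    "('g, 'e::euclidean_space) chart set \<Rightarrow> 'g cov3 \<Rightarrow> 'g cov2 \<Rightarrow> 'g sec \<Rightarrow> 'g sec \<Rightarrow> 'g sec" where
  "dorfman \<A> H F u v = (case (u, v) of ((X, \<xi>, l), (Y, \<eta>, m)) \<Rightarrow>
     (lie_bracket X Y,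
      restrict0 (vector_fields \<A>) (\<lambda>Z. lie_derivative1 X \<eta> Z - ext_d1 \<xi> Y Z + 2 *\<^sub>R (m * Z l)
        + H Y X Z - 2 *\<^sub>R (m * F X Z - l * F Y Z)),
      X m - Y l + F X Y))"

definition courant_Bn_data ::
    "('g, 'e::euclidean_space) chart set \<Rightarrow> 'g cov3 \<Rightarrow> 'g cov2 \<Rightarrow> bool" where
  "courant_Bn_data \<A> H F \<longleftrightarrow> H \<in> three_forms \<A> \<and> F \<in> two_forms \<A> \<and>
     (\<forall>X\<in>vector_fields \<A>. \<forall>Y\<in>vector_fields \<A>. \<forall>Z\<in>vector_fields \<A>. ext_d2 F X Y Z = 0) \<and>
     (\<forall>X\<in>vector_fields \<A>. \<forall>Y\<in>vector_fields \<A>. \<forall>Z\<in>vector_fields \<A>. \<forall>W\<in>vector_fields \<A>.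
        ext_d3 H X Y Z W + wedge_square F X Y Z W = 0)"

text \<open>The section spaces of \<open>E\<^sub>-\<close> and \<open>E\<^sub>+ = E\<^sub>-\<^sup>\<bottom>\<close>.\<close>

definition E_minus :: "('g, 'e::euclidean_space) chart set \<Rightarrow> 'g cov2 \<Rightarrow> 'g sec set" where
  "E_minus \<A> g = {(X, - g X, 0) |X. X \<in> vector_fields \<A>}"

definition E_plus :: "('g, 'e::euclidean_space) chart set \<Rightarrow> 'g cov2 \<Rightarrow> 'g sec set" where
  "E_plus \<A> g = {u \<in> sections \<A>. \<forall>w\<in>E_minus \<A> g. pairing u w = 0}"

definition left_inv_sections :: "('g::group_add, 'e::euclidean_space) chart set \<Rightarrow> 'g sec set" where
  "left_inv_sections \<A> = {(X, \<xi>, l). X \<in> lie_algebra \<A> \<and> \<xi> \<in> one_forms \<A> \<and>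
     left_invariant1 \<A> \<xi> \<and> (\<exists>c. l = (\<lambda>_. c))}"


section \<open>Traces\<close>

text \<open>\<open>is_frame \<A> M k b \<theta>\<close>: the sections \<open>b 0, \<dots>, b (k - 1)\<close> form a global frame of the bundle
  with section space \<open>M\<close>, with dual frame \<open>\<theta>\<close>.  The trace of an endomorphism does not depend on the
  frame used to compute it.  All bundles considered here are trivial, since a Lie group is
  parallelizable.\<close>

definition is_frame ::
    "('g, 'e::euclidean_space) chart set \<Rightarrow> 'g sec set \<Rightarrow> nat \<Rightarrow> (nat \<Rightarrow> 'g sec)
      \<Rightarrow> (nat \<Rightarrow> 'g sec \<Rightarrow> 'g scal) \<Rightarrow> bool" where
  "is_frame \<A> M k b \<theta> \<longleftrightarrow>
     (\<forall>i<k. b i \<in> M) \<and>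
     (\<forall>i<k. (\<forall>u\<in>M. \<theta> i u \<in> smooth_funs \<A>) \<and>
       (\<forall>u\<in>M. \<forall>w\<in>M. \<theta> i (u + w) = \<theta> i u + \<theta> i w) \<and>
       (\<forall>f\<in>smooth_funs \<A>. \<forall>u\<in>M. \<theta> i (f \<odot> u) = f * \<theta> i u)) \<and>
     (\<forall>i<k. \<forall>j<k. \<theta> i (b j) = (if i = j then 1 else 0)) \<and>
     (\<forall>u\<in>M. u = (\<Sum>i<k. \<theta> i u \<odot> b i))"

definition bundle_trace ::
    "('g, 'e::euclidean_space) chart set \<Rightarrow> 'g sec set \<Rightarrow> ('g sec \<Rightarrow> 'g sec) \<Rightarrow> 'g scal" where
  "bundle_trace \<A> M T =
     (THE t. \<exists>k b \<theta>. is_frame \<A> M k b \<theta> \<and> t = (\<Sum>i<k. \<theta> i (T (b i))))"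


section \<open>Generalized connections, divergence operators and Ricci curvature\<close>

text \<open>\<open>D u v\<close> is \<open>D\<^sub>u v\<close>.\<close>

definition generalized_connection ::
    "('g, 'e::euclidean_space) chart set \<Rightarrow> ('g sec \<Rightarrow> 'g sec \<Rightarrow> 'g sec) \<Rightarrow> bool" where
  "generalized_connection \<A> D \<longleftrightarrow>
     (\<forall>u\<in>sections \<A>. \<forall>v\<in>sections \<A>. D u v \<in> sections \<A>) \<and>
     (\<forall>u\<in>sections \<A>. \<forall>u'\<in>sections \<A>. \<forall>v\<in>sections \<A>. D (u + u') v = D u v + D u' v) \<and>
     (\<forall>f\<in>smooth_funs \<A>. \<forall>u\<in>sections \<A>. \<forall>v\<in>sections \<A>. D (f \<odot> u) v = f \<odot> D u v) \<and>
     (\<forall>u\<in>sections \<A>. \<forall>v\<in>sections \<A>. \<forall>v'\<in>sections \<A>. D u (v + v') = D u v + D u v') \<and>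
     (\<forall>f\<in>smooth_funs \<A>. \<forall>u\<in>sections \<A>. \<forall>v\<in>sections \<A>.
        D u (f \<odot> v) = anchor u f \<odot> v + f \<odot> D u v) \<and>
     (\<forall>u\<in>sections \<A>. \<forall>v\<in>sections \<A>. \<forall>w\<in>sections \<A>.
        anchor u (pairing v w) = pairing (D u v) w + pairing v (D u w))"

definition torsion ::
    "('g, 'e::euclidean_space) chart set \<Rightarrow> 'g cov3 \<Rightarrow> 'g cov2 \<Rightarrow> ('g sec \<Rightarrow> 'g sec \<Rightarrow> 'g sec)
      \<Rightarrow> 'g sec \<Rightarrow> 'g sec \<Rightarrow> 'g sec \<Rightarrow> 'g scal" where
  "torsion \<A> H F D u v w =
     pairing (D u v - D v u - dorfman \<A> H F u v) w + pairing v (D w u)"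

definition levi_civita ::
    "('g, 'e::euclidean_space) chart set \<Rightarrow> 'g cov3 \<Rightarrow> 'g cov2 \<Rightarrow> 'g cov2
      \<Rightarrow> ('g sec \<Rightarrow> 'g sec \<Rightarrow> 'g sec) \<Rightarrow> bool" where
  "levi_civita \<A> H F g D \<longleftrightarrow> generalized_connection \<A> D \<and>
     (\<forall>u\<in>sections \<A>. \<forall>v\<in>sections \<A>. \<forall>w\<in>sections \<A>. torsion \<A> H F D u v w = 0) \<and>
     (\<forall>u\<in>sections \<A>. \<forall>v\<in>E_minus \<A> g. D u v \<in> E_minus \<A> g)"

definition divergence_operator ::
    "('g, 'e::euclidean_space) chart set \<Rightarrow> ('g sec \<Rightarrow> 'g scal) \<Rightarrow> bool" where
  "divergence_operator \<A> \<delta> \<longleftrightarrow>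
     (\<forall>u\<in>sections \<A>. \<delta> u \<in> smooth_funs \<A>) \<and>
     (\<forall>u\<in>sections \<A>. \<forall>v\<in>sections \<A>. \<delta> (u + v) = \<delta> u + \<delta> v) \<and>
     (\<forall>f\<in>smooth_funs \<A>. \<forall>u\<in>sections \<A>. \<delta> (f \<odot> u) = anchor u f + f * \<delta> u)"

definition left_invariant_divergence ::
    "('g::group_add, 'e::euclidean_space) chart set \<Rightarrow> ('g sec \<Rightarrow> 'g scal) \<Rightarrow> bool" where
  "left_invariant_divergence \<A> \<delta> \<longleftrightarrow> divergence_operator \<A> \<delta> \<and>
     (\<forall>u\<in>left_inv_sections \<A>. \<exists>c. \<delta> u = (\<lambda>_. c))"

definition divergence_of ::
    "('g, 'e::euclidean_space) chart set \<Rightarrow> ('g sec \<Rightarrow> 'g sec \<Rightarrow> 'g sec) \<Rightarrow> 'g sec \<Rightarrow> 'g scal" where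
  "divergence_of \<A> D u = bundle_trace \<A> (sections \<A>) (\<lambda>v. D v u)"

definition curvature ::
    "('g, 'e::euclidean_space) chart set \<Rightarrow> 'g cov3 \<Rightarrow> 'g cov2 \<Rightarrow> ('g sec \<Rightarrow> 'g sec \<Rightarrow> 'g sec)
      \<Rightarrow> 'g sec \<Rightarrow> 'g sec \<Rightarrow> 'g sec \<Rightarrow> 'g sec" where
  "curvature \<A> H F D u v w = D u (D v w) - D v (D u w) - D (dorfman \<A> H F u v) w"

definition ricci_plus ::
    "('g, 'e::euclidean_space) chart set \<Rightarrow> 'g cov3 \<Rightarrow> 'g cov2 \<Rightarrow> 'g cov2
      \<Rightarrow> ('g sec \<Rightarrow> 'g sec \<Rightarrow> 'g sec) \<Rightarrow> 'g sec \<Rightarrow> 'g sec \<Rightarrow> 'g scal" where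
  "ricci_plus \<A> H F g D u v = bundle_trace \<A> (E_plus \<A> g) (\<lambda>w. curvature \<A> H F D w u v)"

definition ricci_minus ::
    "('g, 'e::euclidean_space) chart set \<Rightarrow> 'g cov3 \<Rightarrow> 'g cov2 \<Rightarrow> 'g cov2
      \<Rightarrow> ('g sec \<Rightarrow> 'g sec \<Rightarrow> 'g sec) \<Rightarrow> 'g sec \<Rightarrow> 'g sec \<Rightarrow> 'g scal" where
  "ricci_minus \<A> H F g D u v = bundle_trace \<A> (E_minus \<A> g) (\<lambda>w. curvature \<A> H F D w u v)"


section \<open>Orthonormal bases\<close>

definition orthonormal_basis ::
    "('g::group_add, 'e::euclidean_space) chart set \<Rightarrow> 'g cov2 \<Rightarrow> nat \<Rightarrow> (nat \<Rightarrow> 'g vf)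
      \<Rightarrow> (nat \<Rightarrow> real) \<Rightarrow> bool" where
  "orthonormal_basis \<A> g n v \<epsilon> \<longleftrightarrow>
     inj_on v {1..n} \<and> independent (v ` {1..n}) \<and> span (v ` {1..n}) = lie_algebra \<A> \<and>
     (\<forall>a\<in>{1..n}. \<epsilon> a \<in> {1, - 1}) \<and>
     (\<forall>a\<in>{1..n}. \<forall>b\<in>{1..n}. g (v a) (v b) = (\<lambda>_. if a = b then \<epsilon> a else 0))"

definition induced_basis :: "'g cov2 \<Rightarrow> nat \<Rightarrow> (nat \<Rightarrow> 'g vf) \<Rightarrow> nat \<Rightarrow> 'g sec" where
  "induced_basis g n v k =
     (if k = 0 then (0, 0, 1)
      else if k \<le> n then (v k, g (v k), 0)
      else (v (k - n), - g (v (k - n)), 0))"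

definition induced_sign :: "nat \<Rightarrow> (nat \<Rightarrow> real) \<Rightarrow> nat \<Rightarrow> real" where
  "induced_sign n \<epsilon> k = (if k = 0 then 1 else if k \<le> n then \<epsilon> k else - \<epsilon> (k - n))"

end

theory Submission
  imports Defs
begin

text \<open>
  Write \<open>\<Gamma> a b c\<close> for the component \<open>\<langle>D\<^sub>e\<^sub>a e\<^sub>b, e\<^sub>c\<rangle>\<close> of the
  Levi-Civita generalized connection.  It is skew in \<open>b, c\<close>, it vanishes if \<open>b\<close> and \<open>c\<close> belong to
  different halves \<open>E\<^sub>+\<close>, \<open>E\<^sub>-\<close>, and vanishing torsion says that the structure coefficient
  \<open>B a b c\<close> is the cyclic sum of \<open>\<Gamma>\<close>.  Hence \<open>B\<close> is totally skew, and the coefficients of mixed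
  type are determined: \<open>\<Gamma> i b c = B i b c\<close> whenever \<open>b, c\<close> belong to one half and \<open>i\<close> to the
  other one.  Equivalently, \<open>[w, u] = D\<^sub>w u - D\<^sub>u w\<close> for \<open>w\<close> and \<open>u\<close> in different halves.  The
  coefficients of pure type, by contrast, depend on the choice of \<open>D\<close>, and need not even be
  constant.

  The Ricci curvature is a trace over one half of \<open>R\<^sup>D(w, e\<^sub>i) e\<^sub>a\<close> with \<open>e\<^sub>i\<close> in the other half.
  Expanding it in the frame, the coefficients of pure type survive only in two ways.  Contracted
  against the skew \<open>B i b c\<close> they cancel.  Contracted with themselves as \<open>\<Sum>\<^sub>b \<epsilon>\<^sub>b \<Gamma> b a b\<close> they
  form the divergence \<open>\<delta>(e\<^sub>a)\<close>, which is prescribed; since it is constant, its derivative drops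
  out.  What remains is quadratic in the mixed structure coefficients, plus a contraction of them
  with \<open>\<delta>\<close>.  The two halves play symmetric roles here, so that one computation
  (\<open>ricci_component\<close>, in the locale \<open>split_connection\<close>) yields both Ricci tensors.  The terms in
  \<open>F\<close> are those with a frame index \<open>0\<close>, because \<open>\<langle>[e\<^sub>0, w], z\<rangle> = F(\<pi> w, \<pi> z)\<close>
  for left-invariant \<open>w, z\<close> (\<open>pairing_dorfman_unit\<close>).

  The computation presupposes that \<open>(e\<^sub>A)\<close> is a global orthonormal frame, that brackets of smooth
  sections are smooth sections, and that traces may be taken in any frame.  For vector fields
  regarded as operators on smooth functions this takes an argument, since coordinates are defined
  only locally.  A left-invariant field that vanishes at one point vanishes identically, so that a
  basis of the Lie algebra is linearly independent at every point and, by a dimension count, spans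
  every tangent space.  Independent tangent vectors are separated by smooth functions; this
  provides globally defined functions with arbitrary differential at a given point
  (\<open>coordinate_functions\<close>).  They show that the commutator of two vector fields is a vector
  field, by the symmetry of second derivatives (\<open>vf_lie_bracket\<close>).  A fraction-free Gauss
  elimination shows further that, near each point, the coefficients of a vector field in the frame
  acquire a smooth common denominator (\<open>common_denominator\<close>).  This suffices to express
  the coefficients through \<open>g\<close> (\<open>frame_expansion\<close>).
\<close>


section \<open>Calculus on open sets\<close>

lemma Ck_on_cong:
  fixes f g :: "'a::euclidean_space \<Rightarrow> 'b::real_normed_vector"
  assumes "open S" "\<And>x. x \<in> S \<Longrightarrow> f x = g x"
  shows "Ck_on k S f \<longleftrightarrow> Ck_on k S g"
  using assms(2)
proof (induction k arbitrary: f g)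
  case 0
  then show ?case by (simp cong: continuous_on_cong)
next
  case (Suc k)
  have hd: "(f has_derivative D) (at x) \<longleftrightarrow> (g has_derivative D) (at x)" if "x \<in> S" for x D
    using has_derivative_transform_within_open[OF _ \<open>open S\<close> that, of f D UNIV g]
      has_derivative_transform_within_open[OF _ \<open>open S\<close> that, of g D UNIV f] Suc.prems by auto
  have "frechet_derivative f (at x) = frechet_derivative g (at x)" if "x \<in> S" for x
    using hd[OF that] by (simp add: frechet_derivative_def)
  then have "Ck_on k S (\<lambda>x. frechet_derivative f (at x) w)
      \<longleftrightarrow> Ck_on k S (\<lambda>x. frechet_derivative g (at x) w)" for w
    by (intro Suc.IH) simp
  then show ?case using hd by (simp add: differentiable_def)
qed

lemma Ck_on_Suc_D: "Ck_on (Suc k) S f \<Longrightarrow> Ck_on k S f"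
proof (induction k arbitrary: f)
  case 0
  then show ?case
    by (auto simp: continuous_on_eq_continuous_within intro!: differentiable_imp_continuous_within
        intro: differentiable_at_withinI)
next
  case (Suc k)
  then show ?case by auto
qed

lemma Ck_on_const: "Ck_on k S (\<lambda>_. c)"
  by (induction k arbitrary: c) auto

lemma Ck_on_add:
  fixes f g :: "'a::euclidean_space \<Rightarrow> 'b::real_normed_vector"
  assumes "open S" "Ck_on k S f" "Ck_on k S g"
  shows "Ck_on k S (\<lambda>x. f x + g x)"
  using assms(2,3)
proof (induction k arbitrary: f g)
  case 0
  then show ?case by (simp add: continuous_on_add continuous_on_mult)
next
  case (Suc k)
  have eq: "frechet_derivative (\<lambda>x. f x + g x) (at x) w
      = frechet_derivative f (at x) w + frechet_derivative g (at x) w" if "x \<in> S" for x w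
  proof -
    have "((\<lambda>x. f x + g x) has_derivative
        (\<lambda>w. frechet_derivative f (at x) w + frechet_derivative g (at x) w)) (at x)"
      using Suc.prems that by (intro has_derivative_add) (auto simp: frechet_derivative_works)
    then show ?thesis by (simp add: frechet_derivative_at[symmetric])
  qed
  then have "Ck_on k S (\<lambda>x. frechet_derivative (\<lambda>x. f x + g x) (at x) w)" for w
    using Ck_on_cong[OF \<open>open S\<close>, of "\<lambda>x. frechet_derivative (\<lambda>x. f x + g x) (at x) w",
        OF eq[where w = w]] Suc by simp
  then show ?case using Suc.prems by auto
qed

lemma Ck_on_mult:
  fixes f g :: "'a::euclidean_space \<Rightarrow> real"
  assumes "open S" "Ck_on k S f" "Ck_on k S g"
  shows "Ck_on k S (\<lambda>x. f x * g x)"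
  using assms(2,3)
proof (induction k arbitrary: f g)
  case 0
  then show ?case by (simp add: continuous_on_add continuous_on_mult)
next
  case (Suc k)
  have eq: "frechet_derivative (\<lambda>x. f x * g x) (at x) w
      = f x * frechet_derivative g (at x) w + frechet_derivative f (at x) w * g x" if "x \<in> S" for x w
  proof -
    have "((\<lambda>x. f x * g x) has_derivative
        (\<lambda>w. f x * frechet_derivative g (at x) w + frechet_derivative f (at x) w * g x)) (at x)"
      using Suc.prems that by (intro has_derivative_mult) (auto simp: frechet_derivative_works)
    then show ?thesis by (simp add: frechet_derivative_at[symmetric])
  qed
  have "Ck_on k S (\<lambda>x. f x * frechet_derivative g (at x) w + frechet_derivative f (at x) w * g x)" for w
    using Suc.prems Suc.prems[THEN Ck_on_Suc_D]
    by (intro Ck_on_add[OF \<open>open S\<close>] Suc.IH) auto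
  then have "Ck_on k S (\<lambda>x. frechet_derivative (\<lambda>x. f x * g x) (at x) w)" for w
    using Ck_on_cong[OF \<open>open S\<close>, of "\<lambda>x. frechet_derivative (\<lambda>x. f x * g x) (at x) w",
        OF eq[where w = w]] by simp
  then show ?case using Suc.prems by auto
qed

text \<open>By the mean value theorem in the direction \<open>b\<close>, the second difference equals \<open>h\<close> times an
  increment of \<open>q \<mapsto> f' q b\<close> over \<open>h a\<close>.  Both end points tend to \<open>p\<close> at the rate \<open>h\<close>, so the
  derivative at \<open>p\<close> approximates this increment.\<close>

lemma mixed_difference_limit:
  fixes f :: "'a::euclidean_space \<Rightarrow> real"
  assumes S: "open S" "p \<in> S" and f: "\<And>q. q \<in> S \<Longrightarrow> (f has_derivative f' q) (at q)"
    and d: "((\<lambda>q. f' q b) has_derivative d) (at p)"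
  shows "((\<lambda>h. (f (p + h *\<^sub>R a + h *\<^sub>R b) - f (p + h *\<^sub>R a) - f (p + h *\<^sub>R b) + f p) / h\<^sup>2)
      \<longlongrightarrow> d a) (at_right 0)"
proof (rule tendstoI)
  fix r :: real assume "r > 0"
  define N where "N = norm a + norm b + 1"
  have N: "N > 0" by (simp add: N_def add_nonneg_pos)
  \<comment> \<open>the two increments below each cost an error of at most \<open>c h N\<close>, and \<open>2 c N < r\<close>\<close>
  define c where "c = r / (4 * N)"
  have c: "c > 0" using \<open>r > 0\<close> N by (simp add: c_def)
  interpret d: bounded_linear d using d by (rule has_derivative_bounded_linear)
  obtain r1 where r1: "r1 > 0" "\<And>y. norm (y - p) < r1 \<Longrightarrow>
      norm (f' y b - f' p b - d (y - p)) \<le> c * norm (y - p)"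
    using d c unfolding has_derivative_at_alt by blast
  obtain r2 where r2: "r2 > 0" "ball p r2 \<subseteq> S" using S by (meson openE)
  define h0 where "h0 = min r1 r2 / N"
  have "h0 > 0" using r1 r2 N by (simp add: h0_def)
  moreover have "dist ((f (p + h *\<^sub>R a + h *\<^sub>R b) - f (p + h *\<^sub>R a) - f (p + h *\<^sub>R b) + f p) / h\<^sup>2) (d a) < r"
    if h: "0 < h" "h < h0" for h
  proof -
    have hN: "h * N < r1" "h * N < r2" using h N by (auto simp: h0_def field_simps)
    have nb: "norm (s *\<^sub>R a + t *\<^sub>R b) < h * N" if "\<bar>s\<bar> \<le> h" "\<bar>t\<bar> \<le> h" for s t
    proof -
      have "norm (s *\<^sub>R a + t *\<^sub>R b) \<le> \<bar>s\<bar> * norm a + \<bar>t\<bar> * norm b"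
        by (metis norm_scaleR norm_triangle_ineq)
      also have "\<dots> \<le> h * norm a + h * norm b" using that by (intro add_mono mult_right_mono) auto
      also have "\<dots> < h * N" using h by (simp add: N_def algebra_simps)
      finally show ?thesis .
    qed
    have inS: "p + s *\<^sub>R a + t *\<^sub>R b \<in> S" if "\<bar>s\<bar> \<le> h" "\<bar>t\<bar> \<le> h" for s t
    proof -
      have "dist p (p + (s *\<^sub>R a + t *\<^sub>R b)) < r2"
        using nb[OF that] hN by (simp only: dist_norm norm_minus_commute[of p]) simp
      then show ?thesis using r2(2) by (auto simp: add.assoc)
    qed
    define \<psi> where "\<psi> t = f (p + h *\<^sub>R a + t *\<^sub>R b) - f (p + t *\<^sub>R b)" for t
    have der: "(\<psi> has_real_derivative (f' (p + h *\<^sub>R a + t *\<^sub>R b) b - f' (p + t *\<^sub>R b) b)) (at t)"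
      if "0 \<le> t" "t \<le> h" for t
    proof -
      have "((\<lambda>t. f (p + s *\<^sub>R a + t *\<^sub>R b)) has_real_derivative f' (p + s *\<^sub>R a + t *\<^sub>R b) b) (at t)"
        if s: "\<bar>s\<bar> \<le> h" for s
      proof -
        have "((\<lambda>t. p + s *\<^sub>R a + t *\<^sub>R b) has_derivative (\<lambda>x. x *\<^sub>R b)) (at t)"
          by (auto intro!: derivative_eq_intros)
        moreover have "(f has_derivative f' (p + s *\<^sub>R a + t *\<^sub>R b)) (at (p + s *\<^sub>R a + t *\<^sub>R b))"
          using s \<open>0 \<le> t\<close> \<open>t \<le> h\<close> by (intro f inS) auto
        ultimately have "((\<lambda>t. f (p + s *\<^sub>R a + t *\<^sub>R b)) has_derivative
            (\<lambda>x. f' (p + s *\<^sub>R a + t *\<^sub>R b) (x *\<^sub>R b))) (at t)"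
          by (rule has_derivative_compose)
        moreover have "f' (p + s *\<^sub>R a + t *\<^sub>R b) (x *\<^sub>R b) = x * f' (p + s *\<^sub>R a + t *\<^sub>R b) b" for x
          using has_derivative_bounded_linear[OF \<open>(f has_derivative f' (p + s *\<^sub>R a + t *\<^sub>R b)) _\<close>]
          by (simp add: linear_simps bounded_linear.linear)
        ultimately show ?thesis by (simp add: has_field_derivative_def mult_commute_abs)
      qed
      from this[of h] this[of 0] h show ?thesis
        unfolding \<psi>_def by (auto intro: DERIV_diff)
    qed
    \<comment> \<open>the second difference is the increment of \<open>\<psi>\<close> over \<open>[0, h]\<close>\<close>
    obtain t where t: "0 < t" "t < h"
      "\<psi> h - \<psi> 0 = h * (f' (p + h *\<^sub>R a + t *\<^sub>R b) b - f' (p + t *\<^sub>R b) b)"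
      using MVT2[of 0 h \<psi>, OF h(1) der] by auto
    have e1: "\<bar>f' (p + s *\<^sub>R a + t *\<^sub>R b) b - f' p b - d (s *\<^sub>R a + t *\<^sub>R b)\<bar> \<le> c * (h * N)"
      if "\<bar>s\<bar> \<le> h" for s
    proof -
      have "\<bar>f' (p + s *\<^sub>R a + t *\<^sub>R b) b - f' p b - d (s *\<^sub>R a + t *\<^sub>R b)\<bar> \<le> c * norm (s *\<^sub>R a + t *\<^sub>R b)"
        using r1(2)[of "p + s *\<^sub>R a + t *\<^sub>R b"] nb[of s t] that t hN by (auto simp: add.assoc)
      also have "\<dots> \<le> c * (h * N)" using nb[of s t] that t c by (intro mult_left_mono) auto
      finally show ?thesis .
    qed
    have dl: "d (h *\<^sub>R a + t *\<^sub>R b) = h * d a + t * d b" "d (0 *\<^sub>R a + t *\<^sub>R b) = t * d b"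
      by (simp_all add: d.add d.scaleR)
    have "\<bar>(f' (p + h *\<^sub>R a + t *\<^sub>R b) b - f' (p + t *\<^sub>R b) b) - h * d a\<bar> \<le> 2 * (c * (h * N))"
      using e1[of h, unfolded dl] e1[of 0, unfolded dl] h by auto
    then have "\<bar>(f' (p + h *\<^sub>R a + t *\<^sub>R b) b - f' (p + t *\<^sub>R b) b) / h - d a\<bar> \<le> 2 * c * N"
      using h by (simp add: field_simps abs_le_iff)
    moreover have "2 * c * N < r" using \<open>r > 0\<close> N by (simp add: c_def)
    moreover have "(f (p + h *\<^sub>R a + h *\<^sub>R b) - f (p + h *\<^sub>R a) - f (p + h *\<^sub>R b) + f p) / h\<^sup>2
        = (f' (p + h *\<^sub>R a + t *\<^sub>R b) b - f' (p + t *\<^sub>R b) b) / h"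
    proof -
      have "f (p + h *\<^sub>R a + h *\<^sub>R b) - f (p + h *\<^sub>R a) - f (p + h *\<^sub>R b) + f p = \<psi> h - \<psi> 0"
        by (simp add: \<psi>_def)
      then show ?thesis using h by (simp add: t(3) power2_eq_square)
    qed
    ultimately show ?thesis by (simp add: dist_real_def)
  qed
  ultimately show "\<forall>\<^sub>F h in at_right 0. dist ((f (p + h *\<^sub>R a + h *\<^sub>R b) - f (p + h *\<^sub>R a)
      - f (p + h *\<^sub>R b) + f p) / h\<^sup>2) (d a) < r"
    by (auto simp: eventually_at_right_field intro: exI[of _ h0])
qed

text \<open>The second difference is symmetric in the two directions, so both iterated derivatives are its
  limit.\<close>

lemma symmetric_second_derivative:
  fixes f :: "'a::euclidean_space \<Rightarrow> real"
  assumes S: "open S" "p \<in> S" and f: "\<And>q. q \<in> S \<Longrightarrow> (f has_derivative f' q) (at q)"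
    and da: "((\<lambda>q. f' q a) has_derivative da) (at p)"
    and db: "((\<lambda>q. f' q b) has_derivative db) (at p)"
  shows "da b = db a"
proof -
  have "((\<lambda>h. (f (p + h *\<^sub>R a + h *\<^sub>R b) - f (p + h *\<^sub>R a) - f (p + h *\<^sub>R b) + f p) / h\<^sup>2) \<longlongrightarrow> da b)
      (at_right 0)"
    using mixed_difference_limit[OF S f da, of b] by (simp add: algebra_simps)
  from tendsto_unique[OF _ this mixed_difference_limit[OF S f db, of a]] show ?thesis by simp
qed

text \<open>At a zero of \<open>d\<close> the product rule needs only continuity of the other factor.  This is what makes
  second derivatives along vector fields computable at a critical point when the coefficients of
  the fields are only known to be continuous.\<close>

lemma has_derivative_mult_vanishing:
  fixes d c :: "'a::real_normed_vector \<Rightarrow> real"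
  assumes d: "(d has_derivative d') (at p)" "d p = 0" and c: "isCont c p"
  shows "((\<lambda>q. d q * c q) has_derivative (\<lambda>w. d' w * c p)) (at p)"
proof -
  interpret d': bounded_linear d' using d(1) by (rule has_derivative_bounded_linear)
  obtain K where K: "\<And>x. norm (d' x) \<le> norm x * K" "K > 0" using d'.pos_bounded by auto
  have "(\<lambda>y. (d y - d' (y - p)) / norm (y - p)) \<midarrow>p\<rightarrow> 0"
    using d by (auto simp: has_derivative_at_within divide_inverse mult.commute)
  then have 1: "(\<lambda>y. (d y - d' (y - p)) / norm (y - p) * c y) \<midarrow>p\<rightarrow> 0 * c p"
    using c by (intro tendsto_mult) (auto simp: isCont_def)
  have "(\<lambda>y. d' (y - p) / norm (y - p) * (c y - c p)) \<midarrow>p\<rightarrow> 0"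
  proof (rule tendsto_0_le[where K = K])
    show "(\<lambda>y. c y - c p) \<midarrow>p\<rightarrow> 0" using c LIM_zero_iff[of c] by (auto simp: isCont_def)
    show "\<forall>\<^sub>F y in at p. norm (d' (y - p) / norm (y - p) * (c y - c p)) \<le> norm (c y - c p) * K"
    proof (rule always_eventually, rule allI)
      fix y
      have "\<bar>d' (y - p)\<bar> / norm (y - p) \<le> K"
        using K(1)[of "y - p"] K(2) by (cases "y = p") (auto simp: divide_le_eq mult.commute)
      then have "\<bar>d' (y - p)\<bar> / norm (y - p) * \<bar>c y - c p\<bar> \<le> K * \<bar>c y - c p\<bar>"
        by (rule mult_right_mono) simp
      then show "norm (d' (y - p) / norm (y - p) * (c y - c p)) \<le> norm (c y - c p) * K"
        by (simp add: abs_mult mult.commute)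
    qed
  qed
  from tendsto_add[OF 1 this]
  have "(\<lambda>y. (d y * c y - d p * c p - d' (y - p) * c p) / norm (y - p)) \<midarrow>p\<rightarrow> 0"
    using d(2) by (simp add: diff_divide_distrib[symmetric] add_divide_distrib[symmetric] algebra_simps)
  then show ?thesis
    by (auto simp: has_derivative_at_within divide_inverse mult.commute
        intro!: bounded_linear_const_mult d'.bounded_linear_axioms)
qed


section \<open>Smooth functions, vector fields and one-forms\<close>

lemma sum_fun_apply: "(\<Sum>a\<in>I. f a) x = (\<Sum>a\<in>I. f a x)"
  by (induction I rule: infinite_finite_induct) auto

lemma smooth_on_openD: "smooth_on S f \<Longrightarrow> open S \<Longrightarrow> q \<in> S \<Longrightarrow>
    (f has_derivative frechet_derivative f (at q)) (at q)"
  using frechet_derivative_works unfolding smooth_on_def by (metis Ck_on.simps(2))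

lemma smooth_on_derivative: "smooth_on S f \<Longrightarrow> smooth_on S (\<lambda>x. frechet_derivative f (at x) w)"
  unfolding smooth_on_def by (metis Ck_on.simps(2))

locale manifold =
  fixes \<A> :: "('g::{t2_space, second_countable_topology}, 'e::euclidean_space) chart set"
  assumes atlas: "smooth_atlas \<A>"
begin

lemma chart_cover: obtains U \<phi> where "(U, \<phi>) \<in> \<A>" "x \<in> U"
proof -
  have "x \<in> (\<Union>(U, \<phi>)\<in>\<A>. U)" using atlas by (simp add: smooth_atlas_def)
  then show ?thesis using that by auto
qed

lemma chart_open: "(U, \<phi>) \<in> \<A> \<Longrightarrow> open U" "(U, \<phi>) \<in> \<A> \<Longrightarrow> open (\<phi> ` U)"
  and chart_homeo: "(U, \<phi>) \<in> \<A> \<Longrightarrow> homeomorphism U (\<phi> ` U) \<phi> (inv_into U \<phi>)"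
  using atlas unfolding smooth_atlas_def by auto

lemma chart_inv: "(U, \<phi>) \<in> \<A> \<Longrightarrow> x \<in> U \<Longrightarrow> inv_into U \<phi> (\<phi> x) = x"
  using chart_homeo homeomorphism_apply1 by blast

lemma chart_image_open:
  assumes "(U, \<phi>) \<in> \<A>" "open V"
  shows "open (\<phi> ` (U \<inter> V))"
proof -
  have "openin (top_of_set (\<phi> ` U)) (\<phi> ` (U \<inter> V))"
    using chart_homeo[OF assms(1)] openin_open_Int[OF assms(2)]
    by (rule homeomorphism_imp_open_map)
  then show ?thesis using chart_open(2)[OF assms(1)] openin_open_trans by blast
qed

lemma chart_transition: "(U, \<phi>) \<in> \<A> \<Longrightarrow> (V, \<psi>) \<in> \<A> \<Longrightarrow> smooth_on (\<phi> ` (U \<inter> V)) (\<psi> \<circ> inv_into U \<phi>)"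
  using atlas unfolding smooth_atlas_def by blast

lemma smooth_funsD: "f \<in> smooth_funs \<A> \<Longrightarrow> (U, \<phi>) \<in> \<A> \<Longrightarrow> smooth_on (\<phi> ` U) (f \<circ> inv_into U \<phi>)"
  unfolding smooth_funs_def by auto

lemma smooth_const: "(\<lambda>_. c) \<in> smooth_funs \<A>"
  by (auto simp: smooth_funs_def smooth_on_def comp_def Ck_on_const)

lemma smooth_add: "f \<in> smooth_funs \<A> \<Longrightarrow> h \<in> smooth_funs \<A> \<Longrightarrow> f + h \<in> smooth_funs \<A>"
  using Ck_on_add[OF chart_open(2)] by (fastforce simp: smooth_funs_def smooth_on_def comp_def)

lemma smooth_mult: "f \<in> smooth_funs \<A> \<Longrightarrow> h \<in> smooth_funs \<A> \<Longrightarrow> f * h \<in> smooth_funs \<A>"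
  using Ck_on_mult[OF chart_open(2)] by (fastforce simp: smooth_funs_def smooth_on_def comp_def)

lemma smooth_0: "0 \<in> smooth_funs \<A>" and smooth_1: "1 \<in> smooth_funs \<A>"
  using smooth_const by (auto simp: zero_fun_def one_fun_def)

lemma smooth_scaleR: "f \<in> smooth_funs \<A> \<Longrightarrow> c *\<^sub>R f \<in> smooth_funs \<A>"
  using smooth_mult[OF smooth_const[of c], of f] by (simp add: scaleR_fun_def times_fun_def)

lemma smooth_uminus: "f \<in> smooth_funs \<A> \<Longrightarrow> - f \<in> smooth_funs \<A>"
  using smooth_scaleR[of f "-1"] by simp

lemma smooth_diff: "f \<in> smooth_funs \<A> \<Longrightarrow> h \<in> smooth_funs \<A> \<Longrightarrow> f - h \<in> smooth_funs \<A>"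
  using smooth_add[of f "- h"] smooth_uminus[of h] by simp

lemma smooth_sum: "(\<And>a. a \<in> I \<Longrightarrow> f a \<in> smooth_funs \<A>) \<Longrightarrow> sum f I \<in> smooth_funs \<A>"
  by (induction I rule: infinite_finite_induct) (auto intro: smooth_0 smooth_add)

lemmas smooth_intros = smooth_const smooth_0 smooth_1 smooth_add smooth_diff smooth_uminus
  smooth_mult smooth_scaleR smooth_sum

lemma chart_derivative:
  assumes "(U, \<phi>) \<in> \<A>" "x \<in> U" "f \<in> smooth_funs \<A>"
  shows "((f \<circ> inv_into U \<phi>) has_derivative frechet_derivative (f \<circ> inv_into U \<phi>) (at (\<phi> x))) (at (\<phi> x))"
  using smooth_on_openD[OF smooth_funsD[OF assms(3,1)] chart_open(2)[OF assms(1)]] assms(2) by blast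

text \<open>By the chain rule for the transition map, every chart around \<open>x\<close> yields all tangent vectors at
  \<open>x\<close>.  Hence tangent vectors can be added, although the definition lets each of them use a chart
  of its own.\<close>

lemma tangent_space_chart:
  assumes c: "(U, \<phi>) \<in> \<A>" "x \<in> U"
  shows "t \<in> tangent_space \<A> x \<longleftrightarrow>
    (\<exists>w. t = restrict0 (smooth_funs \<A>) (\<lambda>f. frechet_derivative (f \<circ> inv_into U \<phi>) (at (\<phi> x)) w))"
proof
  assume "t \<in> tangent_space \<A> x"
  then obtain V \<psi> w where V: "(V, \<psi>) \<in> \<A>" "x \<in> V" and
    t: "t = restrict0 (smooth_funs \<A>) (\<lambda>f. frechet_derivative (f \<circ> inv_into V \<psi>) (at (\<psi> x)) w)"
    unfolding tangent_space_def by blast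
  define \<tau> where "\<tau> = \<phi> \<circ> inv_into V \<psi>"
  have o: "open (\<psi> ` (V \<inter> U))" "\<psi> x \<in> \<psi> ` (V \<inter> U)"
    using chart_image_open[OF V(1) chart_open(1)[OF c(1)]] c V by auto
  have d\<tau>: "(\<tau> has_derivative frechet_derivative \<tau> (at (\<psi> x))) (at (\<psi> x))"
    using smooth_on_openD[OF chart_transition[OF V(1) c(1)] o] by (simp add: \<tau>_def)
  have "frechet_derivative (f \<circ> inv_into V \<psi>) (at (\<psi> x)) w
     = frechet_derivative (f \<circ> inv_into U \<phi>) (at (\<phi> x)) (frechet_derivative \<tau> (at (\<psi> x)) w)"
    if f: "f \<in> smooth_funs \<A>" for f
  proof -
    have "\<tau> (\<psi> x) = \<phi> x" using V by (simp add: \<tau>_def chart_inv)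
    then have "((\<lambda>p. (f \<circ> inv_into U \<phi>) (\<tau> p)) has_derivative
        (\<lambda>w. frechet_derivative (f \<circ> inv_into U \<phi>) (at (\<phi> x)) (frechet_derivative \<tau> (at (\<psi> x)) w))) (at (\<psi> x))"
      using has_derivative_compose[OF d\<tau>] chart_derivative[OF c f] by metis
    moreover have "(f \<circ> inv_into U \<phi>) (\<tau> p) = (f \<circ> inv_into V \<psi>) p" if "p \<in> \<psi> ` (V \<inter> U)" for p
      using that c V by (auto simp: \<tau>_def chart_inv)
    ultimately have "((f \<circ> inv_into V \<psi>) has_derivative
        (\<lambda>w. frechet_derivative (f \<circ> inv_into U \<phi>) (at (\<phi> x)) (frechet_derivative \<tau> (at (\<psi> x)) w))) (at (\<psi> x))"
      using has_derivative_transform_within_open[OF _ o, of "\<lambda>p. (f \<circ> inv_into U \<phi>) (\<tau> p)"] by blast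
    then show ?thesis by (simp add: frechet_derivative_at[symmetric])
  qed
  then show "\<exists>w. t = restrict0 (smooth_funs \<A>) (\<lambda>f. frechet_derivative (f \<circ> inv_into U \<phi>) (at (\<phi> x)) w)"
    unfolding t restrict0_def
    by (intro exI[of _ "frechet_derivative \<tau> (at (\<psi> x)) w"]) (simp add: fun_eq_iff)
next
  assume "\<exists>w. t = restrict0 (smooth_funs \<A>) (\<lambda>f. frechet_derivative (f \<circ> inv_into U \<phi>) (at (\<phi> x)) w)"
  then show "t \<in> tangent_space \<A> x" using c unfolding tangent_space_def by blast
qed

lemma tangent_space_nonsmooth: "t \<in> tangent_space \<A> x \<Longrightarrow> f \<notin> smooth_funs \<A> \<Longrightarrow> t f = 0"
  unfolding tangent_space_def restrict0_def by auto

lemma tangent_space_derivation: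
  assumes t: "t \<in> tangent_space \<A> x" and f: "f \<in> smooth_funs \<A>" and h: "h \<in> smooth_funs \<A>"
  shows "t (f + h) = t f + t h" "t (f * h) = f x * t h + t f * h x" "t (\<lambda>_. c) = 0"
proof -
  obtain U \<phi> where c: "(U, \<phi>) \<in> \<A>" "x \<in> U" using chart_cover .
  then obtain w where t: "t = restrict0 (smooth_funs \<A>) (\<lambda>f. frechet_derivative (f \<circ> inv_into U \<phi>) (at (\<phi> x)) w)"
    using t tangent_space_chart by blast
  note d = chart_derivative[OF c f] chart_derivative[OF c h]
  have e: "(f \<circ> inv_into U \<phi>) (\<phi> x) = f x" "(h \<circ> inv_into U \<phi>) (\<phi> x) = h x"
    using c by (simp_all add: chart_inv)
  have "(f + h) \<circ> inv_into U \<phi> = (\<lambda>p. (f \<circ> inv_into U \<phi>) p + (h \<circ> inv_into U \<phi>) p)"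
    "(f * h) \<circ> inv_into U \<phi> = (\<lambda>p. (f \<circ> inv_into U \<phi>) p * (h \<circ> inv_into U \<phi>) p)"
    "(\<lambda>_. c) \<circ> inv_into U \<phi> = (\<lambda>_. c)"
    by auto
  moreover note fun_cong[OF has_derivative_add[OF d, THEN frechet_derivative_at], of w]
    fun_cong[OF has_derivative_mult[OF d, THEN frechet_derivative_at], of w]
  ultimately show "t (f + h) = t f + t h" "t (f * h) = f x * t h + t f * h x" "t (\<lambda>_. c) = 0"
    using f h e by (simp_all add: t restrict0_def smooth_intros)
qed

lemma tangent_space_add:
  assumes "t \<in> tangent_space \<A> x" "s \<in> tangent_space \<A> x"
  shows "(\<lambda>f. t f + s f) \<in> tangent_space \<A> x"
proof -
  obtain U \<phi> where c: "(U, \<phi>) \<in> \<A>" "x \<in> U" using chart_cover .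
  obtain w1 w2 where
    t: "t = restrict0 (smooth_funs \<A>) (\<lambda>f. frechet_derivative (f \<circ> inv_into U \<phi>) (at (\<phi> x)) w1)"
    and s: "s = restrict0 (smooth_funs \<A>) (\<lambda>f. frechet_derivative (f \<circ> inv_into U \<phi>) (at (\<phi> x)) w2)"
    using assms tangent_space_chart[OF c] by blast
  show ?thesis unfolding tangent_space_chart[OF c]
    using linear_add[OF chart_derivative[OF c, THEN has_derivative_linear]]
    by (intro exI[of _ "w1 + w2"]) (simp add: fun_eq_iff t s restrict0_def)
qed

lemma tangent_space_scale:
  assumes "t \<in> tangent_space \<A> x"
  shows "(\<lambda>f. c * t f) \<in> tangent_space \<A> x"
proof -
  obtain U \<phi> where c: "(U, \<phi>) \<in> \<A>" "x \<in> U" using chart_cover .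
  obtain w1 where
    t: "t = restrict0 (smooth_funs \<A>) (\<lambda>f. frechet_derivative (f \<circ> inv_into U \<phi>) (at (\<phi> x)) w1)"
    using assms tangent_space_chart[OF c] by blast
  show ?thesis unfolding tangent_space_chart[OF c]
    using linear_scale[OF chart_derivative[OF c, THEN has_derivative_linear]]
    by (intro exI[of _ "c *\<^sub>R w1"]) (simp add: fun_eq_iff t restrict0_def)
qed

lemma vf_smooth: "X \<in> vector_fields \<A> \<Longrightarrow> f \<in> smooth_funs \<A> \<Longrightarrow> X f \<in> smooth_funs \<A>"
  and vf_tangent: "X \<in> vector_fields \<A> \<Longrightarrow> (\<lambda>f. X f x) \<in> tangent_space \<A> x"
  by (auto simp: vector_fields_def)

lemma vf_derivation:
  assumes "X \<in> vector_fields \<A>" "f \<in> smooth_funs \<A>" "h \<in> smooth_funs \<A>"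
  shows "X (f + h) = X f + X h" "X (f * h) = f * X h + X f * h"
  using tangent_space_derivation[OF vf_tangent[OF assms(1)] assms(2,3)] by auto

lemma vf_const: "X \<in> vector_fields \<A> \<Longrightarrow> X (\<lambda>_. c) = 0"
  using tangent_space_derivation(3)[OF vf_tangent smooth_0 smooth_0] by auto

lemma vf_zero_arg: "X \<in> vector_fields \<A> \<Longrightarrow> X 0 = 0"
  using vf_const[of X 0] by (simp add: zero_fun_def)

lemma vf_nonsmooth: "X \<in> vector_fields \<A> \<Longrightarrow> f \<notin> smooth_funs \<A> \<Longrightarrow> X f = 0"
  using tangent_space_nonsmooth[OF vf_tangent] by (auto simp: fun_eq_iff)

lemma vf_scaleR_arg:
  assumes "X \<in> vector_fields \<A>" "f \<in> smooth_funs \<A>" shows "X (c *\<^sub>R f) = c *\<^sub>R X f"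
  using vf_derivation(2)[OF assms(1) smooth_const[of c] assms(2)] vf_const[OF assms(1), of c]
  by (simp add: fun_eq_iff scaleR_fun_def times_fun_def)

lemma vf_uminus_arg:
  assumes "X \<in> vector_fields \<A>" "f \<in> smooth_funs \<A>" shows "X (- f) = - X f"
  using vf_scaleR_arg[OF assms, of "-1"] by simp

lemma vf_diff_arg:
  assumes "X \<in> vector_fields \<A>" "f \<in> smooth_funs \<A>" "h \<in> smooth_funs \<A>"
  shows "X (f - h) = X f - X h"
  using vf_derivation(1)[OF assms(1,2), of "- h"] vf_uminus_arg[OF assms(1,3)] assms
  by (simp add: smooth_intros)

lemma vf_sum_arg:
  assumes "X \<in> vector_fields \<A>" "\<And>a. a \<in> I \<Longrightarrow> f a \<in> smooth_funs \<A>"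
  shows "X (\<Sum>a\<in>I. f a) = (\<Sum>a\<in>I. X (f a))"
  using assms(2)
  by (induction I rule: infinite_finite_induct)
    (auto simp: vf_zero_arg[OF assms(1)] vf_derivation[OF assms(1)] smooth_intros)

lemma vf_0: "0 \<in> vector_fields \<A>"
proof -
  have "(\<lambda>f. 0) \<in> tangent_space \<A> x" for x
  proof -
    obtain U \<phi> where c: "(U, \<phi>) \<in> \<A>" "x \<in> U" using chart_cover .
    then have "restrict0 (smooth_funs \<A>) (\<lambda>f. frechet_derivative (f \<circ> inv_into U \<phi>) (at (\<phi> x)) 0) \<in> tangent_space \<A> x"
      unfolding tangent_space_def by blast
    from tangent_space_scale[OF this, of 0] show ?thesis by simp
  qed
  then show ?thesis by (auto simp: vector_fields_def smooth_intros)
qed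

lemma vf_add: "X \<in> vector_fields \<A> \<Longrightarrow> Y \<in> vector_fields \<A> \<Longrightarrow> X + Y \<in> vector_fields \<A>"
  unfolding vector_fields_def by (auto intro!: smooth_intros tangent_space_add)

lemma vf_smult: "f \<in> smooth_funs \<A> \<Longrightarrow> X \<in> vector_fields \<A> \<Longrightarrow> vf_smult f X \<in> vector_fields \<A>"
  unfolding vector_fields_def vf_smult_def by (auto intro!: smooth_intros tangent_space_scale)

lemma vf_sum: "(\<And>a. a \<in> I \<Longrightarrow> X a \<in> vector_fields \<A>) \<Longrightarrow> sum X I \<in> vector_fields \<A>"
  by (induction I rule: infinite_finite_induct) (auto intro: vf_0 vf_add)

lemma one_form_smooth: "\<xi> \<in> one_forms \<A> \<Longrightarrow> X \<in> vector_fields \<A> \<Longrightarrow> \<xi> X \<in> smooth_funs \<A>"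
  and one_form_add: "\<xi> \<in> one_forms \<A> \<Longrightarrow> X \<in> vector_fields \<A> \<Longrightarrow> Y \<in> vector_fields \<A> \<Longrightarrow> \<xi> (X + Y) = \<xi> X + \<xi> Y"
  and one_form_smult: "\<xi> \<in> one_forms \<A> \<Longrightarrow> X \<in> vector_fields \<A> \<Longrightarrow> f \<in> smooth_funs \<A> \<Longrightarrow> \<xi> (vf_smult f X) = f * \<xi> X"
  and one_form_outside: "\<xi> \<in> one_forms \<A> \<Longrightarrow> X \<notin> vector_fields \<A> \<Longrightarrow> \<xi> X = 0"
  unfolding one_forms_def by blast+

lemma one_form_zero: "\<xi> \<in> one_forms \<A> \<Longrightarrow> \<xi> 0 = 0"
  using one_form_add[of \<xi>, OF _ vf_0 vf_0] by (metis add.right_neutral add_left_cancel)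

lemma one_form_sum:
  assumes "\<xi> \<in> one_forms \<A>" "\<And>a. a \<in> I \<Longrightarrow> X a \<in> vector_fields \<A>"
  shows "\<xi> (\<Sum>a\<in>I. X a) = (\<Sum>a\<in>I. \<xi> (X a))"
  using assms(2)
  by (induction I rule: infinite_finite_induct)
    (auto simp: one_form_zero[OF assms(1)] one_form_add[OF assms(1)] vf_sum)

end


section \<open>Commutators and expansions in a global frame of vector fields\<close>

lemma linear_as_inner:
  fixes L :: "'a::euclidean_space \<Rightarrow> real"
  assumes "linear L"
  obtains z where "\<And>u. L u = z \<bullet> u"
  using adjoint_works[OF assms, of _ 1] by (metis inner_commute inner_real_def mult.right_neutral)

lemma linear_euclidean_sum:
  fixes L :: "'a::euclidean_space \<Rightarrow> real"
  assumes "linear L"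
  shows "L u = (\<Sum>j\<in>Basis. L j * (u \<bullet> j))"
proof -
  have "L u = L (\<Sum>j\<in>Basis. (u \<bullet> j) *\<^sub>R j)" by (simp add: euclidean_representation)
  also have "\<dots> = (\<Sum>j\<in>Basis. (u \<bullet> j) * L j)"
    by (simp add: linear_sum[OF assms] linear_scale[OF assms])
  finally show ?thesis by (simp add: mult.commute)
qed

text \<open>Linear algebra for families instead of sets: the family may a priori have repetitions, which
  independence excludes.\<close>

lemma family_spans:
  fixes w :: "nat \<Rightarrow> 'a::euclidean_space"
  assumes I: "finite I" "card I = DIM('a)"
    and indep: "\<And>c. (\<Sum>a\<in>I. c a *\<^sub>R w a) = 0 \<Longrightarrow> \<forall>a\<in>I. c a = (0::real)"
  obtains c where "u = (\<Sum>a\<in>I. c a *\<^sub>R w a)"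
proof -
  have inj: "inj_on w I"
  proof (rule inj_onI, rule ccontr)
    fix a b assume ab: "a \<in> I" "b \<in> I" "w a = w b" "a \<noteq> b"
    define c :: "nat \<Rightarrow> real" where "c i = (if i = a then 1 else 0) - (if i = b then 1 else 0)" for i
    have "(\<Sum>i\<in>I. c i *\<^sub>R w i) = (\<Sum>i\<in>I. (if i = a then w a else 0) - (if i = b then w b else 0))"
      by (rule sum.cong) (auto simp: c_def)
    also have "\<dots> = w a - w b" using ab I by (simp add: sum_subtractf sum.delta)
    finally have "c a = 0" using indep[of c] ab by auto
    then show False using ab by (simp add: c_def)
  qed
  have ind: "independent (w ` I)"
  proof
    assume "dependent (w ` I)"
    then obtain d x where d: "x \<in> w ` I" "d x \<noteq> 0" "(\<Sum>v\<in>w ` I. d v *\<^sub>R v) = (0::'a)"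
      using dependent_finite[of "w ` I"] I by auto
    from d(3) have "(\<Sum>a\<in>I. d (w a) *\<^sub>R w a) = 0" by (simp add: sum.reindex[OF inj])
    from indep[OF this] d show False by auto
  qed
  have "UNIV \<subseteq> span (w ` I)"
    using I card_image[OF inj] by (intro card_ge_dim_independent ind) auto
  then have "u \<in> range (\<lambda>d. \<Sum>v\<in>w ` I. d v *\<^sub>R v)" using span_finite[of "w ` I"] I by auto
  then obtain d where "u = (\<Sum>v\<in>w ` I. d v *\<^sub>R v)" by blast
  then have "u = (\<Sum>a\<in>I. d (w a) *\<^sub>R w a)" by (simp add: sum.reindex[OF inj])
  then show ?thesis by (rule that)
qed

lemma smooth_on_isCont: "smooth_on S f \<Longrightarrow> open S \<Longrightarrow> q \<in> S \<Longrightarrow> isCont f q"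
  using smooth_on_openD has_derivative_continuous by blast

text \<open>A manifold with a global frame of its tangent bundle: \<open>n\<close> vector fields, with \<open>n\<close> the dimension,
  that are linearly independent at every point.\<close>

locale parallelized = manifold \<A>
  for \<A> :: "('g::{t2_space, second_countable_topology}, 'e::euclidean_space) chart set" +
  fixes n :: nat and v :: "nat \<Rightarrow> 'g vf"
  assumes dim: "DIM('e) = n"
    and frame_vf: "a \<in> {1..n} \<Longrightarrow> v a \<in> vector_fields \<A>"
    and frame_indep: "(\<And>f. f \<in> smooth_funs \<A> \<Longrightarrow> (\<Sum>a=1..n. c a * v a f x) = 0) \<Longrightarrow> a \<in> {1..n} \<Longrightarrow> c a = 0"
begin

text \<open>In a chart the frame at \<open>x\<close> is given by \<open>n\<close> vectors of an \<open>n\<close>-dimensional space.  A linear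
  relation between them would be one between the derivations, so they form a basis.\<close>

lemma frame_in_chart:
  assumes c: "(U, \<phi>) \<in> \<A>" "x \<in> U"
  obtains w where
    "\<And>a f. a \<in> {1..n} \<Longrightarrow> f \<in> smooth_funs \<A> \<Longrightarrow>
       v a f x = frechet_derivative (f \<circ> inv_into U \<phi>) (at (\<phi> x)) (w a)"
    "\<And>u. \<exists>c. u = (\<Sum>a=1..n. c a *\<^sub>R w a)"
proof -
  have "\<forall>a\<in>{1..n}. \<exists>w. (\<lambda>f. v a f x) = restrict0 (smooth_funs \<A>)
      (\<lambda>f. frechet_derivative (f \<circ> inv_into U \<phi>) (at (\<phi> x)) w)"
    using vf_tangent[OF frame_vf] tangent_space_chart[OF c] by blast
  then obtain w where w: "\<And>a. a \<in> {1..n} \<Longrightarrow> (\<lambda>f. v a f x) = restrict0 (smooth_funs \<A>)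
      (\<lambda>f. frechet_derivative (f \<circ> inv_into U \<phi>) (at (\<phi> x)) (w a))"
    by metis
  have 1: "v a f x = frechet_derivative (f \<circ> inv_into U \<phi>) (at (\<phi> x)) (w a)"
    if "a \<in> {1..n}" "f \<in> smooth_funs \<A>" for a f
    using fun_cong[OF w[OF that(1)], of f] that by (simp add: restrict0_def)
  have "\<forall>a\<in>{1..n}. c a = 0" if s: "(\<Sum>a=1..n. c a *\<^sub>R w a) = 0" for c
  proof
    fix a assume a: "a \<in> {1..n}"
    show "c a = 0"
    proof (rule frame_indep[OF _ a])
      fix f assume f: "f \<in> smooth_funs \<A>"
      note lin = has_derivative_linear[OF chart_derivative[OF c f]]
      have "(\<Sum>a=1..n. c a * v a f x)
          = frechet_derivative (f \<circ> inv_into U \<phi>) (at (\<phi> x)) (\<Sum>a=1..n. c a *\<^sub>R w a)"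
        using f by (simp add: linear_sum[OF lin] linear_scale[OF lin] 1)
      then show "(\<Sum>a=1..n. c a * v a f x) = 0" unfolding s by (simp add: linear_0[OF lin])
    qed
  qed
  then have "\<exists>c. u = (\<Sum>a=1..n. c a *\<^sub>R w a)" for u
    by (rule family_spans[of "{1..n}" w u, rotated 2]) (auto simp: dim)
  then show ?thesis using 1 that by blast
qed

text \<open>The differentials at \<open>x\<close> of global smooth functions form a subspace of the dual space.  A vector
  that all of them annihilate is a combination of the frame which kills all smooth functions, so
  it is \<open>0\<close> by pointwise independence; hence the subspace is everything.  The functions obtained
  serve as local coordinates that are defined globally.\<close>

lemma coordinate_functions:
  assumes c: "(U, \<phi>) \<in> \<A>" "x \<in> U"
  obtains y where
    "\<And>i. i \<in> Basis \<Longrightarrow> y i \<in> smooth_funs \<A>"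
    "\<And>i u. i \<in> Basis \<Longrightarrow> frechet_derivative (y i \<circ> inv_into U \<phi>) (at (\<phi> x)) u = u \<bullet> i"
proof -
  let ?d = "\<lambda>f. frechet_derivative (f \<circ> inv_into U \<phi>) (at (\<phi> x))"
  define G where "G = {z. \<exists>f\<in>smooth_funs \<A>. \<forall>u. ?d f u = z \<bullet> u}"
  note lin = has_derivative_linear[OF chart_derivative[OF c]]
  have comp: "(f + h) \<circ> inv_into U \<phi> = (\<lambda>p. (f \<circ> inv_into U \<phi>) p + (h \<circ> inv_into U \<phi>) p)"
    "(r *\<^sub>R f) \<circ> inv_into U \<phi> = (\<lambda>p. r *\<^sub>R (f \<circ> inv_into U \<phi>) p)" for f h :: "'g scal" and r
    by (auto simp: scaleR_fun_def)
  have "subspace G"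
    unfolding subspace_def
  proof (intro conjI ballI allI)
    show "0 \<in> G" unfolding G_def
      by (auto intro!: bexI[of _ "\<lambda>_. 0"] smooth_const simp: comp_def)
    show "z + z' \<in> G" if z: "z \<in> G" "z' \<in> G" for z z'
    proof -
      obtain f f' where f: "f \<in> smooth_funs \<A>" "f' \<in> smooth_funs \<A>" "\<And>u. ?d f u = z \<bullet> u" "\<And>u. ?d f' u = z' \<bullet> u"
        using z unfolding G_def by auto
      have "?d (f + f') u = (z + z') \<bullet> u" for u
        using fun_cong[OF has_derivative_add[OF chart_derivative[OF c f(1)] chart_derivative[OF c f(2)],
              THEN frechet_derivative_at], of u]
        unfolding comp by (simp add: f(3,4) inner_add_left)
      then show ?thesis using f smooth_add unfolding G_def by blast
    qed
    show "r *\<^sub>R z \<in> G" if z: "z \<in> G" for r z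
    proof -
      obtain f where f: "f \<in> smooth_funs \<A>" "\<And>u. ?d f u = z \<bullet> u"
        using z unfolding G_def by auto
      have "?d (r *\<^sub>R f) u = (r *\<^sub>R z) \<bullet> u" for u
        using fun_cong[OF has_derivative_scaleR_right[OF chart_derivative[OF c f(1)],
              THEN frechet_derivative_at], of r u]
        unfolding comp by (simp add: f(2))
      then show ?thesis using f smooth_scaleR unfolding G_def by blast
    qed
  qed
  moreover have "dim G = DIM('e)"
  proof (rule ccontr)
    assume "dim G \<noteq> DIM('e)"
    then have "dim G < DIM('e)" using dim_subset_UNIV[of G] by linarith
    then obtain u where u: "u \<noteq> 0" "\<And>z. z \<in> span G \<Longrightarrow> orthogonal u z"
      using orthogonal_to_subspace_exists[of G] by blast
    have du: "?d f u = 0" if f: "f \<in> smooth_funs \<A>" for f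
    proof -
      obtain z where z: "\<And>u. ?d f u = z \<bullet> u" using linear_as_inner[OF lin[OF f]] by blast
      then have "z \<in> G" using f unfolding G_def by blast
      from u(2)[OF span_base[OF this]] show ?thesis by (simp add: z orthogonal_def inner_commute)
    qed
    obtain w where w: "\<And>a f. a \<in> {1..n} \<Longrightarrow> f \<in> smooth_funs \<A> \<Longrightarrow> v a f x = ?d f (w a)"
      and sp: "\<And>u. \<exists>c. u = (\<Sum>a=1..n. c a *\<^sub>R w a)"
      using frame_in_chart[OF c] by blast
    obtain k where k: "u = (\<Sum>a=1..n. k a *\<^sub>R w a)" using sp by blast
    have "(\<Sum>a=1..n. k a * v a f x) = 0" if f: "f \<in> smooth_funs \<A>" for f
      using du[OF f] f unfolding k by (simp add: linear_sum[OF lin[OF f]] linear_scale[OF lin[OF f]] w)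
    then have "k a = 0" if "a \<in> {1..n}" for a using frame_indep that by blast
    then have "u = 0" unfolding k by simp
    then show False using u by simp
  qed
  ultimately have "G = UNIV" by (metis dim_eq_full span_eq_iff)
  then have "\<forall>i\<in>Basis. \<exists>f\<in>smooth_funs \<A>. \<forall>u. ?d f u = i \<bullet> u" unfolding G_def by auto
  then obtain y where "\<forall>i\<in>Basis. y i \<in> smooth_funs \<A> \<and> (\<forall>u. ?d (y i) u = i \<bullet> u)" by metis
  then show ?thesis using that[of y] by (simp add: inner_commute)
qed

text \<open>With global functions \<open>y\<^sub>i\<close> whose differentials at \<open>x\<close> are the standard coordinates, the vector
  \<open>z q\<close> with the continuous components \<open>Y y\<^sub>i\<close> is the image of \<open>A q\<close> under a linear map that tends
  to the identity as \<open>q\<close> tends to \<open>\<phi> x\<close>.  So \<open>z q\<close> and \<open>A q\<close> have the same limit.\<close>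

lemma vf_chart_continuous:
  assumes c: "(U, \<phi>) \<in> \<A>" "x \<in> U" and Y: "Y \<in> vector_fields \<A>"
    and A: "\<And>q f. q \<in> \<phi> ` U \<Longrightarrow> f \<in> smooth_funs \<A> \<Longrightarrow>
       Y f (inv_into U \<phi> q) = frechet_derivative (f \<circ> inv_into U \<phi>) (at q) (A q)"
  shows "isCont A (\<phi> x)"
proof -
  let ?d = "\<lambda>f q. frechet_derivative (f \<circ> inv_into U \<phi>) (at q)"
  let ?p = "\<phi> x"
  have p: "open (\<phi> ` U)" "?p \<in> \<phi> ` U" using chart_open c by auto
  obtain y where y: "\<And>i. i \<in> Basis \<Longrightarrow> y i \<in> smooth_funs \<A>"
    "\<And>i u. i \<in> Basis \<Longrightarrow> ?d (y i) ?p u = u \<bullet> i"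
    using coordinate_functions[OF c] by blast
  \<comment> \<open>\<open>m q\<close> bounds the norm of the difference between that linear map and the identity\<close>
  define m where "m q = (\<Sum>i\<in>Basis. \<Sum>j\<in>Basis. \<bar>?d (y i) q j - j \<bullet> i\<bar>)" for q
  define z where "z q = (\<Sum>i\<in>Basis. (Y (y i) \<circ> inv_into U \<phi>) q *\<^sub>R i)" for q
  have "isCont (\<lambda>q. ?d (y i) q j) ?p" if "i \<in> Basis" for i j
    using smooth_on_isCont[OF smooth_on_derivative[OF smooth_funsD[OF y(1)[OF that] c(1)]] p] .
  then have "isCont m ?p" unfolding m_def by (intro continuous_intros) auto
  moreover have "m ?p = 0" by (simp add: m_def y(2))
  ultimately have m0: "(m \<longlongrightarrow> 0) (at ?p)" by (simp add: isCont_def)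
  have "isCont z ?p" unfolding z_def
    using smooth_on_isCont[OF smooth_funsD[OF vf_smooth[OF Y y(1)] c(1)] p]
    by (intro continuous_sum continuous_scaleR continuous_const) (simp_all only:)
  then have z0: "(z \<longlongrightarrow> z ?p) (at ?p)" by (simp add: isCont_def)
  have zA: "norm (z q - A q) \<le> m q * norm (A q)" if q: "q \<in> \<phi> ` U" for q
  proof -
    have "z q - A q = (\<Sum>i\<in>Basis. (Y (y i) \<circ> inv_into U \<phi>) q *\<^sub>R i) - (\<Sum>i\<in>Basis. (A q \<bullet> i) *\<^sub>R i)"
      by (simp add: z_def euclidean_representation)
    also have "\<dots> = (\<Sum>i\<in>Basis. (?d (y i) q (A q) - A q \<bullet> i) *\<^sub>R i)"
      using y q by (simp add: A scaleR_diff_left sum_subtractf)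
    also have "norm \<dots> \<le> (\<Sum>i\<in>Basis. norm ((?d (y i) q (A q) - A q \<bullet> i) *\<^sub>R i))"
      by (rule norm_sum)
    also have "\<dots> = (\<Sum>i\<in>Basis. \<bar>?d (y i) q (A q) - A q \<bullet> i\<bar>)"
      by simp
    also have "\<dots> \<le> (\<Sum>i\<in>Basis. \<Sum>j\<in>Basis. \<bar>?d (y i) q j - j \<bullet> i\<bar> * norm (A q))"
    proof (rule sum_mono)
      fix i :: 'e assume i: "i \<in> Basis"
      have lin: "linear (?d (y i) q)"
        using smooth_on_openD[OF smooth_funsD[OF y(1)[OF i] c(1)] p(1) q] by (rule has_derivative_linear)
      have "?d (y i) q (A q) - A q \<bullet> i = (\<Sum>j\<in>Basis. ?d (y i) q j * (A q \<bullet> j)) - (\<Sum>j\<in>Basis. (j \<bullet> i) * (A q \<bullet> j))"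
        using linear_euclidean_sum[OF lin, of "A q"]
          linear_euclidean_sum[OF bounded_linear.linear[OF bounded_linear_inner_left[of i]], of "A q"]
        by simp
      also have "\<dots> = (\<Sum>j\<in>Basis. (?d (y i) q j - j \<bullet> i) * (A q \<bullet> j))"
        by (simp add: sum_subtractf left_diff_distrib)
      finally have "\<bar>?d (y i) q (A q) - A q \<bullet> i\<bar> \<le> (\<Sum>j\<in>Basis. \<bar>(?d (y i) q j - j \<bullet> i) * (A q \<bullet> j)\<bar>)"
        by (metis sum_abs)
      also have "\<dots> \<le> (\<Sum>j\<in>Basis. \<bar>?d (y i) q j - j \<bullet> i\<bar> * norm (A q))"
        by (intro sum_mono) (auto simp: abs_mult Basis_le_norm intro: mult_left_mono)
      finally show "\<bar>?d (y i) q (A q) - A q \<bullet> i\<bar> \<le> (\<Sum>j\<in>Basis. \<bar>?d (y i) q j - j \<bullet> i\<bar> * norm (A q))" .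
    qed
    finally show ?thesis by (simp add: m_def sum_distrib_right)
  qed
  have Ap: "A ?p = z ?p" using zA[OF p(2)] \<open>m ?p = 0\<close> by simp
  have "\<forall>\<^sub>F q in at ?p. norm (z q - A q) \<le> norm (z q) * (2 * m q)"
  proof -
    have "\<forall>\<^sub>F q in at ?p. q \<in> \<phi> ` U" using p eventually_at_in_open' by blast
    moreover have "\<forall>\<^sub>F q in at ?p. m q < 1/2" using m0 by (rule order_tendstoD) simp
    ultimately show ?thesis
    proof eventually_elim
      case (elim q)
      have m: "0 \<le> m q" by (auto simp: m_def intro!: sum_nonneg)
      \<comment> \<open>once \<open>m q < 1/2\<close>, the norm of \<open>A q\<close> is controlled by that of \<open>z q\<close>\<close>
      have "norm (A q) \<le> norm (z q) + norm (z q - A q)"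
        by (metis norm_minus_commute norm_triangle_sub)
      also have "norm (z q - A q) \<le> 1/2 * norm (A q)"
        using zA[OF elim(1)] mult_right_mono[of "m q" "1/2" "norm (A q)"] elim(2) by simp
      finally have "norm (A q) \<le> 2 * norm (z q)" by simp
      then have "m q * norm (A q) \<le> m q * (2 * norm (z q))" using m by (rule mult_left_mono)
      then show ?case using zA[OF elim(1)] by (simp add: mult_ac)
    qed
  qed
  moreover have "((\<lambda>q. norm (z q) * (2 * m q)) \<longlongrightarrow> norm (z ?p) * (2 * 0)) (at ?p)"
    by (intro tendsto_intros z0 m0)
  ultimately have "((\<lambda>q. z q - A q) \<longlongrightarrow> 0) (at ?p)"
    using Lim_null_comparison[of "\<lambda>q. z q - A q" "\<lambda>q. norm (z q) * (2 * m q)"] by simp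
  from tendsto_diff[OF z0 this] have "(A \<longlongrightarrow> A ?p) (at ?p)" by (simp add: Ap)
  then show ?thesis by (simp add: isCont_def)
qed

text \<open>At a critical point only the Hessian of \<open>f\<close> contributes to \<open>X (Y f)\<close>, because derivatives of the
  coefficients of \<open>Y\<close> are multiplied by first derivatives of \<open>f\<close>.\<close>

lemma second_derivative_at_critical_point:
  assumes c: "(U, \<phi>) \<in> \<A>" "x \<in> U" and X: "X \<in> vector_fields \<A>" and Y: "Y \<in> vector_fields \<A>"
    and f: "f \<in> smooth_funs \<A>" and crit: "\<And>u. frechet_derivative (f \<circ> inv_into U \<phi>) (at (\<phi> x)) u = 0"
  shows "X (Y f) x = Y (X f) x"
proof -
  let ?f = "f \<circ> inv_into U \<phi>" and ?p = "\<phi> x"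
  let ?D = "\<lambda>j q. frechet_derivative ?f (at q) j"
  let ?H = "\<lambda>j. frechet_derivative (?D j) (at ?p)"
  have p: "open (\<phi> ` U)" "?p \<in> \<phi> ` U" using chart_open c by auto
  note sm = smooth_funsD[OF f c(1)]
  have fd: "(?f has_derivative frechet_derivative ?f (at q)) (at q)" if "q \<in> \<phi> ` U" for q
    using smooth_on_openD[OF sm p(1) that] .
  have Hd: "(?D j has_derivative ?H j) (at ?p)" for j
    using smooth_on_openD[OF smooth_on_derivative[OF sm] p] .
  have rep: "\<exists>A. \<forall>q\<in>\<phi> ` U. \<forall>h\<in>smooth_funs \<A>. Z h (inv_into U \<phi> q) = frechet_derivative (h \<circ> inv_into U \<phi>) (at q) (A q)"
    if Z: "Z \<in> vector_fields \<A>" for Z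
  proof -
    have "\<exists>w. \<forall>h\<in>smooth_funs \<A>. Z h (inv_into U \<phi> q) = frechet_derivative (h \<circ> inv_into U \<phi>) (at q) w"
      if q: "q \<in> \<phi> ` U" for q
    proof -
      obtain y where y: "y \<in> U" "q = \<phi> y" using q by auto
      obtain w where w: "(\<lambda>f. Z f y) = restrict0 (smooth_funs \<A>)
          (\<lambda>f. frechet_derivative (f \<circ> inv_into U \<phi>) (at (\<phi> y)) w)"
        using vf_tangent[OF Z, of y] tangent_space_chart[OF c(1) y(1)] by blast
      have "Z h (inv_into U \<phi> q) = frechet_derivative (h \<circ> inv_into U \<phi>) (at q) w"
        if "h \<in> smooth_funs \<A>" for h
        using fun_cong[OF w, of h] that y c by (simp add: restrict0_def chart_inv)
      then show ?thesis by blast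
    qed
    then show ?thesis by metis
  qed
  have key: "Z (W f) x = (\<Sum>i\<in>Basis. \<Sum>j\<in>Basis. ?H j i * (A ?p \<bullet> i) * (B ?p \<bullet> j))"
    if Z: "Z \<in> vector_fields \<A>" and W: "W \<in> vector_fields \<A>"
      and A: "\<forall>q\<in>\<phi> ` U. \<forall>h\<in>smooth_funs \<A>. Z h (inv_into U \<phi> q) = frechet_derivative (h \<circ> inv_into U \<phi>) (at q) (A q)"
      and B: "\<forall>q\<in>\<phi> ` U. \<forall>h\<in>smooth_funs \<A>. W h (inv_into U \<phi> q) = frechet_derivative (h \<circ> inv_into U \<phi>) (at q) (B q)"
    for Z W A B
  proof -
    have "isCont B ?p" using vf_chart_continuous[OF c W] B by blast
    then have "((\<lambda>q. \<Sum>j\<in>Basis. ?D j q * (B q \<bullet> j)) has_derivative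
        (\<lambda>w. \<Sum>j\<in>Basis. ?H j w * (B ?p \<bullet> j))) (at ?p)"
      using crit by (intro has_derivative_sum has_derivative_mult_vanishing Hd) (auto intro: continuous_intros)
    moreover have "(\<Sum>j\<in>Basis. ?D j q * (B q \<bullet> j)) = (W f \<circ> inv_into U \<phi>) q" if q: "q \<in> \<phi> ` U" for q
      using linear_euclidean_sum[OF has_derivative_linear[OF fd[OF q]], of "B q"]
        bspec[OF bspec[OF B q] f] by simp
    ultimately have "((W f \<circ> inv_into U \<phi>) has_derivative (\<lambda>w. \<Sum>j\<in>Basis. ?H j w * (B ?p \<bullet> j))) (at ?p)"
      using has_derivative_transform_within_open[OF _ p] by blast
    then have "frechet_derivative (W f \<circ> inv_into U \<phi>) (at ?p) = (\<lambda>w. \<Sum>j\<in>Basis. ?H j w * (B ?p \<bullet> j))"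
      by (simp add: frechet_derivative_at[symmetric])
    moreover have "Z (W f) x = frechet_derivative (W f \<circ> inv_into U \<phi>) (at ?p) (A ?p)"
      using bspec[OF bspec[OF A p(2)] vf_smooth[OF W f]] c by (simp add: chart_inv)
    ultimately have "Z (W f) x = (\<Sum>j\<in>Basis. ?H j (A ?p) * (B ?p \<bullet> j))" by simp
    also have "\<dots> = (\<Sum>j\<in>Basis. (\<Sum>i\<in>Basis. ?H j i * (A ?p \<bullet> i)) * (B ?p \<bullet> j))"
      by (intro sum.cong arg_cong2[of _ _ _ _ "(*)"] linear_euclidean_sum has_derivative_linear[OF Hd] refl)
    also have "\<dots> = (\<Sum>i\<in>Basis. \<Sum>j\<in>Basis. ?H j i * (A ?p \<bullet> i) * (B ?p \<bullet> j))"
      by (subst sum.swap) (simp add: sum_distrib_right)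
    finally show ?thesis .
  qed
  obtain A where A: "\<forall>q\<in>\<phi> ` U. \<forall>h\<in>smooth_funs \<A>. X h (inv_into U \<phi> q) = frechet_derivative (h \<circ> inv_into U \<phi>) (at q) (A q)"
    using rep[OF X] by blast
  obtain B where B: "\<forall>q\<in>\<phi> ` U. \<forall>h\<in>smooth_funs \<A>. Y h (inv_into U \<phi> q) = frechet_derivative (h \<circ> inv_into U \<phi>) (at q) (B q)"
    using rep[OF Y] by blast
  have sym: "?H j i = ?H i j" for i j
    by (rule symmetric_second_derivative[OF p fd Hd Hd])
  show ?thesis unfolding key[OF X Y A B] key[OF Y X B A]
    by (subst sum.swap) (simp add: sym mult_ac)
qed

lemma vf_linear_combination:
  assumes Z: "Z \<in> vector_fields \<A>" and f: "f \<in> smooth_funs \<A>"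
    and y: "\<And>i. i \<in> I \<Longrightarrow> y i \<in> smooth_funs \<A>"
  shows "Z (f - (\<Sum>i\<in>I. c i *\<^sub>R y i)) = Z f - (\<Sum>i\<in>I. c i *\<^sub>R Z (y i))"
proof -
  have "Z (\<Sum>i\<in>I. c i *\<^sub>R y i) = (\<Sum>i\<in>I. Z (c i *\<^sub>R y i))"
    by (rule vf_sum_arg[OF Z]) (rule smooth_scaleR[OF y])
  also have "\<dots> = (\<Sum>i\<in>I. c i *\<^sub>R Z (y i))"
    by (rule sum.cong[OF refl]) (rule vf_scaleR_arg[OF Z y])
  finally have "Z (\<Sum>i\<in>I. c i *\<^sub>R y i) = (\<Sum>i\<in>I. c i *\<^sub>R Z (y i))" .
  moreover have "(\<Sum>i\<in>I. c i *\<^sub>R y i) \<in> smooth_funs \<A>" by (intro smooth_sum smooth_scaleR y)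
  ultimately show ?thesis using vf_diff_arg[OF Z f] by simp
qed

text \<open>Subtracting from \<open>f\<close> its linear part in the coordinate functions leaves a function that is
  critical at \<open>x\<close>, on which the commutator vanishes.  So at \<open>x\<close> the commutator is the directional
  derivative along the vector of its values on the coordinates.\<close>

lemma vf_lie_bracket:
  assumes X: "X \<in> vector_fields \<A>" and Y: "Y \<in> vector_fields \<A>"
  shows "lie_bracket X Y \<in> vector_fields \<A>"
proof -
  let ?B = "lie_bracket X Y"
  have "(\<lambda>f. ?B f x) \<in> tangent_space \<A> x" for x
  proof -
    obtain U \<phi> where c: "(U, \<phi>) \<in> \<A>" "x \<in> U" using chart_cover .
    let ?d = "\<lambda>f. frechet_derivative (f \<circ> inv_into U \<phi>) (at (\<phi> x))"
    obtain y where y: "\<And>i. i \<in> Basis \<Longrightarrow> y i \<in> smooth_funs \<A>"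
      "\<And>i u. i \<in> Basis \<Longrightarrow> ?d (y i) u = u \<bullet> i"
      using coordinate_functions[OF c] by blast
    define w where "w = (\<Sum>i\<in>Basis. ?B (y i) x *\<^sub>R i)"
    have "?B f x = ?d f w" if f: "f \<in> smooth_funs \<A>" for f
    proof -
      note lin = has_derivative_linear[OF chart_derivative[OF c f]]
      \<comment> \<open>the linear part of \<open>f\<close> at \<open>x\<close>\<close>
      define s where "s = (\<Sum>i\<in>Basis. ?d f i *\<^sub>R y i)"
      have s: "s \<in> smooth_funs \<A>" unfolding s_def by (intro smooth_intros y)
      have "?d (f - s) u = 0" for u
      proof -
        have "((\<lambda>p. (f \<circ> inv_into U \<phi>) p - (\<Sum>i\<in>Basis. ?d f i *\<^sub>R (y i \<circ> inv_into U \<phi>) p)) has_derivative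
            (\<lambda>u. ?d f u - (\<Sum>i\<in>Basis. ?d f i *\<^sub>R ?d (y i) u))) (at (\<phi> x))"
          by (intro has_derivative_diff has_derivative_sum has_derivative_scaleR_right chart_derivative[OF c] f y)
        moreover have "(\<lambda>p. (f \<circ> inv_into U \<phi>) p - (\<Sum>i\<in>Basis. ?d f i *\<^sub>R (y i \<circ> inv_into U \<phi>) p)) = (f - s) \<circ> inv_into U \<phi>"
          by (auto simp: s_def sum_fun_apply scaleR_fun_def)
        ultimately have "?d (f - s) = (\<lambda>u. ?d f u - (\<Sum>i\<in>Basis. ?d f i *\<^sub>R ?d (y i) u))"
          by (simp add: frechet_derivative_at[symmetric])
        then show ?thesis using linear_euclidean_sum[OF lin, of u] y(2) by simp
      qed
      then have eq: "X (Y (f - s)) x = Y (X (f - s)) x"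
        using second_derivative_at_critical_point[OF c X Y smooth_diff[OF f s]] by blast
      have comb: "Z (W (f - s)) = Z (W f) - (\<Sum>i\<in>Basis. ?d f i *\<^sub>R Z (W (y i)))"
        if Z: "Z \<in> vector_fields \<A>" and W: "W \<in> vector_fields \<A>" for Z W
      proof -
        have W: "W (f - s) = W f - (\<Sum>i\<in>Basis. ?d f i *\<^sub>R W (y i))"
          unfolding s_def by (rule vf_linear_combination[OF W f y(1)])
        have "Z (W f - (\<Sum>i\<in>Basis. ?d f i *\<^sub>R W (y i))) = Z (W f) - (\<Sum>i\<in>Basis. ?d f i *\<^sub>R Z (W (y i)))"
          by (rule vf_linear_combination[OF Z vf_smooth[OF that(2) f] vf_smooth[OF that(2) y(1)]])
        then show ?thesis by (simp only: W)
      qed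
      have "?B f x = (\<Sum>i\<in>Basis. ?d f i * ?B (y i) x)"
        using eq unfolding comb[OF X Y] comb[OF Y X]
        by (simp add: lie_bracket_def sum_fun_apply scaleR_fun_def right_diff_distrib sum_subtractf)
      also have "\<dots> = ?d f w"
        by (simp add: w_def linear_sum[OF lin] linear_scale[OF lin] mult.commute)
      finally show ?thesis .
    qed
    moreover have "?B f x = 0" if "f \<notin> smooth_funs \<A>" for f
      using that X Y by (simp add: lie_bracket_def vf_nonsmooth vf_zero_arg vf_const)
    ultimately have "(\<lambda>f. ?B f x) = restrict0 (smooth_funs \<A>) (\<lambda>f. ?d f w)"
      by (auto simp: restrict0_def)
    then show ?thesis using tangent_space_chart[OF c] by blast
  qed
  then show ?thesis using X Y by (auto simp: vector_fields_def lie_bracket_def[of X Y] intro!: smooth_intros)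
qed

lemma frame_spans_tangent:
  assumes "X \<in> vector_fields \<A>"
  obtains c where "\<And>f x. X f x = (\<Sum>a=1..n. c a x * v a f x)"
proof -
  have "\<exists>c. \<forall>f. X f x = (\<Sum>a=1..n. c a * v a f x)" for x
  proof -
    obtain U \<phi> where c: "(U, \<phi>) \<in> \<A>" "x \<in> U" using chart_cover .
    let ?d = "\<lambda>f. frechet_derivative (f \<circ> inv_into U \<phi>) (at (\<phi> x))"
    obtain u where u: "(\<lambda>f. X f x) = restrict0 (smooth_funs \<A>) (\<lambda>f. ?d f u)"
      using vf_tangent[OF assms] tangent_space_chart[OF c] by blast
    obtain w where w: "\<And>a f. a \<in> {1..n} \<Longrightarrow> f \<in> smooth_funs \<A> \<Longrightarrow> v a f x = ?d f (w a)"
      and sp: "\<And>u. \<exists>c. u = (\<Sum>a=1..n. c a *\<^sub>R w a)"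
      using frame_in_chart[OF c] by blast
    obtain k where k: "u = (\<Sum>a=1..n. k a *\<^sub>R w a)" using sp by blast
    have "X f x = (\<Sum>a=1..n. k a * v a f x)" for f
    proof (cases "f \<in> smooth_funs \<A>")
      case True
      note lin = has_derivative_linear[OF chart_derivative[OF c True]]
      show ?thesis using fun_cong[OF u, of f] True w
        by (simp add: restrict0_def k linear_sum[OF lin] linear_scale[OF lin])
    next
      case False
      then show ?thesis using vf_nonsmooth[OF assms] vf_nonsmooth[OF frame_vf] by simp
    qed
    then show ?thesis by blast
  qed
  then obtain c where "\<And>f x. X f x = (\<Sum>a=1..n. c x a * v a f x)" by metis
  then show ?thesis using that[of "\<lambda>a x. c x a"] by blast
qed

text \<open>Fraction-free Gauss elimination, one step at a time.  Some smooth \<open>f\<close> has \<open>w\<^sub>k f \<noteq> 0\<close> at \<open>x\<close>, by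
  independence; replacing every operator \<open>w\<close> by \<open>h w - (w f) w\<^sub>k\<close> with \<open>h = w\<^sub>k f\<close> removes the
  coefficient of \<open>w\<^sub>k\<close>, keeps the other coefficients of \<open>X\<close>, and preserves independence at \<open>x\<close>
  because \<open>h x \<noteq> 0\<close>.\<close>

lemma common_denominator:
  fixes w :: "nat \<Rightarrow> 'g vf" and X :: "'g vf" and c :: "nat \<Rightarrow> 'g scal"
  assumes "\<And>a f. a \<in> {1..k} \<Longrightarrow> f \<in> smooth_funs \<A> \<Longrightarrow> w a f \<in> smooth_funs \<A>"
    and "\<And>f. f \<in> smooth_funs \<A> \<Longrightarrow> X f \<in> smooth_funs \<A>"
    and "\<And>d. (\<And>f. f \<in> smooth_funs \<A> \<Longrightarrow> (\<Sum>a=1..k. d a * w a f x) = 0) \<Longrightarrow> \<forall>a\<in>{1..k}. d a = (0::real)"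
    and "\<And>f y. f \<in> smooth_funs \<A> \<Longrightarrow> X f y = (\<Sum>a=1..k. c a y * w a f y)"
  shows "\<exists>h\<in>smooth_funs \<A>. h x \<noteq> 0 \<and> (\<forall>a\<in>{1..k}. h * c a \<in> smooth_funs \<A>)"
  using assms
proof (induction k arbitrary: w X)
  case 0
  then show ?case using smooth_1 by (intro bexI[of _ 1]) auto
next
  case (Suc k)
  let ?k = "Suc k"
  have "\<exists>f\<in>smooth_funs \<A>. w ?k f x \<noteq> 0"
  proof (rule ccontr)
    assume no: "\<not> ?thesis"
    have "(\<Sum>a=1..?k. (if a = ?k then 1 else 0) * w a f x) = 0" if "f \<in> smooth_funs \<A>" for f
      using no that by (simp add: if_distrib[of "\<lambda>z. z * _"] cong: if_cong)
    from Suc.prems(3)[OF this] show False by (auto dest: bspec[of _ _ ?k])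
  qed
  then obtain f where f: "f \<in> smooth_funs \<A>" "w ?k f x \<noteq> 0" by blast
  define h where "h = w ?k f"
  define w' where "w' a \<psi> = h * w a \<psi> - w a f * w ?k \<psi>" for a \<psi>
  define X' where "X' \<psi> = h * X \<psi> - X f * w ?k \<psi>" for \<psi>
  have h: "h \<in> smooth_funs \<A>" using Suc.prems(1)[of ?k f] f by (simp add: h_def)
  have "\<exists>h'\<in>smooth_funs \<A>. h' x \<noteq> 0 \<and> (\<forall>a\<in>{1..k}. h' * c a \<in> smooth_funs \<A>)"
  proof (rule Suc.IH[of w' X'])
    show "w' a \<psi> \<in> smooth_funs \<A>" if "a \<in> {1..k}" "\<psi> \<in> smooth_funs \<A>" for a \<psi>
      unfolding w'_def using that f h by (intro smooth_intros Suc.prems(1)) auto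
    show "X' \<psi> \<in> smooth_funs \<A>" if "\<psi> \<in> smooth_funs \<A>" for \<psi>
      unfolding X'_def using that f h by (intro smooth_intros Suc.prems(1) Suc.prems(2)) auto
    show "X' \<psi> y = (\<Sum>a=1..k. c a y * w' a \<psi> y)" if "\<psi> \<in> smooth_funs \<A>" for \<psi> y
      using that f by (simp add: X'_def w'_def h_def Suc.prems(4) algebra_simps sum_distrib_left sum_distrib_right sum_subtractf)
    show "\<forall>a\<in>{1..k}. d a = 0"
      if d: "\<And>\<psi>. \<psi> \<in> smooth_funs \<A> \<Longrightarrow> (\<Sum>a=1..k. d a * w' a \<psi> x) = 0" for d
    proof -
      \<comment> \<open>a relation between the \<open>w'\<close> at \<open>x\<close>, rewritten as a relation between the \<open>w\<close>\<close>
      define d' where "d' a = (if a = ?k then - (\<Sum>b=1..k. d b * w b f x) else d a * h x)" for a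
      have "(\<Sum>a=1..?k. d' a * w a \<psi> x) = 0" if "\<psi> \<in> smooth_funs \<A>" for \<psi>
      proof -
        have "(\<Sum>a=1..?k. d' a * w a \<psi> x) = (\<Sum>a=1..k. d' a * w a \<psi> x) + d' ?k * w ?k \<psi> x" by simp
        also have "(\<Sum>a=1..k. d' a * w a \<psi> x) = (\<Sum>a=1..k. d a * h x * w a \<psi> x)"
          by (rule sum.cong) (auto simp: d'_def)
        also have "\<dots> + d' ?k * w ?k \<psi> x = (\<Sum>a=1..k. d a * w' a \<psi> x)"
          by (simp add: d'_def w'_def algebra_simps sum_distrib_left sum_distrib_right sum_subtractf)
        finally show ?thesis using d[OF that] by simp
      qed
      from Suc.prems(3)[OF this] have z: "\<forall>a\<in>{1..?k}. d' a = 0" .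
      show ?thesis
      proof
        fix a assume "a \<in> {1..k}"
        then have "a \<in> {1..?k}" "a \<noteq> ?k" by auto
        then have "d a * h x = 0" using bspec[OF z, of a] by (simp add: d'_def)
        then show "d a = 0" using f by (simp add: h_def)
      qed
    qed
  qed
  then obtain h' where h': "h' \<in> smooth_funs \<A>" "h' x \<noteq> 0" "\<And>a. a \<in> {1..k} \<Longrightarrow> h' * c a \<in> smooth_funs \<A>" by blast
  \<comment> \<open>the eliminated coefficient is recovered from \<open>X f\<close>, where it is multiplied by \<open>h\<close>\<close>
  have last: "h * h' * c ?k = h' * X f - (\<Sum>a=1..k. h' * c a * w a f)"
  proof
    fix y
    have "X f y = (\<Sum>a=1..k. c a y * w a f y) + c ?k y * h y" using Suc.prems(4)[OF f(1), of y] by (simp add: h_def)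
    then show "(h * h' * c ?k) y = (h' * X f - (\<Sum>a=1..k. h' * c a * w a f)) y"
      by (simp add: sum_fun_apply algebra_simps sum_distrib_left)
  qed
  have "h * h' * c a \<in> smooth_funs \<A>" if "a \<in> {1..?k}" for a
  proof (cases "a = ?k")
    case True
    then show ?thesis unfolding True last using f
      by (intro smooth_intros h' Suc.prems(1) Suc.prems(2)) auto
  next
    case False
    then show ?thesis using that h h'(3)[of a] smooth_mult[of h "h' * c a"] by (simp add: mult.assoc)
  qed
  moreover have "h * h' \<in> smooth_funs \<A>" "(h * h') x \<noteq> 0" using f h h' by (auto simp: h_def smooth_mult)
  ultimately show ?case by blast
qed

lemma frame_local_expansion:
  assumes X: "X \<in> vector_fields \<A>"
  obtains h s where "h \<in> smooth_funs \<A>" "h x \<noteq> 0" "\<And>a. a \<in> {1..n} \<Longrightarrow> s a \<in> smooth_funs \<A>"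
    "vf_smult h X = (\<Sum>a=1..n. vf_smult (s a) (v a))"
proof -
  obtain c where c: "\<And>f x. X f x = (\<Sum>a=1..n. c a x * v a f x)"
    using frame_spans_tangent[OF X] by blast
  have "\<exists>h\<in>smooth_funs \<A>. h x \<noteq> 0 \<and> (\<forall>a\<in>{1..n}. h * c a \<in> smooth_funs \<A>)"
  proof (rule common_denominator[of n v X])
    show "\<forall>a\<in>{1..n}. d a = 0" if "\<And>f. f \<in> smooth_funs \<A> \<Longrightarrow> (\<Sum>a=1..n. d a * v a f x) = 0" for d
      using frame_indep[OF that] by blast
  qed (simp_all only: c vf_smooth[OF X] vf_smooth[OF frame_vf])
  then obtain h where h: "h \<in> smooth_funs \<A>" "h x \<noteq> 0" "\<And>a. a \<in> {1..n} \<Longrightarrow> h * c a \<in> smooth_funs \<A>" by blast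
  have "vf_smult h X = (\<Sum>a=1..n. vf_smult (h * c a) (v a))"
    by (auto simp: fun_eq_iff vf_smult_def sum_fun_apply c sum_distrib_left mult_ac)
  then show ?thesis using h that[of h "\<lambda>a. h * c a"] by blast
qed

text \<open>A one-form commutes with multiplication by smooth functions, so it can be evaluated on the
  multiple \<open>h X\<close>, whose coefficients in the frame are smooth.  Dividing by \<open>h x \<noteq> 0\<close> identifies
  the coefficients of \<open>X\<close> at \<open>x\<close>, which are therefore smooth globally.\<close>

lemma frame_expansion:
  assumes X: "X \<in> vector_fields \<A>"
    and \<theta>: "\<And>a. a \<in> {1..n} \<Longrightarrow> \<theta> a \<in> one_forms \<A>"
    and dual: "\<And>a b. a \<in> {1..n} \<Longrightarrow> b \<in> {1..n} \<Longrightarrow> \<theta> a (v b) = (\<lambda>_. if a = b then \<sigma> a else 0)"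
    and \<sigma>: "\<And>a. a \<in> {1..n} \<Longrightarrow> \<sigma> a * \<sigma> a = 1"
  shows "X = (\<Sum>a=1..n. vf_smult (\<sigma> a *\<^sub>R \<theta> a X) (v a))"
proof (rule ext, rule ext)
  fix f x
  obtain h s where h: "h \<in> smooth_funs \<A>" "h x \<noteq> 0" "\<And>a. a \<in> {1..n} \<Longrightarrow> s a \<in> smooth_funs \<A>"
    and ex: "vf_smult h X = (\<Sum>a=1..n. vf_smult (s a) (v a))"
    using frame_local_expansion[OF X, of x] by blast
  have \<theta>x: "h x * \<theta> a X x = s a x * \<sigma> a" if a: "a \<in> {1..n}" for a
  proof -
    have "h * \<theta> a X = \<theta> a (\<Sum>b=1..n. vf_smult (s b) (v b))"
      using one_form_smult[OF \<theta>[OF a] X h(1)] by (simp add: ex)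
    also have "\<dots> = (\<Sum>b=1..n. s b * \<theta> a (v b))"
      using h(3) frame_vf by (subst one_form_sum[OF \<theta>[OF a]]) (auto simp: one_form_smult[OF \<theta>[OF a]] vf_smult)
    finally have "(h * \<theta> a X) x = (\<Sum>b=1..n. s b * \<theta> a (v b)) x" by simp
    also have "\<dots> = (\<Sum>b=1..n. if a = b then s a x * \<sigma> a else 0)"
      unfolding sum_fun_apply using a by (intro sum.cong) (auto simp: dual)
    finally show ?thesis using a by simp
  qed
  have "h x * X f x = (\<Sum>a=1..n. s a x * v a f x)"
    using fun_cong[OF fun_cong[OF ex, of f], of x] by (simp add: vf_smult_def sum_fun_apply)
  also have "\<dots> = (\<Sum>a=1..n. h x * (\<sigma> a * \<theta> a X x * v a f x))"
  proof (rule sum.cong)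
    fix a assume a: "a \<in> {1..n}"
    have "h x * (\<sigma> a * \<theta> a X x * v a f x) = \<sigma> a * (h x * \<theta> a X x) * v a f x" by simp
    also have "\<dots> = (\<sigma> a * \<sigma> a) * s a x * v a f x" by (simp add: \<theta>x[OF a])
    also have "\<dots> = s a x * v a f x" by (simp only: \<sigma>[OF a] mult_1)
    finally show "s a x * v a f x = h x * (\<sigma> a * \<theta> a X x * v a f x)" by (rule sym)
  qed simp
  finally have "X f x = (\<Sum>a=1..n. \<sigma> a * \<theta> a X x * v a f x)"
    using h(2) by (simp add: sum_distrib_left[symmetric])
  then show "X f x = (\<Sum>a=1..n. vf_smult (\<sigma> a *\<^sub>R \<theta> a X) (v a)) f x"
    by (simp add: vf_smult_def sum_fun_apply scaleR_fun_def)
qed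

end


section \<open>Modules of sections and traces\<close>

lemma smult_diff_right: "f \<odot> (u - w) = f \<odot> u - f \<odot> w"
  by (cases u; cases w) (auto simp: smult_def vf_smult_def fun_eq_iff algebra_simps)

lemma smult_zero_left: "0 \<odot> u = 0"
  by (cases u) (auto simp: smult_def vf_smult_def zero_prod_def fun_eq_iff)

lemma smult_minus_one: "(\<lambda>_. - 1) \<odot> u = - u"
  by (cases u) (auto simp: smult_def vf_smult_def fun_eq_iff)

lemma pairing_commute: "pairing u w = pairing w u"
  by (cases u; cases w) (auto simp: pairing_def add.commute mult.commute)

context manifold
begin

lemma one_forms_0: "0 \<in> one_forms \<A>"
  by (auto simp: one_forms_def smooth_intros)

lemma one_forms_add: "\<xi> \<in> one_forms \<A> \<Longrightarrow> \<eta> \<in> one_forms \<A> \<Longrightarrow> \<xi> + \<eta> \<in> one_forms \<A>"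
  by (auto simp: one_forms_def smooth_intros algebra_simps)

lemma one_forms_smult: "f \<in> smooth_funs \<A> \<Longrightarrow> \<xi> \<in> one_forms \<A> \<Longrightarrow> (\<lambda>X. f * \<xi> X) \<in> one_forms \<A>"
  by (auto simp: one_forms_def smooth_intros algebra_simps)

lemma one_forms_uminus: "\<xi> \<in> one_forms \<A> \<Longrightarrow> - \<xi> \<in> one_forms \<A>"
  using one_forms_smult[of "\<lambda>_. - 1" \<xi>] smooth_const[of "- 1"]
  by (simp add: fun_Compl_def times_fun_def)

lemma sections_0: "0 \<in> sections \<A>"
  by (simp add: sections_def zero_prod_def vf_0 one_forms_0 smooth_0)

lemma sections_add: "u \<in> sections \<A> \<Longrightarrow> w \<in> sections \<A> \<Longrightarrow> u + w \<in> sections \<A>"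
  by (auto simp: sections_def vf_add one_forms_add smooth_add)

lemma sections_smult: "f \<in> smooth_funs \<A> \<Longrightarrow> u \<in> sections \<A> \<Longrightarrow> f \<odot> u \<in> sections \<A>"
  by (auto simp: sections_def smult_def vf_smult one_forms_smult smooth_mult)

lemma anchor_vf: "u \<in> sections \<A> \<Longrightarrow> anchor u \<in> vector_fields \<A>"
  by (auto simp: sections_def anchor_def)

lemma pairing_smooth:
  assumes "u \<in> sections \<A>" "w \<in> sections \<A>"
  shows "pairing u w \<in> smooth_funs \<A>"
proof -
  obtain X \<xi> l Y \<eta> m where uw: "u = (X, \<xi>, l)" "w = (Y, \<eta>, m)" by (metis prod_cases3)
  then have "X \<in> vector_fields \<A>" "\<xi> \<in> one_forms \<A>" "l \<in> smooth_funs \<A>"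
    "Y \<in> vector_fields \<A>" "\<eta> \<in> one_forms \<A>" "m \<in> smooth_funs \<A>"
    using assms by (auto simp: sections_def)
  then show ?thesis unfolding uw
    by (simp add: pairing_def smooth_add smooth_scaleR smooth_mult one_form_smooth)
qed

lemma pairing_add_left:
  "u \<in> sections \<A> \<Longrightarrow> u' \<in> sections \<A> \<Longrightarrow> w \<in> sections \<A> \<Longrightarrow> pairing (u + u') w = pairing u w + pairing u' w"
  by (auto simp: sections_def pairing_def one_form_add scaleR_fun_def fun_eq_iff algebra_simps add_divide_distrib)

lemma pairing_smult_left:
  "f \<in> smooth_funs \<A> \<Longrightarrow> u \<in> sections \<A> \<Longrightarrow> w \<in> sections \<A> \<Longrightarrow> pairing (f \<odot> u) w = f * pairing u w"
  by (auto simp: sections_def pairing_def smult_def one_form_smult scaleR_fun_def fun_eq_iff algebra_simps)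

lemma sections_uminus: "u \<in> sections \<A> \<Longrightarrow> - u \<in> sections \<A>"
  using sections_smult[OF smooth_const[of "- 1"]] by (simp add: smult_minus_one)

lemma sections_diff: "u \<in> sections \<A> \<Longrightarrow> w \<in> sections \<A> \<Longrightarrow> u - w \<in> sections \<A>"
  using sections_add[of u "- w"] sections_uminus[of w] by simp

lemma pairing_diff_left:
  assumes "u \<in> sections \<A>" "u' \<in> sections \<A>" "w \<in> sections \<A>"
  shows "pairing (u - u') w = pairing u w - pairing u' w"
  using pairing_add_left[OF sections_diff[OF assms(1,2)] assms(2,3)] by simp

definition submodule :: "'g sec set \<Rightarrow> bool" where
  "submodule S \<longleftrightarrow> S \<subseteq> sections \<A> \<and> 0 \<in> S \<and> (\<forall>u\<in>S. \<forall>w\<in>S. u + w \<in> S) \<and>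
     (\<forall>f\<in>smooth_funs \<A>. \<forall>u\<in>S. f \<odot> u \<in> S)"

lemma submodule_sections: "submodule (sections \<A>)"
  by (simp add: submodule_def sections_0 sections_add sections_smult)

lemma submodule_diff:
  assumes "submodule S" "u \<in> S" "w \<in> S" shows "u - w \<in> S"
proof -
  have "u + (\<lambda>_. - 1) \<odot> w \<in> S" using assms smooth_const[of "- 1"] unfolding submodule_def by blast
  then show ?thesis by (simp add: smult_minus_one)
qed

text \<open>The parameter \<open>act\<close> is the action of smooth functions on the target, so that the notion covers
  both endomorphisms of modules of sections and maps to functions.\<close>

definition smooth_linear :: "'g sec set \<Rightarrow> ('g sec \<Rightarrow> 'b::ab_group_add) \<Rightarrow> ('g scal \<Rightarrow> 'b \<Rightarrow> 'b) \<Rightarrow> bool" where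
  "smooth_linear S T act \<longleftrightarrow> (\<forall>u\<in>S. \<forall>w\<in>S. T (u + w) = T u + T w) \<and>
     (\<forall>f\<in>smooth_funs \<A>. \<forall>u\<in>S. T (f \<odot> u) = act f (T u))"

lemma smooth_linear_combination:
  assumes S: "submodule S" and T: "smooth_linear S T act"
    and u: "\<And>i. i \<in> I \<Longrightarrow> u i \<in> S" and c: "\<And>i. i \<in> I \<Longrightarrow> c i \<in> smooth_funs \<A>"
  shows "(\<Sum>i\<in>I. c i \<odot> u i) \<in> S \<and> T (\<Sum>i\<in>I. c i \<odot> u i) = (\<Sum>i\<in>I. act (c i) (T (u i)))"
proof -
  have "0 \<in> S" using S by (simp add: submodule_def)
  then have "T (0 + 0) = T 0 + T 0" using T unfolding smooth_linear_def by blast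
  then have "T 0 = 0" by simp
  then show ?thesis using u c \<open>0 \<in> S\<close>
  proof (induction I rule: infinite_finite_induct)
    case (insert i I)
    then have "c i \<odot> u i \<in> S" using S unfolding submodule_def by blast
    then show ?case using insert S T unfolding submodule_def smooth_linear_def by simp
  qed auto
qed

text \<open>Traces do not depend on the frame: expanding each frame in the other one turns both traces into
  the same double sum.  Hence the description defining the trace picks the value in any given
  frame.\<close>

lemma bundle_trace_eq:
  assumes S: "submodule S" and T: "smooth_linear S T (\<odot>)" and TS: "\<And>u. u \<in> S \<Longrightarrow> T u \<in> S"
    and fr: "is_frame \<A> S k b \<theta>"
  shows "bundle_trace \<A> S T = (\<Sum>i<k. \<theta> i (T (b i)))"
proof -
  have fr_lin: "smooth_linear S (\<theta>' i) (*)" if "is_frame \<A> S k' b' \<theta>'" "i < k'" for k' b' \<theta>' i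
    using that unfolding is_frame_def smooth_linear_def by blast
  have "(\<Sum>i<k'. \<theta>' i (T (b' i))) = (\<Sum>i<k. \<theta> i (T (b i)))" if fr': "is_frame \<A> S k' b' \<theta>'" for k' b' \<theta>'
  proof -
    have b: "b i \<in> S" if "i < k" for i using fr that by (auto simp: is_frame_def)
    have b': "b' i \<in> S" if "i < k'" for i using fr' that by (auto simp: is_frame_def)
    have sm: "\<theta> i u \<in> smooth_funs \<A>" if "i < k" "u \<in> S" for i u
      using fr that unfolding is_frame_def by blast
    have sm': "\<theta>' i u \<in> smooth_funs \<A>" if "i < k'" "u \<in> S" for i u
      using fr' that unfolding is_frame_def by blast
    have ex: "u = (\<Sum>i<k. \<theta> i u \<odot> b i)" if "u \<in> S" for u using fr that by (auto simp: is_frame_def)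
    have ex': "u = (\<Sum>i<k'. \<theta>' i u \<odot> b' i)" if "u \<in> S" for u using fr' that by (auto simp: is_frame_def)
    have "\<theta> i (T (b i)) = (\<Sum>j<k'. \<theta>' j (b i) * \<theta> i (T (b' j)))" if i: "i < k" for i
    proof -
      have "T (b i) = T (\<Sum>j<k'. \<theta>' j (b i) \<odot> b' j)" using ex'[OF b[OF i]] by (rule arg_cong)
      also have "\<dots> = (\<Sum>j<k'. \<theta>' j (b i) \<odot> T (b' j))"
        using b' sm' b i by (intro smooth_linear_combination[OF S T, THEN conjunct2]) auto
      finally have "\<theta> i (T (b i)) = \<theta> i (\<Sum>j<k'. \<theta>' j (b i) \<odot> T (b' j))" by (rule arg_cong)
      then show ?thesis
        using smooth_linear_combination[OF S fr_lin[OF fr i], of "{..<k'}" "\<lambda>j. T (b' j)" "\<lambda>j. \<theta>' j (b i)"]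
          b' sm' b i TS by simp
    qed
    then have "(\<Sum>i<k. \<theta> i (T (b i))) = (\<Sum>i<k. \<Sum>j<k'. \<theta>' j (b i) * \<theta> i (T (b' j)))"
      by (intro sum.cong) auto
    also have "\<dots> = (\<Sum>j<k'. \<Sum>i<k. \<theta> i (T (b' j)) * \<theta>' j (b i))"
      by (subst sum.swap) (simp add: mult.commute)
    also have "\<dots> = (\<Sum>j<k'. \<theta>' j (T (b' j)))"
    proof (rule sum.cong[OF refl])
      fix j assume "j \<in> {..<k'}" then have j: "j < k'" by simp
      have "\<theta>' j (T (b' j)) = \<theta>' j (\<Sum>i<k. \<theta> i (T (b' j)) \<odot> b i)"
        using ex[OF TS[OF b'[OF j]]] by (rule arg_cong)
      also have "\<dots> = (\<Sum>i<k. \<theta> i (T (b' j)) * \<theta>' j (b i))"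
        using b sm TS b' j by (intro smooth_linear_combination[OF S fr_lin[OF fr' j], THEN conjunct2]) auto
      finally show "(\<Sum>i<k. \<theta> i (T (b' j)) * \<theta>' j (b i)) = \<theta>' j (T (b' j))" by (rule sym)
    qed
    finally show ?thesis by (rule sym)
  qed
  then show ?thesis unfolding bundle_trace_def using fr by (intro the_equality) blast+
qed

lemma bundle_trace_orthonormal:
  assumes Q: "finite Q" and S: "submodule S" and e: "\<And>b. b \<in> Q \<Longrightarrow> e b \<in> S"
    and orth: "\<And>a b. a \<in> Q \<Longrightarrow> b \<in> Q \<Longrightarrow> pairing (e a) (e b) = (\<lambda>_. if a = b then \<epsilon> a else 0)"
    and sgn: "\<And>b. b \<in> Q \<Longrightarrow> \<epsilon> b * \<epsilon> b = 1"
    and ex: "\<And>u. u \<in> S \<Longrightarrow> u = (\<Sum>b\<in>Q. (\<epsilon> b *\<^sub>R pairing u (e b)) \<odot> e b)"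
    and T: "smooth_linear S T (\<odot>)" and TS: "\<And>u. u \<in> S \<Longrightarrow> T u \<in> S"
  shows "bundle_trace \<A> S T = (\<Sum>b\<in>Q. \<epsilon> b *\<^sub>R pairing (T (e b)) (e b))"
proof -
  obtain s where s: "bij_betw s {..<card Q} Q"
    using ex_bij_betw_nat_finite[OF Q] by (auto simp: atLeast0LessThan)
  have sQ: "s i \<in> Q" if "i < card Q" for i using bij_betwE[OF s] that by auto
  have inj: "s i = s j \<longleftrightarrow> i = j" if "i < card Q" "j < card Q" for i j
    using s that by (auto simp: bij_betw_def inj_on_def)
  have Ss: "S \<subseteq> sections \<A>" using S by (simp add: submodule_def)
  define \<theta> where "\<theta> i u = \<epsilon> (s i) *\<^sub>R pairing u (e (s i))" for i u
  have eS: "e (s i) \<in> sections \<A>" if "i < card Q" for i using e[OF sQ[OF that]] Ss by blast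
  have "is_frame \<A> S (card Q) (\<lambda>i. e (s i)) \<theta>"
    unfolding is_frame_def
  proof (intro conjI allI impI ballI)
    fix i assume i: "i < card Q"
    show "e (s i) \<in> S" using e[OF sQ[OF i]] .
    show "\<theta> i u \<in> smooth_funs \<A>" if "u \<in> S" for u
      unfolding \<theta>_def using that Ss eS[OF i] by (intro smooth_scaleR pairing_smooth) auto
    show "\<theta> i (u + w) = \<theta> i u + \<theta> i w" if "u \<in> S" "w \<in> S" for u w
      unfolding \<theta>_def using that Ss eS[OF i] by (subst pairing_add_left) (auto simp: scaleR_add_right)
    show "\<theta> i (f \<odot> u) = f * \<theta> i u" if "f \<in> smooth_funs \<A>" "u \<in> S" for f u
      unfolding \<theta>_def using that Ss eS[OF i] by (subst pairing_smult_left) (auto simp: scaleR_fun_def)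
    show "\<theta> i (e (s j)) = (if i = j then 1 else 0)" if j: "j < card Q" for j
    proof (cases "i = j")
      case True
      then show ?thesis unfolding \<theta>_def orth[OF sQ[OF j] sQ[OF i]]
        by (simp add: scaleR_fun_def fun_eq_iff sgn[OF sQ[OF j]])
    next
      case False
      then have "s j \<noteq> s i" using inj[OF i j] by simp
      then show ?thesis unfolding \<theta>_def orth[OF sQ[OF j] sQ[OF i]]
        using False by (simp add: scaleR_fun_def fun_eq_iff)
    qed
  next
    fix u assume u: "u \<in> S"
    have "u = (\<Sum>b\<in>Q. (\<epsilon> b *\<^sub>R pairing u (e b)) \<odot> e b)" by (rule ex[OF u])
    also have "\<dots> = (\<Sum>i<card Q. \<theta> i u \<odot> e (s i))"
      unfolding \<theta>_def by (rule sum.reindex_bij_betw[OF s, symmetric])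
    finally show "u = (\<Sum>i<card Q. \<theta> i u \<odot> e (s i))" .
  qed
  from bundle_trace_eq[OF S T TS this]
  have "bundle_trace \<A> S T = (\<Sum>i<card Q. \<epsilon> (s i) *\<^sub>R pairing (T (e (s i))) (e (s i)))"
    by (simp add: \<theta>_def)
  also have "\<dots> = (\<Sum>b\<in>Q. \<epsilon> b *\<^sub>R pairing (T (e b)) (e b))"
    by (rule sum.reindex_bij_betw[OF s])
  finally show ?thesis .
qed

end


section \<open>Ricci curvature in terms of structure coefficients\<close>

text \<open>A torsion-free metric connection that preserves an orthogonal decomposition of \<open>E\<close> into two
  subbundles, with adapted orthonormal frame and constant structure coefficients.  The index sets
  \<open>P\<close> and \<open>M\<close> of the two parts enter symmetrically, so that the locale applies to
  \<open>E = E\<^sub>+ \<oplus> E\<^sub>-\<close> in either order.\<close>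

locale split_connection = manifold \<A>
  for \<A> :: "('g::{t2_space, second_countable_topology}, 'e::euclidean_space) chart set" +
  fixes H :: "'g cov3" and F :: "'g cov2" and D :: "'g sec \<Rightarrow> 'g sec \<Rightarrow> 'g sec"
    and e :: "nat \<Rightarrow> 'g sec" and \<epsilon> :: "nat \<Rightarrow> real" and P M :: "nat set" and EP EM :: "'g sec set"
  assumes index: "finite P" "finite M" "P \<inter> M = {}"
    and dorfman_section: "u \<in> sections \<A> \<Longrightarrow> w \<in> sections \<A> \<Longrightarrow> dorfman \<A> H F u w \<in> sections \<A>"
    and sub: "submodule EP" "submodule EM"
    and EP_EM: "u \<in> EP \<Longrightarrow> w \<in> EM \<Longrightarrow> pairing u w = 0"
    and e_EP: "b \<in> P \<Longrightarrow> e b \<in> EP" and e_EM: "j \<in> M \<Longrightarrow> e j \<in> EM"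
    and orthonormal: "a \<in> P \<union> M \<Longrightarrow> b \<in> P \<union> M \<Longrightarrow> pairing (e a) (e b) = (\<lambda>_. if a = b then \<epsilon> a else 0)"
    and sgn: "b \<in> P \<union> M \<Longrightarrow> \<epsilon> b * \<epsilon> b = 1"
    and expansion: "u \<in> sections \<A> \<Longrightarrow> u = (\<Sum>b\<in>P \<union> M. (\<epsilon> b *\<^sub>R pairing u (e b)) \<odot> e b)"
    and connection: "generalized_connection \<A> D"
    and torsion_free: "u \<in> sections \<A> \<Longrightarrow> w \<in> sections \<A> \<Longrightarrow> z \<in> sections \<A> \<Longrightarrow> torsion \<A> H F D u w z = 0"
    and D_EP: "u \<in> sections \<A> \<Longrightarrow> w \<in> EP \<Longrightarrow> D u w \<in> EP"
    and D_EM: "u \<in> sections \<A> \<Longrightarrow> w \<in> EM \<Longrightarrow> D u w \<in> EM"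
    and structure_constants: "a \<in> P \<union> M \<Longrightarrow> b \<in> P \<union> M \<Longrightarrow> c \<in> P \<union> M \<Longrightarrow>
      \<exists>k. pairing (dorfman \<A> H F (e a) (e b)) (e c) = (\<lambda>_. k)"
begin

lemma EP_sections: "u \<in> EP \<Longrightarrow> u \<in> sections \<A>" and EM_sections: "u \<in> EM \<Longrightarrow> u \<in> sections \<A>"
  using sub by (auto simp: submodule_def)

lemma e_sections: "b \<in> P \<union> M \<Longrightarrow> e b \<in> sections \<A>"
  using e_EP e_EM EP_sections EM_sections by blast

lemma D_sections: "u \<in> sections \<A> \<Longrightarrow> w \<in> sections \<A> \<Longrightarrow> D u w \<in> sections \<A>"
  and D_add_left: "u \<in> sections \<A> \<Longrightarrow> u' \<in> sections \<A> \<Longrightarrow> w \<in> sections \<A> \<Longrightarrow> D (u + u') w = D u w + D u' w"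
  and D_smult_left: "f \<in> smooth_funs \<A> \<Longrightarrow> u \<in> sections \<A> \<Longrightarrow> w \<in> sections \<A> \<Longrightarrow> D (f \<odot> u) w = f \<odot> D u w"
  and D_add_right: "u \<in> sections \<A> \<Longrightarrow> w \<in> sections \<A> \<Longrightarrow> w' \<in> sections \<A> \<Longrightarrow> D u (w + w') = D u w + D u w'"
  and D_smult_right: "f \<in> smooth_funs \<A> \<Longrightarrow> u \<in> sections \<A> \<Longrightarrow> w \<in> sections \<A> \<Longrightarrow>
      D u (f \<odot> w) = anchor u f \<odot> w + f \<odot> D u w"
  and D_metric: "u \<in> sections \<A> \<Longrightarrow> w \<in> sections \<A> \<Longrightarrow> z \<in> sections \<A> \<Longrightarrow>
      anchor u (pairing w z) = pairing (D u w) z + pairing w (D u z)"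
  using connection unfolding generalized_connection_def by blast+

lemma D_diff_left:
  assumes "u \<in> sections \<A>" "u' \<in> sections \<A>" "w \<in> sections \<A>"
  shows "D (u - u') w = D u w - D u' w"
  using D_add_left[OF sections_diff[OF assms(1,2)] assms(2,3)] by simp

lemma pairing_expansion:
  assumes "u \<in> sections \<A>" "w \<in> sections \<A>"
  shows "pairing u w x = (\<Sum>b\<in>P \<union> M. \<epsilon> b * pairing u (e b) x * pairing w (e b) x)"
proof -
  have "smooth_linear (sections \<A>) (\<lambda>u. pairing u w) (*)"
    using assms by (auto simp: smooth_linear_def pairing_add_left pairing_smult_left)
  then have "pairing u w = (\<Sum>b\<in>P \<union> M. (\<epsilon> b *\<^sub>R pairing u (e b)) * pairing (e b) w)"
    using smooth_linear_combination[OF submodule_sections, of "\<lambda>u. pairing u w" "(*)" "P \<union> M" e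
        "\<lambda>b. \<epsilon> b *\<^sub>R pairing u (e b)"] expansion[OF assms(1)] assms
    by (auto simp: e_sections smooth_scaleR pairing_smooth)
  then show ?thesis by (simp add: sum_fun_apply scaleR_fun_def pairing_commute[of w])
qed

lemma D_expansion:
  assumes "w \<in> sections \<A>" "u \<in> sections \<A>" "z \<in> sections \<A>"
  shows "pairing (D w u) z x = (\<Sum>b\<in>P \<union> M. \<epsilon> b * pairing w (e b) x * pairing (D (e b) u) z x)"
proof -
  have "smooth_linear (sections \<A>) (\<lambda>w. pairing (D w u) z) (*)"
    using assms by (auto simp: smooth_linear_def D_add_left D_smult_left pairing_add_left pairing_smult_left D_sections)
  then have "pairing (D w u) z = (\<Sum>b\<in>P \<union> M. (\<epsilon> b *\<^sub>R pairing w (e b)) * pairing (D (e b) u) z)"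
    using smooth_linear_combination[OF submodule_sections, of "\<lambda>w. pairing (D w u) z" "(*)" "P \<union> M" e
        "\<lambda>b. \<epsilon> b *\<^sub>R pairing w (e b)"] expansion[OF assms(1)] assms
    by (auto simp: e_sections smooth_scaleR pairing_smooth)
  then show ?thesis by (simp add: sum_fun_apply scaleR_fun_def)
qed

lemma section_eqI:
  assumes "u \<in> sections \<A>" "w \<in> sections \<A>" "\<And>b. b \<in> P \<union> M \<Longrightarrow> pairing u (e b) = pairing w (e b)"
  shows "u = w"
proof -
  have "(\<Sum>b\<in>P \<union> M. (\<epsilon> b *\<^sub>R pairing u (e b)) \<odot> e b) = (\<Sum>b\<in>P \<union> M. (\<epsilon> b *\<^sub>R pairing w (e b)) \<odot> e b)"
    using assms(3) by (intro sum.cong) auto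
  then show ?thesis using expansion[OF assms(1)] expansion[OF assms(2)] by metis
qed

text \<open>The torsion differs from the naive expression \<open>D\<^sub>w u - D\<^sub>u w - [w, u]\<close> by \<open>\<langle>u, D w\<rangle>\<close>, and that
  term vanishes for \<open>w\<close> and \<open>u\<close> in orthogonal parts preserved by \<open>D\<close>.\<close>

lemma mixed_bracket:
  assumes w: "w \<in> EP" and u: "u \<in> EM"
  shows "dorfman \<A> H F w u = D w u - D u w"
proof (rule section_eqI)
  note ws = EP_sections[OF w] and us = EM_sections[OF u]
  show "dorfman \<A> H F w u \<in> sections \<A>" "D w u - D u w \<in> sections \<A>"
    using ws us by (auto intro: dorfman_section sections_diff D_sections)
  fix b assume "b \<in> P \<union> M"
  then have b: "e b \<in> sections \<A>" by (rule e_sections)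
  have "pairing u (D (e b) w) = 0"
    using EP_EM[OF D_EP[OF b w] u] by (simp add: pairing_commute)
  then have "pairing (D w u - D u w - dorfman \<A> H F w u) (e b) = 0"
    using torsion_free[OF ws us b] by (simp add: torsion_def)
  then show "pairing (dorfman \<A> H F w u) (e b) = pairing (D w u - D u w) (e b)"
    using pairing_diff_left[of "D w u - D u w" "dorfman \<A> H F w u" "e b"] b ws us
    by (simp add: sections_diff D_sections dorfman_section)
qed

definition \<Gamma> :: "nat \<Rightarrow> nat \<Rightarrow> nat \<Rightarrow> 'g \<Rightarrow> real" where
  "\<Gamma> a b c = pairing (D (e a) (e b)) (e c)"

definition B :: "nat \<Rightarrow> nat \<Rightarrow> nat \<Rightarrow> 'g \<Rightarrow> real" where
  "B a b c = pairing (dorfman \<A> H F (e a) (e b)) (e c)"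

lemma \<Gamma>_skew:
  assumes "a \<in> P \<union> M" "b \<in> P \<union> M" "c \<in> P \<union> M"
  shows "\<Gamma> a b c x = - \<Gamma> a c b x"
proof -
  have "anchor (e a) (pairing (e b) (e c)) = 0"
    unfolding orthonormal[OF assms(2,3)] by (rule vf_const[OF anchor_vf[OF e_sections[OF assms(1)]]])
  then have "pairing (D (e a) (e b)) (e c) + pairing (e b) (D (e a) (e c)) = 0"
    using D_metric[OF assms[THEN e_sections]] by simp
  then show ?thesis unfolding \<Gamma>_def pairing_commute[of "e b"]
    by (metis add_eq_0_iff2 plus_fun_apply zero_fun_apply)
qed

lemma \<Gamma>_mixed:
  assumes "a \<in> P \<union> M" "b \<in> P" "j \<in> M"
  shows "\<Gamma> a b j x = 0" "\<Gamma> a j b x = 0"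
  using EP_EM[OF D_EP[OF e_sections[OF assms(1)] e_EP[OF assms(2)]] e_EM[OF assms(3)]] \<Gamma>_skew[of a j b x] assms
  by (auto simp: \<Gamma>_def)

text \<open>Vanishing of the torsion, with the skew symmetry of \<open>\<Gamma>\<close> used to write it as a cyclic sum.  The
  total skew symmetry of \<open>B\<close> is read off from this formula.\<close>

lemma B_eq:
  assumes "a \<in> P \<union> M" "b \<in> P \<union> M" "c \<in> P \<union> M"
  shows "B a b c x = \<Gamma> a b c x + \<Gamma> b c a x + \<Gamma> c a b x"
proof -
  note s = assms[THEN e_sections]
  have "\<Gamma> a b c - \<Gamma> b a c - B a b c + \<Gamma> c a b = 0"
    using torsion_free[OF s] s unfolding torsion_def pairing_commute[of "e b"]
    by (simp add: pairing_diff_left sections_diff D_sections dorfman_section \<Gamma>_def B_def)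
  from fun_cong[OF this, of x] have "\<Gamma> a b c x - \<Gamma> b a c x - B a b c x + \<Gamma> c a b x = 0" by simp
  then show ?thesis using \<Gamma>_skew[OF assms(2,1,3), of x] by simp
qed

lemma B_skew:
  assumes "a \<in> P \<union> M" "b \<in> P \<union> M" "c \<in> P \<union> M"
  shows "B b a c x = - B a b c x" "B a c b x = - B a b c x"
  using \<Gamma>_skew[OF assms, of x] \<Gamma>_skew[OF assms(2,3,1), of x] \<Gamma>_skew[OF assms(3,1,2), of x]
    B_eq[OF assms, of x] B_eq[OF assms(2,1,3), of x] B_eq[OF assms(1,3,2), of x]
  by linarith+

text \<open>In the cyclic sum for indices of mixed type two of the three terms pair sections of orthogonal
  parts.\<close>

lemma \<Gamma>_determined:
  assumes "i \<in> M" "b \<in> P" "c \<in> P"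
  shows "\<Gamma> i b c x = B i b c x"
  using B_eq[of i b c x] \<Gamma>_mixed[of b c i x] \<Gamma>_mixed[of c b i x] assms by auto

lemma \<Gamma>_determined':
  assumes "b \<in> P" "i \<in> M" "j \<in> M"
  shows "\<Gamma> b i j x = B b i j x"
  using B_eq[of b i j x] \<Gamma>_mixed[of i b j x] \<Gamma>_mixed[of j b i x] assms by auto

lemma \<Gamma>_smooth: "a \<in> P \<union> M \<Longrightarrow> b \<in> P \<union> M \<Longrightarrow> c \<in> P \<union> M \<Longrightarrow> \<Gamma> a b c \<in> smooth_funs \<A>"
  unfolding \<Gamma>_def by (intro pairing_smooth D_sections e_sections)

text \<open>The trace runs over the whole frame, but for \<open>e\<^sub>a\<close> in one part the indices of the other part
  contribute nothing, since \<open>D\<close> preserves the parts.\<close>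

lemma divergence_P:
  assumes a: "a \<in> P"
  shows "divergence_of \<A> D (e a) = (\<Sum>b\<in>P. \<epsilon> b *\<^sub>R \<Gamma> b a b)"
proof -
  have ea: "e a \<in> sections \<A>" using a e_sections by blast
  have "divergence_of \<A> D (e a) = (\<Sum>b\<in>P \<union> M. \<epsilon> b *\<^sub>R pairing (D (e b) (e a)) (e b))"
    unfolding divergence_of_def
    using index ea
    by (intro bundle_trace_orthonormal submodule_sections e_sections orthonormal sgn expansion)
      (auto simp: smooth_linear_def D_add_left D_smult_left D_sections)
  also have "\<dots> = (\<Sum>b\<in>P. \<epsilon> b *\<^sub>R \<Gamma> b a b) + (\<Sum>b\<in>M. \<epsilon> b *\<^sub>R \<Gamma> b a b)"
    unfolding \<Gamma>_def using index by (intro sum.union_disjoint)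
  also have "(\<Sum>b\<in>M. \<epsilon> b *\<^sub>R \<Gamma> b a b) = 0"
    using \<Gamma>_mixed(1)[OF _ a] by (intro sum.neutral) (auto simp: fun_eq_iff scaleR_fun_def)
  finally show ?thesis by simp
qed

text \<open>For general arguments the curvature of a generalized connection is not tensorial, since the
  Dorfman bracket \<open>[f w, u]\<close> contains a term with \<open>\<langle>w, u\<rangle>\<close>.  For \<open>w\<close> and \<open>u\<close> in orthogonal parts
  the bracket is \<open>D\<^sub>w u - D\<^sub>u w\<close>, and the usual cancellation of derivatives of \<open>f\<close> takes place.\<close>

lemma curvature_linear:
  assumes u: "u \<in> EM" and z: "z \<in> EP"
  shows "smooth_linear EP (\<lambda>w. curvature \<A> H F D w u z) (\<odot>)"
    and "\<And>w. w \<in> EP \<Longrightarrow> curvature \<A> H F D w u z \<in> EP"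
proof -
  note us = EM_sections[OF u] and zs = EP_sections[OF z]
  have R: "curvature \<A> H F D w u z = D w (D u z) - D u (D w z) - (D (D w u) z - D (D u w) z)"
    if w: "w \<in> EP" for w
    using EP_sections[OF w] us zs
    by (simp add: curvature_def mixed_bracket[OF w u] D_diff_left D_sections)
  show "curvature \<A> H F D w u z \<in> EP" if w: "w \<in> EP" for w
    unfolding R[OF w] using EP_sections[OF w] us z
    by (intro submodule_diff[OF sub(1)] D_EP D_sections) auto
  show "smooth_linear EP (\<lambda>w. curvature \<A> H F D w u z) (\<odot>)"
    unfolding smooth_linear_def
  proof (intro conjI ballI)
    fix w w' assume w: "w \<in> EP" "w' \<in> EP"
    then have "w + w' \<in> EP" using sub by (simp add: submodule_def)
    then show "curvature \<A> H F D (w + w') u z = curvature \<A> H F D w u z + curvature \<A> H F D w' u z"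
      using EP_sections[OF w(1)] EP_sections[OF w(2)] us zs w
      by (simp add: R D_add_left D_add_right D_sections algebra_simps)
  next
    fix f w assume f: "f \<in> smooth_funs \<A>" and w: "w \<in> EP"
    then have fw: "f \<odot> w \<in> EP" using sub by (simp add: submodule_def)
    note ws = EP_sections[OF w]
    have uf: "anchor u f \<in> smooth_funs \<A>" using vf_smooth[OF anchor_vf[OF us] f] .
    \<comment> \<open>both terms below contain \<open>anchor u f \<odot> D w z\<close>, with opposite signs in the curvature\<close>
    have "D u (D (f \<odot> w) z) = anchor u f \<odot> D w z + f \<odot> D u (D w z)"
      using f us ws zs by (simp add: D_smult_left D_smult_right D_sections)
    moreover have "D (D u (f \<odot> w)) z = anchor u f \<odot> D w z + f \<odot> D (D u w) z"
      using f us ws zs uf by (simp add: D_smult_left D_smult_right D_add_left D_sections sections_smult)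
    ultimately show "curvature \<A> H F D (f \<odot> w) u z = f \<odot> curvature \<A> H F D w u z"
      using f us ws zs
      by (simp add: R[OF w] R[OF fw] D_smult_left D_sections smult_diff_right)
  qed
qed

text \<open>Metricity moves the outer derivative to the other argument of the pairing.  The resulting
  derivative of \<open>\<Gamma> i a b = B i a b\<close> vanishes, that of \<open>\<Gamma> b a b\<close> becomes one of the divergence
  after summation.\<close>

lemma curvature_component:
  assumes b: "b \<in> P" and i: "i \<in> M" and a: "a \<in> P"
  shows "pairing (curvature \<A> H F D (e b) (e i) (e a)) (e b) x =
      (\<Sum>c\<in>P. \<epsilon> c * B i a c x * \<Gamma> b c b x) - anchor (e i) (\<Gamma> b a b) x
      + (\<Sum>c\<in>P. \<epsilon> c * \<Gamma> b a c x * B i b c x)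
      - (\<Sum>j\<in>M. \<epsilon> j * B b i j x * B j a b x)
      + (\<Sum>c\<in>P. \<epsilon> c * B i b c x * \<Gamma> c a b x)"
proof -
  have I: "b \<in> P \<union> M" "i \<in> P \<union> M" "a \<in> P \<union> M" using assms by auto
  note s = I[THEN e_sections]
  have split: "(\<Sum>c\<in>P \<union> M. h c) = (\<Sum>c\<in>P. h c) + (\<Sum>c\<in>M. h c)" for h :: "nat \<Rightarrow> real"
    using index by (intro sum.union_disjoint)
  have PP: "(\<Sum>c\<in>P \<union> M. h c) = (\<Sum>c\<in>P. h c)" if "\<And>c. c \<in> M \<Longrightarrow> h c = 0" for h :: "nat \<Rightarrow> real"
    using split[of h] that by simp
  have t1: "pairing (D (e b) (D (e i) (e a))) (e b) x = (\<Sum>c\<in>P. \<epsilon> c * B i a c x * \<Gamma> b c b x)"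
  proof -
    have "\<Gamma> i a b = B i a b" using \<Gamma>_determined[OF i a b] by auto
    then obtain k where "\<Gamma> i a b = (\<lambda>_. k)" using structure_constants[OF I(2,3,1)] by (auto simp: B_def)
    then have "anchor (e b) (pairing (D (e i) (e a)) (e b)) = 0"
      using vf_const[OF anchor_vf[OF s(1)]] by (simp add: \<Gamma>_def)
    then have "pairing (D (e b) (D (e i) (e a))) (e b) + pairing (D (e i) (e a)) (D (e b) (e b)) = 0"
      using D_metric[OF s(1) D_sections[OF s(2,3)] s(1)] by simp
    from fun_cong[OF this, of x] have "pairing (D (e b) (D (e i) (e a))) (e b) x = - pairing (D (e i) (e a)) (D (e b) (e b)) x"
        by simp
    also have "pairing (D (e i) (e a)) (D (e b) (e b)) x = (\<Sum>c\<in>P \<union> M. \<epsilon> c * \<Gamma> i a c x * \<Gamma> b b c x)"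
      using s by (subst pairing_expansion) (simp_all add: D_sections \<Gamma>_def)
    also have "\<dots> = (\<Sum>c\<in>P. \<epsilon> c * \<Gamma> i a c x * \<Gamma> b b c x)"
      by (rule PP) (simp add: \<Gamma>_mixed[OF I(2) a])
    also have "- \<dots> = (\<Sum>c\<in>P. \<epsilon> c * B i a c x * \<Gamma> b c b x)"
      unfolding sum_negf[symmetric]
    proof (rule sum.cong[OF refl])
      fix c assume c: "c \<in> P"
      show "- (\<epsilon> c * \<Gamma> i a c x * \<Gamma> b b c x) = \<epsilon> c * B i a c x * \<Gamma> b c b x"
        using \<Gamma>_skew[of b b c x] c I by (simp add: \<Gamma>_determined[OF i a c])
    qed
    finally show ?thesis .
  qed
  have t2: "pairing (D (e i) (D (e b) (e a))) (e b) x
      = anchor (e i) (\<Gamma> b a b) x - (\<Sum>c\<in>P. \<epsilon> c * \<Gamma> b a c x * B i b c x)"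
  proof -
    have "anchor (e i) (\<Gamma> b a b) = pairing (D (e i) (D (e b) (e a))) (e b) + pairing (D (e b) (e a)) (D (e i) (e b))"
      using D_metric[OF s(2) D_sections[OF s(1,3)] s(1)] by (simp add: \<Gamma>_def)
    then have "pairing (D (e i) (D (e b) (e a))) (e b) x
        = anchor (e i) (\<Gamma> b a b) x - pairing (D (e b) (e a)) (D (e i) (e b)) x" by simp
    also have "pairing (D (e b) (e a)) (D (e i) (e b)) x = (\<Sum>c\<in>P \<union> M. \<epsilon> c * \<Gamma> b a c x * \<Gamma> i b c x)"
      using s by (subst pairing_expansion) (simp_all add: D_sections \<Gamma>_def)
    also have "\<dots> = (\<Sum>c\<in>P. \<epsilon> c * \<Gamma> b a c x * \<Gamma> i b c x)"
      by (rule PP) (simp add: \<Gamma>_mixed[OF I(1) a])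
    also have "\<dots> = (\<Sum>c\<in>P. \<epsilon> c * \<Gamma> b a c x * B i b c x)"
      by (intro sum.cong) (auto simp: \<Gamma>_determined[OF i b])
    finally show ?thesis .
  qed
  have t3: "pairing (D (D (e b) (e i)) (e a)) (e b) x = (\<Sum>j\<in>M. \<epsilon> j * B b i j x * B j a b x)"
  proof -
    have "pairing (D (D (e b) (e i)) (e a)) (e b) x = (\<Sum>c\<in>P \<union> M. \<epsilon> c * \<Gamma> b i c x * \<Gamma> c a b x)"
      using s by (subst D_expansion) (simp_all add: D_sections \<Gamma>_def)
    also have "\<dots> = (\<Sum>j\<in>M. \<epsilon> j * \<Gamma> b i j x * \<Gamma> j a b x)"
      unfolding split by (simp add: \<Gamma>_mixed(2)[OF I(1) _ i])
    also have "\<dots> = (\<Sum>j\<in>M. \<epsilon> j * B b i j x * B j a b x)"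
      by (intro sum.cong) (auto simp: \<Gamma>_determined[OF _ a b] \<Gamma>_determined'[OF b i])
    finally show ?thesis .
  qed
  have t4: "pairing (D (D (e i) (e b)) (e a)) (e b) x = (\<Sum>c\<in>P. \<epsilon> c * B i b c x * \<Gamma> c a b x)"
  proof -
    have "pairing (D (D (e i) (e b)) (e a)) (e b) x = (\<Sum>c\<in>P \<union> M. \<epsilon> c * \<Gamma> i b c x * \<Gamma> c a b x)"
      using s by (subst D_expansion) (simp_all add: D_sections \<Gamma>_def)
    also have "\<dots> = (\<Sum>c\<in>P. \<epsilon> c * \<Gamma> i b c x * \<Gamma> c a b x)"
      by (rule PP) (simp add: \<Gamma>_mixed[OF I(2) b])
    also have "\<dots> = (\<Sum>c\<in>P. \<epsilon> c * B i b c x * \<Gamma> c a b x)"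
      by (intro sum.cong) (auto simp: \<Gamma>_determined[OF i b])
    finally show ?thesis .
  qed
  have "curvature \<A> H F D (e b) (e i) (e a) = D (e b) (D (e i) (e a)) - D (e i) (D (e b) (e a))
      - (D (D (e b) (e i)) (e a) - D (D (e i) (e b)) (e a))"
    using s by (simp add: curvature_def mixed_bracket[OF e_EP[OF b] e_EM[OF i]] D_diff_left D_sections)
  then have "pairing (curvature \<A> H F D (e b) (e i) (e a)) (e b) x =
      pairing (D (e b) (D (e i) (e a))) (e b) x - pairing (D (e i) (D (e b) (e a))) (e b) x
      - (pairing (D (D (e b) (e i)) (e a)) (e b) x - pairing (D (D (e i) (e b)) (e a)) (e b) x)"
    using s by (simp add: pairing_diff_left D_sections sections_diff)
  then show ?thesis unfolding t1 t2 t3 t4 by simp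
qed

text \<open>After summation over \<open>b\<close> the products of \<open>\<Gamma>\<close> of pure type with \<open>B i b c\<close> cancel in pairs, by
  the skew symmetry of \<open>B i b c\<close> in \<open>b, c\<close>.  All other occurrences of \<open>\<Gamma>\<close> of pure type are
  contracted to the divergence.\<close>

lemma ricci_component:
  assumes i: "i \<in> M" and a: "a \<in> P" and const: "\<exists>k. divergence_of \<A> D (e a) = (\<lambda>_. k)"
  shows "bundle_trace \<A> EP (\<lambda>w. curvature \<A> H F D w (e i) (e a)) x =
    (\<Sum>b\<in>P. (\<Sum>j\<in>M. \<epsilon> b * \<epsilon> j * B b i j x * B a j b x) + \<epsilon> b * B i a b x * divergence_of \<A> D (e b) x)"
proof -
  have "u = (\<Sum>b\<in>P. (\<epsilon> b *\<^sub>R pairing u (e b)) \<odot> e b)" if u: "u \<in> EP" for u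
  proof -
    have "(\<Sum>b\<in>M. (\<epsilon> b *\<^sub>R pairing u (e b)) \<odot> e b) = 0"
      using EP_EM[OF u e_EM] by (intro sum.neutral) (auto simp: smult_zero_left)
    moreover have "u = (\<Sum>b\<in>P. (\<epsilon> b *\<^sub>R pairing u (e b)) \<odot> e b) + (\<Sum>b\<in>M. (\<epsilon> b *\<^sub>R pairing u (e b)) \<odot> e b)"
      using expansion[OF EP_sections[OF u]] index by (simp add: sum.union_disjoint)
    ultimately show ?thesis by simp
  qed
  note trace = bundle_trace_orthonormal[OF index(1) sub(1) e_EP orthonormal sgn this
      curvature_linear[OF e_EM[OF i] e_EP[OF a]]]
  have trace: "bundle_trace \<A> EP (\<lambda>w. curvature \<A> H F D w (e i) (e a)) x
      = (\<Sum>b\<in>P. \<epsilon> b * pairing (curvature \<A> H F D (e b) (e i) (e a)) (e b) x)"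
    by (subst trace) (auto simp: sum_fun_apply scaleR_fun_def)
  have expand: "(\<Sum>b\<in>P. \<epsilon> b * pairing (curvature \<A> H F D (e b) (e i) (e a)) (e b) x)
      = (\<Sum>b\<in>P. \<epsilon> b * (\<Sum>c\<in>P. \<epsilon> c * B i a c x * \<Gamma> b c b x)) - (\<Sum>b\<in>P. \<epsilon> b * anchor (e i) (\<Gamma> b a b) x)
      - (\<Sum>b\<in>P. \<epsilon> b * (\<Sum>j\<in>M. \<epsilon> j * B b i j x * B j a b x))
      + ((\<Sum>b\<in>P. \<epsilon> b * (\<Sum>c\<in>P. \<epsilon> c * \<Gamma> b a c x * B i b c x)) + (\<Sum>b\<in>P. \<epsilon> b * (\<Sum>c\<in>P. \<epsilon> c * B i b c x * \<Gamma> c a b x)))"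
    using i a by (simp add: curvature_component distrib_left right_diff_distrib sum.distrib sum_subtractf)
  have cancel: "(\<Sum>b\<in>P. \<epsilon> b * (\<Sum>c\<in>P. \<epsilon> c * B i b c x * \<Gamma> c a b x)) = - (\<Sum>b\<in>P. \<epsilon> b * (\<Sum>c\<in>P. \<epsilon> c * \<Gamma> b a c x * B i b c x))"
    unfolding sum_negf[symmetric] sum_distrib_left
  proof (subst sum.swap, intro sum.cong[OF refl])
    fix c b assume "c \<in> P" "b \<in> P"
    then show "\<epsilon> b * (\<epsilon> c * B i b c x * \<Gamma> c a b x) = - (\<epsilon> c * (\<epsilon> b * \<Gamma> c a b x * B i c b x))"
      using B_skew(2)[of i c b x] i by simp
  qed
  have derivative: "(\<Sum>b\<in>P. \<epsilon> b * anchor (e i) (\<Gamma> b a b) x) = 0"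
  proof -
    have vi: "anchor (e i) \<in> vector_fields \<A>" using i by (intro anchor_vf e_sections) auto
    have sm: "\<Gamma> b a b \<in> smooth_funs \<A>" if "b \<in> P" for b using that a by (intro \<Gamma>_smooth) auto
    have "anchor (e i) (\<Sum>b\<in>P. \<epsilon> b *\<^sub>R \<Gamma> b a b) = (\<Sum>b\<in>P. anchor (e i) (\<epsilon> b *\<^sub>R \<Gamma> b a b))"
      by (rule vf_sum_arg[OF vi]) (rule smooth_scaleR[OF sm])
    moreover have "anchor (e i) (\<Sum>b\<in>P. \<epsilon> b *\<^sub>R \<Gamma> b a b) = 0"
      using const vf_const[OF vi] by (auto simp: divergence_P[OF a, symmetric])
    ultimately have "(\<Sum>b\<in>P. \<epsilon> b *\<^sub>R anchor (e i) (\<Gamma> b a b)) = 0"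
      by (simp add: vf_scaleR_arg[OF vi sm])
    from fun_cong[OF this, of x] show ?thesis by (simp add: sum_fun_apply scaleR_fun_def)
  qed
  have divergence: "(\<Sum>b\<in>P. \<epsilon> b * (\<Sum>c\<in>P. \<epsilon> c * B i a c x * \<Gamma> b c b x))
      = (\<Sum>c\<in>P. \<epsilon> c * B i a c x * divergence_of \<A> D (e c) x)"
  proof -
    have "(\<Sum>b\<in>P. \<epsilon> b * (\<Sum>c\<in>P. \<epsilon> c * B i a c x * \<Gamma> b c b x))
        = (\<Sum>c\<in>P. \<Sum>b\<in>P. \<epsilon> b * (\<epsilon> c * B i a c x * \<Gamma> b c b x))"
      unfolding sum_distrib_left by (rule sum.swap)
    also have "\<dots> = (\<Sum>c\<in>P. \<epsilon> c * B i a c x * divergence_of \<A> D (e c) x)"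
      by (intro sum.cong[OF refl])
        (simp add: divergence_P sum_fun_apply scaleR_fun_def sum_distrib_left mult_ac)
    finally show ?thesis .
  qed
  have quadratic: "(\<Sum>b\<in>P. \<epsilon> b * (\<Sum>j\<in>M. \<epsilon> j * B b i j x * B j a b x))
      = - (\<Sum>b\<in>P. \<Sum>j\<in>M. \<epsilon> b * \<epsilon> j * B b i j x * B a j b x)"
    unfolding sum_negf[symmetric] sum_distrib_left
  proof (intro sum.cong[OF refl])
    fix b j assume "b \<in> P" "j \<in> M"
    then show "\<epsilon> b * (\<epsilon> j * B b i j x * B j a b x) = - (\<epsilon> b * \<epsilon> j * B b i j x * B a j b x)"
      using B_skew(1)[of a j b x] a by simp
  qed
  show ?thesis
    unfolding trace expand cancel derivative divergence quadratic sum.distrib by simp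
qed

end


section \<open>The Dorfman bracket and the frame induced by an orthonormal basis\<close>

context parallelized
begin

text \<open>One-forms before extension by \<open>0\<close> to operators that are not vector fields.\<close>

definition vf_linear :: "'g cov1 \<Rightarrow> bool" where
  "vf_linear T \<longleftrightarrow> (\<forall>X\<in>vector_fields \<A>. T X \<in> smooth_funs \<A>) \<and>
     (\<forall>X\<in>vector_fields \<A>. \<forall>Y\<in>vector_fields \<A>. T (X + Y) = T X + T Y) \<and>
     (\<forall>f\<in>smooth_funs \<A>. \<forall>X\<in>vector_fields \<A>. T (vf_smult f X) = f * T X)"

lemma vf_linear_one_form: "vf_linear T \<Longrightarrow> restrict0 (vector_fields \<A>) T \<in> one_forms \<A>"
  by (auto simp: vf_linear_def one_forms_def restrict0_def vf_add vf_smult)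

lemma one_form_vf_linear: "\<xi> \<in> one_forms \<A> \<Longrightarrow> vf_linear \<xi>"
  by (auto simp: vf_linear_def one_forms_def)

lemma vf_linear_add: "vf_linear S \<Longrightarrow> vf_linear T \<Longrightarrow> vf_linear (\<lambda>X. S X + T X)"
  by (auto simp: vf_linear_def smooth_add algebra_simps)

lemma vf_linear_smult: "f \<in> smooth_funs \<A> \<Longrightarrow> vf_linear T \<Longrightarrow> vf_linear (\<lambda>X. f * T X)"
  by (auto simp: vf_linear_def smooth_mult algebra_simps)

lemma vf_linear_scaleR: "vf_linear T \<Longrightarrow> vf_linear (\<lambda>X. r *\<^sub>R T X)"
  using vf_linear_smult[OF smooth_const[of r]] by (simp add: scaleR_fun_def times_fun_def)

lemma vf_linear_diff: "vf_linear S \<Longrightarrow> vf_linear T \<Longrightarrow> vf_linear (\<lambda>X. S X - T X)"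
  using vf_linear_add[of S "\<lambda>X. (-1) *\<^sub>R T X"] vf_linear_scaleR[of T "-1"] by simp

lemma lie_bracket_add_right:
  assumes "X \<in> vector_fields \<A>" "Y \<in> vector_fields \<A>" "Z \<in> vector_fields \<A>"
  shows "lie_bracket X (Y + Z) = lie_bracket X Y + lie_bracket X Z"
proof
  fix f
  show "lie_bracket X (Y + Z) f = (lie_bracket X Y + lie_bracket X Z) f"
  proof (cases "f \<in> smooth_funs \<A>")
    case True
    then show ?thesis using assms by (simp add: lie_bracket_def vf_derivation(1) vf_smooth fun_eq_iff)
  next
    case False
    show ?thesis
      by (simp only: lie_bracket_def plus_fun_apply assms[THEN vf_nonsmooth, OF False]
          assms[THEN vf_zero_arg] add_0_left diff_self)
  qed
qed

lemma lie_bracket_smult_right: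
  assumes X: "X \<in> vector_fields \<A>" and Y: "Y \<in> vector_fields \<A>" and h: "h \<in> smooth_funs \<A>"
  shows "lie_bracket X (vf_smult h Y) = vf_smult (X h) Y + vf_smult h (lie_bracket X Y)"
proof
  fix f
  show "lie_bracket X (vf_smult h Y) f = (vf_smult (X h) Y + vf_smult h (lie_bracket X Y)) f"
  proof (cases "f \<in> smooth_funs \<A>")
    case True
    have "X (h * Y f) = h * X (Y f) + X h * Y f"
      by (rule vf_derivation(2)[OF X h vf_smooth[OF Y True]])
    then show ?thesis by (simp add: lie_bracket_def vf_smult_def algebra_simps)
  next
    case False
    show ?thesis
      by (simp only: lie_bracket_def vf_smult_def plus_fun_apply X[THEN vf_nonsmooth, OF False]
          Y[THEN vf_nonsmooth, OF False] X[THEN vf_zero_arg] Y[THEN vf_zero_arg]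
          mult_zero_right add_0_left diff_self)
  qed
qed

text \<open>The derivative of \<open>f\<close> in \<open>X (f \<cdot> \<eta> Z)\<close> cancels with that in \<open>[X, f Z]\<close>.  The same expression with
  \<open>\<xi>, Y\<close> instead of \<open>\<eta>, X\<close> is \<open>i\<^sub>Y d\<xi>\<close> up to the term \<open>Z (\<xi> Y)\<close>.\<close>

lemma lie_derivative_linear:
  assumes X: "X \<in> vector_fields \<A>" and \<eta>: "\<eta> \<in> one_forms \<A>"
  shows "vf_linear (\<lambda>Z. X (\<eta> Z) - \<eta> (lie_bracket X Z))"
  unfolding vf_linear_def
proof (intro conjI ballI)
  fix Z assume Z: "Z \<in> vector_fields \<A>"
  show "X (\<eta> Z) - \<eta> (lie_bracket X Z) \<in> smooth_funs \<A>"
    by (rule smooth_diff[OF vf_smooth[OF X one_form_smooth[OF \<eta> Z]] one_form_smooth[OF \<eta> vf_lie_bracket[OF X Z]]])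
  show "X (\<eta> (Z + W)) - \<eta> (lie_bracket X (Z + W))
      = (X (\<eta> Z) - \<eta> (lie_bracket X Z)) + (X (\<eta> W) - \<eta> (lie_bracket X W))"
    if W: "W \<in> vector_fields \<A>" for W
    by (simp add: lie_bracket_add_right[OF X Z W] one_form_add[OF \<eta>] Z W vf_lie_bracket X
        vf_derivation(1)[OF X] one_form_smooth[OF \<eta>])
  show "X (\<eta> (vf_smult f Z)) - \<eta> (lie_bracket X (vf_smult f Z)) = f * (X (\<eta> Z) - \<eta> (lie_bracket X Z))"
    if f: "f \<in> smooth_funs \<A>" for f
    by (simp add: lie_bracket_smult_right[OF X Z f] one_form_add[OF \<eta>] one_form_smult[OF \<eta>] Z f
        vf_lie_bracket X vf_smult vf_smooth[OF X] vf_derivation(2)[OF X] one_form_smooth[OF \<eta>] algebra_simps)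
qed

lemma vf_evaluation_linear:
  assumes "l \<in> smooth_funs \<A>"
  shows "vf_linear (\<lambda>Z. Z l)"
  using assms by (simp add: vf_linear_def vf_smooth vf_smult_def)

lemma dorfman_sections:
  assumes H: "H \<in> three_forms \<A>" and F: "F \<in> two_forms \<A>"
    and u: "u \<in> sections \<A>" and w: "w \<in> sections \<A>"
  shows "dorfman \<A> H F u w \<in> sections \<A>"
proof -
  obtain X \<xi> l Y \<eta> m where uw: "u = (X, \<xi>, l)" "w = (Y, \<eta>, m)" by (metis prod_cases3)
  have s: "X \<in> vector_fields \<A>" "\<xi> \<in> one_forms \<A>" "l \<in> smooth_funs \<A>"
    "Y \<in> vector_fields \<A>" "\<eta> \<in> one_forms \<A>" "m \<in> smooth_funs \<A>"
    using u w uw by (auto simp: sections_def)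
  have FX: "F X \<in> one_forms \<A>" and FY: "F Y \<in> one_forms \<A>" using F s by (auto simp: two_forms_def)
  have "H Y \<in> two_forms \<A>" using H s(4) unfolding three_forms_def by blast
  then have HYX: "H Y X \<in> one_forms \<A>" using s(1) unfolding two_forms_def by blast
  have "vf_linear (\<lambda>Z. (X (\<eta> Z) - \<eta> (lie_bracket X Z)) - ((Y (\<xi> Z) - \<xi> (lie_bracket Y Z)) - Z (\<xi> Y))
      + 2 *\<^sub>R (m * Z l) + H Y X Z - 2 *\<^sub>R (m * F X Z - l * F Y Z))"
    using s FX FY HYX
    by (intro vf_linear_add vf_linear_diff vf_linear_scaleR vf_linear_smult lie_derivative_linear
        one_form_vf_linear vf_evaluation_linear one_form_smooth[of \<xi>])
  then have "vf_linear (\<lambda>Z. lie_derivative1 X \<eta> Z - ext_d1 \<xi> Y Z + 2 *\<^sub>R (m * Z l)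
        + H Y X Z - 2 *\<^sub>R (m * F X Z - l * F Y Z))"
    by (simp add: lie_derivative1_def ext_d1_def algebra_simps)
  moreover have "X m - Y l + F X Y \<in> smooth_funs \<A>"
    using s by (intro smooth_add smooth_diff one_form_smooth[OF FX] vf_smooth[of X] vf_smooth[of Y])
  ultimately show ?thesis
    using s by (simp add: uw dorfman_def sections_def vf_lie_bracket vf_linear_one_form)
qed

end

locale metric_frame = parallelized \<A> n v
  for \<A> :: "('g::{t2_space, second_countable_topology}, 'e::euclidean_space) chart set"
    and n :: nat and v :: "nat \<Rightarrow> 'g vf" +
  fixes g :: "'g cov2" and \<epsilon>\<^sub>0 :: "nat \<Rightarrow> real"
  assumes metric: "g \<in> pseudo_riemannian_metrics \<A>"
    and unit: "a \<in> {1..n} \<Longrightarrow> \<epsilon>\<^sub>0 a * \<epsilon>\<^sub>0 a = 1"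
    and g_frame: "a \<in> {1..n} \<Longrightarrow> b \<in> {1..n} \<Longrightarrow> g (v a) (v b) = (\<lambda>_. if a = b then \<epsilon>\<^sub>0 a else 0)"
begin

abbreviation e :: "nat \<Rightarrow> 'g sec" where "e \<equiv> induced_basis g n v"
abbreviation \<epsilon> :: "nat \<Rightarrow> real" where "\<epsilon> \<equiv> induced_sign n \<epsilon>\<^sub>0"

lemma e_simps:
  "e 0 = (0, 0, 1)"
  "a \<in> {1..n} \<Longrightarrow> e a = (v a, g (v a), 0)"
  "a \<in> {1..n} \<Longrightarrow> e (n + a) = (v a, - g (v a), 0)"
  by (auto simp: induced_basis_def)

lemma \<epsilon>_simps:
  "\<epsilon> 0 = 1" "a \<in> {1..n} \<Longrightarrow> \<epsilon> a = \<epsilon>\<^sub>0 a" "a \<in> {1..n} \<Longrightarrow> \<epsilon> (n + a) = - \<epsilon>\<^sub>0 a"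
  by (auto simp: induced_sign_def)

lemma index_cases:
  assumes "A \<in> {0..n} \<union> {n+1..2*n}"
  obtains "A = 0" | "A \<in> {1..n}" | a where "a \<in> {1..n}" "A = n + a"
proof -
  have "A = 0 \<or> A \<in> {1..n} \<or> (A - n \<in> {1..n} \<and> A = n + (A - n))" using assms by auto
  then show ?thesis using that by blast
qed

lemma sum_index_split:
  fixes h :: "nat \<Rightarrow> 'b::comm_monoid_add"
  shows "(\<Sum>A\<in>{0..n} \<union> {n+1..2*n}. h A) = h 0 + (\<Sum>a=1..n. h a + h (n + a))"
proof -
  have "(\<Sum>A\<in>{0..n} \<union> {n+1..2*n}. h A) = (\<Sum>A\<in>{0..n}. h A) + (\<Sum>A\<in>{n+1..2*n}. h A)"
    by (intro sum.union_disjoint) auto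
  also have "(\<Sum>A\<in>{0..n}. h A) = h 0 + (\<Sum>a=1..n. h a)" by (simp add: sum.atLeast_Suc_atMost)
  also have "(\<Sum>A\<in>{n+1..2*n}. h A) = (\<Sum>a=1..n. h (n + a))"
    using sum.shift_bounds_cl_nat_ivl[of h 1 n n] by (simp add: mult_2 add.commute)
  finally show ?thesis by (simp add: sum.distrib add.assoc)
qed

lemma g_one_form: "X \<in> vector_fields \<A> \<Longrightarrow> g X \<in> one_forms \<A>"
  and g_sym: "X \<in> vector_fields \<A> \<Longrightarrow> Y \<in> vector_fields \<A> \<Longrightarrow> g X Y = g Y X"
  using metric by (auto simp: pseudo_riemannian_metrics_def)

lemma g_add: "X \<in> vector_fields \<A> \<Longrightarrow> Y \<in> vector_fields \<A> \<Longrightarrow> g (X + Y) = g X + g Y"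
proof
  fix Z assume X: "X \<in> vector_fields \<A>" and Y: "Y \<in> vector_fields \<A>"
  note s = vf_add[OF X Y]
  show "g (X + Y) Z = (g X + g Y) Z"
  proof (cases "Z \<in> vector_fields \<A>")
    case True
    then show ?thesis
      by (simp add: g_sym[OF s True] g_sym[OF X True] g_sym[OF Y True] one_form_add[OF g_one_form X Y])
  next
    case False
    then show ?thesis by (simp add: one_form_outside[OF g_one_form] X Y s)
  qed
qed

lemma g_smult: "f \<in> smooth_funs \<A> \<Longrightarrow> X \<in> vector_fields \<A> \<Longrightarrow> g (vf_smult f X) = (\<lambda>Y. f * g X Y)"
proof
  fix Z assume f: "f \<in> smooth_funs \<A>" and X: "X \<in> vector_fields \<A>"
  note s = vf_smult[OF f X]
  show "g (vf_smult f X) Z = f * g X Z"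
  proof (cases "Z \<in> vector_fields \<A>")
    case True
    then show ?thesis
      by (simp add: g_sym[OF s True] g_sym[OF X True] one_form_smult[OF g_one_form X f])
  next
    case False
    then show ?thesis by (simp add: one_form_outside[OF g_one_form] X s)
  qed
qed

lemma e_sections: "A \<in> {0..n} \<union> {n+1..2*n} \<Longrightarrow> e A \<in> sections \<A>"
  by (erule index_cases)
    (auto simp: e_simps sections_def frame_vf g_one_form one_forms_uminus vf_0 one_forms_0 smooth_0 smooth_1)

lemma E_minus_submodule: "submodule (E_minus \<A> g)"
  unfolding submodule_def
proof (intro conjI ballI subsetI)
  show "u \<in> sections \<A>" if "u \<in> E_minus \<A> g" for u
    using that by (auto simp: E_minus_def sections_def g_one_form one_forms_uminus smooth_0)
  have "g 0 = 0" using g_add[OF vf_0 vf_0] by simp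
  then show "0 \<in> E_minus \<A> g" by (auto simp: E_minus_def zero_prod_def vf_0 intro!: exI[of _ 0])
  show "u + w \<in> E_minus \<A> g" if "u \<in> E_minus \<A> g" "w \<in> E_minus \<A> g" for u w
  proof -
    obtain X Y where "u = (X, - g X, 0)" "w = (Y, - g Y, 0)" "X \<in> vector_fields \<A>" "Y \<in> vector_fields \<A>"
      using \<open>u \<in> _\<close> \<open>w \<in> _\<close> by (auto simp: E_minus_def)
    then show ?thesis by (auto simp: E_minus_def g_add vf_add intro!: exI[of _ "X + Y"])
  qed
  show "f \<odot> u \<in> E_minus \<A> g" if f: "f \<in> smooth_funs \<A>" and "u \<in> E_minus \<A> g" for f u
  proof -
    obtain X where "u = (X, - g X, 0)" "X \<in> vector_fields \<A>" using \<open>u \<in> _\<close> by (auto simp: E_minus_def)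
    then show ?thesis using f
      by (auto simp: E_minus_def smult_def g_smult vf_smult fun_eq_iff intro!: exI[of _ "vf_smult f X"])
  qed
qed

lemma E_plus_submodule: "submodule (E_plus \<A> g)"
proof -
  have Em: "w \<in> sections \<A>" if "w \<in> E_minus \<A> g" for w
    using E_minus_submodule that by (auto simp: submodule_def)
  have "pairing 0 w = 0" if "w \<in> sections \<A>" for w
    using pairing_smult_left[OF smooth_0 sections_0 that] by (simp add: smult_zero_left)
  then show ?thesis
    by (auto simp: submodule_def E_plus_def sections_0 sections_add sections_smult Em
        pairing_add_left pairing_smult_left)
qed

lemma E_plus_E_minus: "u \<in> E_plus \<A> g \<Longrightarrow> w \<in> E_minus \<A> g \<Longrightarrow> pairing u w = 0"
  by (simp add: E_plus_def)

lemma e_E_minus: "i \<in> {n+1..2*n} \<Longrightarrow> e i \<in> E_minus \<A> g"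
proof -
  assume "i \<in> {n+1..2*n}"
  then have "i - n \<in> {1..n}" "i > n" by auto
  then show ?thesis using frame_vf[of "i - n"] by (auto simp: E_minus_def induced_basis_def)
qed

lemma e_E_plus:
  assumes "a \<in> {0..n}" shows "e a \<in> E_plus \<A> g"
proof -
  have "pairing (e a) (Y, - g Y, 0) = 0" if Y: "Y \<in> vector_fields \<A>" for Y
  proof (cases "a = 0")
    case True
    then show ?thesis using one_form_zero[OF g_one_form[OF Y]] by (simp add: e_simps pairing_def)
  next
    case False
    then have a: "a \<in> {1..n}" using assms by auto
    then show ?thesis using g_sym[OF frame_vf[OF a] Y] by (simp add: e_simps pairing_def)
  qed
  then show ?thesis using e_sections[of a] assms by (auto simp: E_plus_def E_minus_def)
qed

lemma pairing_e:
  assumes "u = (X, \<xi>, l)" "u \<in> sections \<A>"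
  shows "pairing u (e 0) = l"
    and "a \<in> {1..n} \<Longrightarrow> pairing u (e a) = (1/2) *\<^sub>R (\<xi> (v a) + g (v a) X)"
    and "a \<in> {1..n} \<Longrightarrow> pairing u (e (n + a)) = (1/2) *\<^sub>R (\<xi> (v a) - g (v a) X)"
  using assms by (auto simp: pairing_def e_simps sections_def one_form_zero)

lemma e_orthonormal:
  assumes A: "A \<in> {0..n} \<union> {n+1..2*n}" and C: "C \<in> {0..n} \<union> {n+1..2*n}"
  shows "pairing (e A) (e C) = (\<lambda>_. if A = C then \<epsilon> A else 0)"
proof -
  have z: "g (v a) 0 = 0" if "a \<in> {1..n}" for a using one_form_zero[OF g_one_form[OF frame_vf[OF that]]] .
  from A C show ?thesis
    by (elim index_cases) (auto simp: pairing_def e_simps \<epsilon>_simps g_frame z fun_eq_iff scaleR_fun_def)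
qed

lemma \<epsilon>_square: "A \<in> {0..n} \<union> {n+1..2*n} \<Longrightarrow> \<epsilon> A * \<epsilon> A = 1"
  by (erule index_cases) (auto simp: \<epsilon>_simps unit)

text \<open>For \<open>u = X + \<xi> + l\<close>, the terms with indices \<open>a\<close> and \<open>n + a\<close> add up to \<open>\<epsilon>\<^sub>a g(v\<^sub>a, X) v\<^sub>a\<close> in the
  tangent part and to \<open>\<epsilon>\<^sub>a \<xi>(v\<^sub>a) g(v\<^sub>a)\<close> in the cotangent part.\<close>

lemma e_expansion:
  assumes u: "u \<in> sections \<A>"
  shows "u = (\<Sum>A\<in>{0..n} \<union> {n+1..2*n}. (\<epsilon> A *\<^sub>R pairing u (e A)) \<odot> e A)"
proof -
  obtain X \<xi> l where uX: "u = (X, \<xi>, l)" by (metis prod_cases3)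
  have X: "X \<in> vector_fields \<A>" and \<xi>: "\<xi> \<in> one_forms \<A>" using u by (auto simp: uX sections_def)
  have gX: "X = (\<Sum>a=1..n. vf_smult (\<epsilon>\<^sub>0 a *\<^sub>R g (v a) X) (v a))" if "X \<in> vector_fields \<A>" for X
    using that by (rule frame_expansion) (auto simp: g_one_form frame_vf g_frame unit)
  have pair: "(\<epsilon> a *\<^sub>R pairing u (e a)) \<odot> e a + (\<epsilon> (n + a) *\<^sub>R pairing u (e (n + a))) \<odot> e (n + a)
      = (vf_smult (\<epsilon>\<^sub>0 a *\<^sub>R g (v a) X) (v a), (\<lambda>Z. \<epsilon>\<^sub>0 a *\<^sub>R \<xi> (v a) * g (v a) Z), 0)"
    if a: "a \<in> {1..n}" for a
    unfolding pairing_e(2,3)[OF uX u a] unfolding \<epsilon>_simps(2,3)[OF a] e_simps(2,3)[OF a] smult_def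
    by (simp add: vf_smult_def fun_eq_iff scaleR_fun_def algebra_simps)
  have "(\<Sum>A\<in>{0..n} \<union> {n+1..2*n}. (\<epsilon> A *\<^sub>R pairing u (e A)) \<odot> e A)
      = (0, 0, l) + (\<Sum>a=1..n. (vf_smult (\<epsilon>\<^sub>0 a *\<^sub>R g (v a) X) (v a), (\<lambda>Z. \<epsilon>\<^sub>0 a *\<^sub>R \<xi> (v a) * g (v a) Z), 0))"
    unfolding sum_index_split pairing_e(1)[OF uX u] unfolding \<epsilon>_simps(1) e_simps(1)
    by (intro arg_cong2[of _ _ _ _ "(+)"] sum.cong pair refl)
      (auto simp: smult_def vf_smult_def fun_eq_iff)
  also have "\<dots> = (X, \<xi>, l)"
  proof (intro prod_eqI)
    show "fst ((0, 0, l) + (\<Sum>a=1..n. (vf_smult (\<epsilon>\<^sub>0 a *\<^sub>R g (v a) X) (v a), (\<lambda>Z. \<epsilon>\<^sub>0 a *\<^sub>R \<xi> (v a) * g (v a) Z), 0)))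
        = fst (X, \<xi>, l)"
      using gX[OF X] by (simp add: fst_sum)
    show "snd (snd ((0, 0, l) + (\<Sum>a=1..n. (vf_smult (\<epsilon>\<^sub>0 a *\<^sub>R g (v a) X) (v a), (\<lambda>Z. \<epsilon>\<^sub>0 a *\<^sub>R \<xi> (v a) * g (v a) Z), 0))))
        = snd (snd (X, \<xi>, l))"
      by (simp add: snd_sum)
    have "(\<Sum>a=1..n. (\<lambda>Z. \<epsilon>\<^sub>0 a *\<^sub>R \<xi> (v a) * g (v a) Z)) = \<xi>"
    proof
      fix Z
      show "(\<Sum>a=1..n. (\<lambda>Z. \<epsilon>\<^sub>0 a *\<^sub>R \<xi> (v a) * g (v a) Z)) Z = \<xi> Z"
      proof (cases "Z \<in> vector_fields \<A>")
        case True
        have sm: "\<epsilon>\<^sub>0 a *\<^sub>R g (v a) Z \<in> smooth_funs \<A>" if "a \<in> {1..n}" for a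
          using one_form_smooth[OF g_one_form[OF frame_vf[OF that]] True] by (rule smooth_scaleR)
        have "\<xi> Z = \<xi> (\<Sum>a=1..n. vf_smult (\<epsilon>\<^sub>0 a *\<^sub>R g (v a) Z) (v a))" using gX[OF True] by (rule arg_cong)
        also have "\<dots> = (\<Sum>a=1..n. \<epsilon>\<^sub>0 a *\<^sub>R g (v a) Z * \<xi> (v a))"
          using sm frame_vf by (subst one_form_sum[OF \<xi>]) (auto simp: vf_smult one_form_smult[OF \<xi>])
        finally show ?thesis by (simp add: sum_fun_apply fun_eq_iff scaleR_fun_def mult_ac)
      next
        case False
        then show ?thesis
          by (simp add: sum_fun_apply one_form_outside[OF g_one_form[OF frame_vf]] one_form_outside[OF \<xi>])
      qed
    qed
    then show "fst (snd ((0, 0, l) + (\<Sum>a=1..n. (vf_smult (\<epsilon>\<^sub>0 a *\<^sub>R g (v a) X) (v a), (\<lambda>Z. \<epsilon>\<^sub>0 a *\<^sub>R \<xi> (v a) * g (v a) Z), 0))))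
        = fst (snd (X, \<xi>, l))"
      by (simp add: fst_sum snd_sum)
  qed
  finally show ?thesis by (simp add: uX)
qed

end


section \<open>Left-invariant tensors\<close>

lemma lie_algebra_eq:
  assumes "X \<in> lie_algebra \<A>"
  shows "X f (a + y) = X (\<lambda>z. f (a + z)) y"
proof -
  have "translate a X f (a + y) = X f (a + y)" using assms by (simp add: lie_algebra_def)
  then show ?thesis by (simp add: translate_def add.assoc[symmetric])
qed

lemma lie_algebra_translate: "X \<in> lie_algebra \<A> \<Longrightarrow> translate a X = X"
  by (simp add: lie_algebra_def)

lemma translate_lie_bracket:
  "translate a (lie_bracket X Y) = lie_bracket (translate a X) (translate a Y)"
  by (auto simp: translate_def lie_bracket_def fun_eq_iff add.assoc[symmetric])

text \<open>The left translations act transitively, and they carry the value at \<open>x\<close> to all other values.\<close>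

lemma lie_algebra_vanishing:
  assumes X: "X \<in> lie_algebra \<A>" and zero: "\<And>f. X f x = 0"
  shows "X = 0"
proof (rule ext, rule ext)
  fix f y
  have "X f ((y - x) + x) = X (\<lambda>z. f ((y - x) + z)) x" by (rule lie_algebra_eq[OF X])
  then show "X f y = 0 f y" using zero by simp
qed

lemma left_invariant1_constant:
  assumes "left_invariant1 \<A> \<omega>" "X \<in> lie_algebra \<A>"
  shows "\<omega> X x = \<omega> X 0"
proof -
  have "X \<in> vector_fields \<A>" using assms by (simp add: lie_algebra_def)
  then have "\<omega> (translate x X) (x + 0) = \<omega> X 0" using assms unfolding left_invariant1_def by blast
  then show ?thesis using lie_algebra_translate[OF assms(2)] by simp
qed

lemma left_invariant2_interior:
  assumes "left_invariant2 \<A> \<omega>" "X \<in> lie_algebra \<A>"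
  shows "left_invariant1 \<A> (\<omega> X)"
  using assms lie_algebra_translate[OF assms(2)] unfolding left_invariant1_def left_invariant2_def lie_algebra_def
  by force

lemma left_invariant3_interior:
  assumes "left_invariant3 \<A> \<omega>" "X \<in> lie_algebra \<A>"
  shows "left_invariant2 \<A> (\<omega> X)"
  using assms lie_algebra_translate[OF assms(2)] unfolding left_invariant2_def left_invariant3_def lie_algebra_def
  by force

text \<open>A relation at one point makes a left-invariant field vanish there, hence everywhere.\<close>

lemma invariant_frame_independent:
  fixes v :: "nat \<Rightarrow> ('g::group_add) vf"
  assumes inj: "inj_on v {1..n}" and indep: "independent (v ` {1..n})"
    and span: "span (v ` {1..n}) = lie_algebra \<A>"
    and zero: "\<And>f. (\<Sum>a=1..n. c a * v a f x) = 0" and a: "a \<in> {1..n}"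
  shows "c a = 0"
proof -
  have "(\<Sum>a=1..n. c a *\<^sub>R v a) \<in> span (v ` {1..n})"
    by (intro span_sum span_scale span_base) auto
  then have "(\<Sum>a=1..n. c a *\<^sub>R v a) \<in> lie_algebra \<A>" using span by simp
  then have V: "(\<Sum>a=1..n. c a *\<^sub>R v a) = 0"
  proof (rule lie_algebra_vanishing)
    show "(\<Sum>a=1..n. c a *\<^sub>R v a) f x = 0" for f
      using zero[of f] by (simp add: sum_fun_apply scaleR_fun_def)
  qed
  define u where "u X = c (the_inv_into {1..n} v X)" for X
  have u: "u (v a) = c a" if "a \<in> {1..n}" for a
    by (simp only: u_def the_inv_into_f_f[OF inj that])
  have "(\<Sum>X\<in>v ` {1..n}. u X *\<^sub>R X) = (\<Sum>a=1..n. u (v a) *\<^sub>R v a)"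
    by (rule sum.reindex_cong[OF inj]) auto
  also have "\<dots> = (\<Sum>a=1..n. c a *\<^sub>R v a)"
    by (intro sum.cong) (simp_all only: u)
  finally have "u (v a) = 0"
    using independentD[OF indep, of "v ` {1..n}" u "v a"] V a by auto
  then show ?thesis using u[OF a] by simp
qed


section \<open>Ricci curvature of left-invariant data\<close>

text \<open>All data are left-invariant except the connection \<open>D\<close>, which is only tied to the invariant
  divergence \<open>\<delta>\<close>.\<close>

locale homogeneous_levi_civita = metric_frame \<A> n v g \<epsilon>\<^sub>0
  for \<A> :: "('g::{topological_group_add, t2_space, second_countable_topology}, 'e::euclidean_space) chart set"
    and n :: nat and v :: "nat \<Rightarrow> 'g vf" and g :: "'g cov2" and \<epsilon>\<^sub>0 :: "nat \<Rightarrow> real" +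
  fixes H :: "'g cov3" and F :: "'g cov2" and \<delta> :: "'g sec \<Rightarrow> 'g scal" and D :: "'g sec \<Rightarrow> 'g sec \<Rightarrow> 'g sec"
  assumes H_form: "H \<in> three_forms \<A>" and F_form: "F \<in> two_forms \<A>"
    and H_inv: "left_invariant3 \<A> H" and F_inv: "left_invariant2 \<A> F" and g_inv: "left_invariant2 \<A> g"
    and frame_inv: "a \<in> {1..n} \<Longrightarrow> v a \<in> lie_algebra \<A>"
    and LC: "levi_civita \<A> H F g D"
    and \<delta>_inv: "left_invariant_divergence \<A> \<delta>"
    and \<delta>_D: "u \<in> sections \<A> \<Longrightarrow> divergence_of \<A> D u = \<delta> u"
begin

lemma lie_algebra_vf: "X \<in> lie_algebra \<A> \<Longrightarrow> X \<in> vector_fields \<A>"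
  by (simp add: lie_algebra_def)

lemma lie_algebra_0: "0 \<in> lie_algebra \<A>"
  by (auto simp: lie_algebra_def vf_0 translate_def fun_eq_iff)

lemma lie_algebra_bracket: "X \<in> lie_algebra \<A> \<Longrightarrow> Y \<in> lie_algebra \<A> \<Longrightarrow> lie_bracket X Y \<in> lie_algebra \<A>"
  by (simp add: lie_algebra_def vf_lie_bracket translate_lie_bracket)

lemma F_skew:
  assumes "X \<in> vector_fields \<A>" "Y \<in> vector_fields \<A>"
  shows "F X Y x = - F Y X x"
proof -
  have "F X Y = - F Y X" using F_form assms unfolding two_forms_def by blast
  from fun_cong[OF this, of x] show ?thesis by (simp only: uminus_apply)
qed

lemma F_one_form: "X \<in> vector_fields \<A> \<Longrightarrow> F X \<in> one_forms \<A>"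
  using F_form unfolding two_forms_def by blast

lemma F_zero: "Y \<in> vector_fields \<A> \<Longrightarrow> F 0 Y x = 0" "Y \<in> vector_fields \<A> \<Longrightarrow> F Y 0 x = 0"
  using F_skew[OF vf_0, of Y x] one_form_zero[OF F_one_form, of Y] by simp_all

lemma H_zero:
  assumes "Y \<in> vector_fields \<A>" "Z \<in> vector_fields \<A>"
  shows "H Y 0 Z x = 0"
proof -
  have "H Y \<in> two_forms \<A>" using H_form assms unfolding three_forms_def by blast
  then have "H Y 0 Z = - H Y Z 0" "H Y Z \<in> one_forms \<A>"
    using assms vf_0 unfolding two_forms_def by blast+
  then show ?thesis using one_form_zero[of "H Y Z"] by simp
qed

text \<open>Of the Lie derivative and of the exterior derivative only the terms with commutators remain,
  because left-invariant functions are constant.\<close>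

lemma pairing_dorfman_invariant:
  assumes inv: "X \<in> lie_algebra \<A>" "Y \<in> lie_algebra \<A>" "Z \<in> lie_algebra \<A>"
    and \<xi>: "\<xi> \<in> one_forms \<A>" "left_invariant1 \<A> \<xi>" and \<eta>: "\<eta> \<in> one_forms \<A>" "left_invariant1 \<A> \<eta>"
  shows "pairing (dorfman \<A> H F (X, \<xi>, \<lambda>_. l) (Y, \<eta>, \<lambda>_. m)) (Z, \<zeta>, \<lambda>_. k) x =
    (\<xi> (lie_bracket Y Z) x - \<eta> (lie_bracket X Z) x + \<zeta> (lie_bracket X Y) x + H Y X Z x) / 2
    - (m * F X Z x - l * F Y Z x) + F X Y x * k"
proof -
  have vf: "X \<in> vector_fields \<A>" "Y \<in> vector_fields \<A>" "Z \<in> vector_fields \<A>"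
    using inv lie_algebra_vf by auto
  have const: "\<omega> W = (\<lambda>_. \<omega> W 0)" if "left_invariant1 \<A> \<omega>" "W \<in> lie_algebra \<A>" for \<omega> W
    using left_invariant1_constant[OF that] by (rule ext)
  have d: "X (\<eta> Z) = 0" "Y (\<xi> Z) = 0" "Z (\<xi> Y) = 0" "X (\<lambda>_. m) = 0" "Y (\<lambda>_. l) = 0" "Z (\<lambda>_. l) = 0"
    using const[OF \<xi>(2) inv(3)] const[OF \<xi>(2) inv(2)] const[OF \<eta>(2) inv(3)] vf_const vf by metis+
  show ?thesis
    using vf by (simp add: pairing_def dorfman_def restrict0_def lie_derivative1_def ext_d1_def d
        scaleR_fun_def field_simps)
qed

lemma pairing_dorfman_constant:
  assumes "u \<in> left_inv_sections \<A>" "w \<in> left_inv_sections \<A>" "z \<in> left_inv_sections \<A>"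
  shows "\<exists>k. pairing (dorfman \<A> H F u w) z = (\<lambda>_. k)"
proof -
  obtain X \<xi> l where u: "u = (X, \<xi>, \<lambda>_. l)" "X \<in> lie_algebra \<A>" "\<xi> \<in> one_forms \<A>" "left_invariant1 \<A> \<xi>"
    using assms(1) by (auto simp: left_inv_sections_def)
  obtain Y \<eta> m where w: "w = (Y, \<eta>, \<lambda>_. m)" "Y \<in> lie_algebra \<A>" "\<eta> \<in> one_forms \<A>" "left_invariant1 \<A> \<eta>"
    using assms(2) by (auto simp: left_inv_sections_def)
  obtain Z \<zeta> k where z: "z = (Z, \<zeta>, \<lambda>_. k)" "Z \<in> lie_algebra \<A>" "left_invariant1 \<A> \<zeta>"
    using assms(3) by (auto simp: left_inv_sections_def)
  note c = left_invariant1_constant[OF u(4) lie_algebra_bracket[OF w(2) z(2)]]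
    left_invariant1_constant[OF w(4) lie_algebra_bracket[OF u(2) z(2)]]
    left_invariant1_constant[OF z(3) lie_algebra_bracket[OF u(2) w(2)]]
    left_invariant1_constant[OF left_invariant2_interior[OF left_invariant3_interior[OF H_inv w(2)] u(2)] z(2)]
    left_invariant1_constant[OF left_invariant2_interior[OF F_inv u(2)] z(2)]
    left_invariant1_constant[OF left_invariant2_interior[OF F_inv w(2)] z(2)]
    left_invariant1_constant[OF left_invariant2_interior[OF F_inv u(2)] w(2)]
  have "pairing (dorfman \<A> H F u w) z x = pairing (dorfman \<A> H F u w) z 0" for x
    unfolding u(1) w(1) z(1) pairing_dorfman_invariant[OF u(2) w(2) z(2) u(3,4) w(3,4)]
    by (simp only: c[of x])
  then show ?thesis by blast
qed

text \<open>This is where \<open>F\<close> enters the Ricci curvature: only the term \<open>2 \<lambda> i\<^sub>Y F\<close> of the Dorfman bracket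
  with \<open>\<lambda> = 1\<close> survives.\<close>

lemma pairing_dorfman_unit:
  assumes "w \<in> left_inv_sections \<A>" "z \<in> left_inv_sections \<A>"
  shows "pairing (dorfman \<A> H F (e 0) w) z x = F (anchor w) (anchor z) x"
proof -
  obtain Y \<eta> m where w: "w = (Y, \<eta>, \<lambda>_. m)" "Y \<in> lie_algebra \<A>" "\<eta> \<in> one_forms \<A>" "left_invariant1 \<A> \<eta>"
    using assms(1) by (auto simp: left_inv_sections_def)
  obtain Z \<zeta> k where z: "z = (Z, \<zeta>, \<lambda>_. k)" "Z \<in> lie_algebra \<A>" "\<zeta> \<in> one_forms \<A>"
    using assms(2) by (auto simp: left_inv_sections_def)
  note vf = lie_algebra_vf[OF w(2)] lie_algebra_vf[OF z(2)]
  have e0: "e 0 = (0, 0, \<lambda>_. 1)" by (simp add: induced_basis_def one_fun_def)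
  have br: "lie_bracket 0 W = 0" if "W \<in> vector_fields \<A>" for W
    using vf_zero_arg[OF that] by (auto simp: lie_bracket_def fun_eq_iff)
  have inv0: "left_invariant1 \<A> 0" by (simp add: left_invariant1_def)
  show ?thesis
    unfolding w(1) z(1) e0 pairing_dorfman_invariant[OF lie_algebra_0 w(2) z(2) one_forms_0 inv0 w(3,4)]
    by (simp add: br vf one_form_zero w z F_zero H_zero anchor_def)
qed

lemma e_left_invariant:
  assumes "A \<in> {0..n} \<union> {n+1..2*n}"
  shows "e A \<in> left_inv_sections \<A>"
proof -
  have g: "g (v a) \<in> one_forms \<A>" "left_invariant1 \<A> (g (v a))" if "a \<in> {1..n}" for a
    using g_one_form[OF frame_vf[OF that]] left_invariant2_interior[OF g_inv frame_inv[OF that]] by auto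
  have neg: "left_invariant1 \<A> (- \<omega>)" if "left_invariant1 \<A> \<omega>" for \<omega>
    using that by (simp add: left_invariant1_def)
  have "left_invariant1 \<A> 0" by (simp add: left_invariant1_def)
  moreover have "\<exists>c. (0::'g scal) = (\<lambda>_. c)" "\<exists>c. (1::'g scal) = (\<lambda>_. c)"
    by (auto simp: zero_fun_def one_fun_def)
  ultimately show ?thesis using assms
    by (elim index_cases)
      (simp_all add: e_simps left_inv_sections_def lie_algebra_0 one_forms_0 frame_inv g neg one_forms_uminus)
qed

lemma LC_connection: "generalized_connection \<A> D"
  and LC_torsion: "u \<in> sections \<A> \<Longrightarrow> w \<in> sections \<A> \<Longrightarrow> z \<in> sections \<A> \<Longrightarrow> torsion \<A> H F D u w z = 0"
  and LC_E_minus: "u \<in> sections \<A> \<Longrightarrow> w \<in> E_minus \<A> g \<Longrightarrow> D u w \<in> E_minus \<A> g"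
  using LC unfolding levi_civita_def by blast+

text \<open>Metricity carries the invariance of \<open>E\<^sub>-\<close> over to its orthogonal complement.\<close>

lemma LC_E_plus:
  assumes u: "u \<in> sections \<A>" and w: "w \<in> E_plus \<A> g"
  shows "D u w \<in> E_plus \<A> g"
proof -
  have ws: "w \<in> sections \<A>" using w by (simp add: E_plus_def)
  have "pairing (D u w) z = 0" if z: "z \<in> E_minus \<A> g" for z
  proof -
    have zs: "z \<in> sections \<A>" using E_minus_submodule z by (auto simp: submodule_def)
    have "anchor u (pairing w z) = pairing (D u w) z + pairing w (D u z)"
      using LC_connection u ws zs unfolding generalized_connection_def by blast
    moreover have "anchor u (pairing w z) = 0"
      using vf_zero_arg[OF anchor_vf[OF u]] E_plus_E_minus[OF w z] by simp
    ultimately show ?thesis using E_plus_E_minus[OF w LC_E_minus[OF u z]] by simp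
  qed
  moreover have "D u w \<in> sections \<A>"
    using LC_connection u ws unfolding generalized_connection_def by blast
  ultimately show ?thesis by (simp add: E_plus_def)
qed

lemma index_disjoint: "{0..n} \<inter> {n+1..2*n} = {}"
  by auto

lemma invariant_constants:
  assumes "A \<in> {0..n} \<union> {n+1..2*n}" "C \<in> {0..n} \<union> {n+1..2*n}" "E \<in> {0..n} \<union> {n+1..2*n}"
  shows "\<exists>k. pairing (dorfman \<A> H F (e A) (e C)) (e E) = (\<lambda>_. k)"
  by (rule pairing_dorfman_constant[OF assms[THEN e_left_invariant]])

sublocale plus: split_connection \<A> H F D e \<epsilon> "{0..n}" "{n+1..2*n}" "E_plus \<A> g" "E_minus \<A> g"
proof (unfold_locales)
  fix u w assume "u \<in> sections \<A>" "w \<in> sections \<A>"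
  then show "dorfman \<A> H F u w \<in> sections \<A>" by (rule dorfman_sections[OF H_form F_form])
qed (fact finite_atLeastAtMost index_disjoint E_plus_submodule E_minus_submodule E_plus_E_minus
    e_E_plus e_E_minus e_orthonormal \<epsilon>_square e_expansion LC_connection LC_torsion LC_E_plus LC_E_minus
    invariant_constants)+

sublocale minus: split_connection \<A> H F D e \<epsilon> "{n+1..2*n}" "{0..n}" "E_minus \<A> g" "E_plus \<A> g"
proof (unfold_locales)
  fix u w assume "u \<in> sections \<A>" "w \<in> sections \<A>"
  then show "dorfman \<A> H F u w \<in> sections \<A>" by (rule dorfman_sections[OF H_form F_form])
next
  fix u w assume "u \<in> E_minus \<A> g" "w \<in> E_plus \<A> g"
  then show "pairing u w = 0" using E_plus_E_minus by (simp add: pairing_commute[of u])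
qed (fact finite_atLeastAtMost index_disjoint[unfolded Int_commute[of "{0..n}"]] E_plus_submodule E_minus_submodule
    e_E_plus e_E_minus LC_connection LC_torsion LC_E_plus LC_E_minus
    e_orthonormal[unfolded Un_commute[of "{0..n}"]] \<epsilon>_square[unfolded Un_commute[of "{0..n}"]]
    e_expansion[unfolded Un_commute[of "{0..n}"]] invariant_constants[unfolded Un_commute[of "{0..n}"]])+

abbreviation B :: "nat \<Rightarrow> nat \<Rightarrow> nat \<Rightarrow> 'g \<Rightarrow> real" where "B \<equiv> plus.B"

lemma \<delta>_constant: "A \<in> {0..n} \<union> {n+1..2*n} \<Longrightarrow> \<exists>k. divergence_of \<A> D (e A) = (\<lambda>_. k)"
  using \<delta>_inv e_left_invariant by (simp add: \<delta>_D e_sections left_invariant_divergence_def)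

lemma ricci_plus_components:
  assumes "i \<in> {n+1..2*n}" "a \<in> {0..n}"
  shows "ricci_plus \<A> H F g D (e i) (e a) x =
    (\<Sum>b=0..n. (\<Sum>j=n+1..2*n. \<epsilon> b * \<epsilon> j * B b i j x * B a j b x) + \<epsilon> b * B i a b x * \<delta> (e b) x)"
  using plus.ricci_component[OF assms \<delta>_constant, of x] assms
  by (simp add: ricci_plus_def \<delta>_D e_sections)

text \<open>Exchanging the parts exchanges \<open>i\<close> with \<open>a\<close> and \<open>b\<close> with \<open>j\<close>.  By skew symmetry of \<open>B\<close> both
  factors of the quadratic term change sign, so that it agrees with that of \<open>Ric\<^sup>+\<close>.\<close>

lemma ricci_minus_components:
  assumes i: "i \<in> {n+1..2*n}" and a: "a \<in> {0..n}"
  shows "ricci_minus \<A> H F g D (e a) (e i) x =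
    (\<Sum>b=0..n. \<Sum>j=n+1..2*n. \<epsilon> b * \<epsilon> j * B b i j x * B a j b x) + (\<Sum>j=n+1..2*n. \<epsilon> j * B a i j x * \<delta> (e j) x)"
proof -
  have swap: "\<epsilon> j * \<epsilon> b * B j a b x * B i b j x = \<epsilon> b * \<epsilon> j * B b i j x * B a j b x"
    if "j \<in> {n+1..2*n}" "b \<in> {0..n}" for j b
    using plus.B_skew(1)[of a j b x] plus.B_skew(1)[of b i j x] that i a by simp
  have "(\<Sum>j=n+1..2*n. \<Sum>b=0..n. \<epsilon> j * \<epsilon> b * B j a b x * B i b j x)
      = (\<Sum>j=n+1..2*n. \<Sum>b=0..n. \<epsilon> b * \<epsilon> j * B b i j x * B a j b x)"
    by (intro sum.cong refl swap)
  also have "\<dots> = (\<Sum>b=0..n. \<Sum>j=n+1..2*n. \<epsilon> b * \<epsilon> j * B b i j x * B a j b x)"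
    by (rule sum.swap)
  finally have quadratic: "(\<Sum>j=n+1..2*n. \<Sum>b=0..n. \<epsilon> j * \<epsilon> b * B j a b x * B i b j x)
      = (\<Sum>b=0..n. \<Sum>j=n+1..2*n. \<epsilon> b * \<epsilon> j * B b i j x * B a j b x)" .
  have "ricci_minus \<A> H F g D (e a) (e i) x =
      (\<Sum>j=n+1..2*n. (\<Sum>b=0..n. \<epsilon> j * \<epsilon> b * B j a b x * B i b j x) + \<epsilon> j * B a i j x * \<delta> (e j) x)"
    using minus.ricci_component[OF a i \<delta>_constant, of x] i
    by (simp add: ricci_minus_def \<delta>_D e_sections)
  then show ?thesis by (simp only: sum.distrib quadratic)
qed

lemma anchor_e:
  "anchor (e 0) = 0" "a \<in> {1..n} \<Longrightarrow> anchor (e a) = v a" "j \<in> {n+1..2*n} \<Longrightarrow> anchor (e j) = v (j - n)"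
  by (auto simp: anchor_def induced_basis_def)

lemma B_unit:
  assumes "A \<in> {0..n} \<union> {n+1..2*n}" "C \<in> {0..n} \<union> {n+1..2*n}"
  shows "B 0 A C x = F (anchor (e A)) (anchor (e C)) x"
  unfolding plus.B_def by (rule pairing_dorfman_unit[OF assms[THEN e_left_invariant]])

lemma \<epsilon>_minus: "j \<in> {n+1..2*n} \<Longrightarrow> \<epsilon> j = - \<epsilon> (j - n)"
  by (auto simp: induced_sign_def)

lemma sum_from_0: "(\<Sum>b=0..n. h b) = h 0 + (\<Sum>b=1..n. h b)" for h :: "nat \<Rightarrow> real"
  by (simp add: sum.atLeast_Suc_atMost)

lemma B_00: "A \<in> {0..n} \<union> {n+1..2*n} \<Longrightarrow> B 0 A 0 x = 0" "A \<in> {0..n} \<union> {n+1..2*n} \<Longrightarrow> B A 0 0 x = 0"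
  using plus.B_skew(2)[of A 0 0 x] plus.B_skew(1)[of A 0 0 x] by auto

text \<open>The summand \<open>b = 0\<close> has the factors \<open>B 0 i j = F(v\<^sub>i\<^sub>', v\<^sub>j\<^sub>')\<close> and \<open>B a j 0 = F(v\<^sub>a, v\<^sub>j\<^sub>')\<close>; since
  \<open>\<epsilon>\<^sub>j = - \<epsilon>\<^sub>j\<^sub>'\<close>, it is the negative of the term quadratic in \<open>F\<close>.\<close>

lemma quadratic_term:
  assumes i: "i \<in> {n+1..2*n}" and a: "a \<in> {1..n}"
  shows "(\<Sum>b=0..n. \<Sum>j=n+1..2*n. \<epsilon> b * \<epsilon> j * B b i j x * B a j b x)
    = (\<Sum>b=1..n. \<Sum>j=n+1..2*n. (\<epsilon> j * B b i j x) * (\<epsilon> b * B a j b x))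
      - (\<Sum>b=1..n. \<epsilon> b * F (v (i - n)) (v b) x * F (v a) (v b) x)"
proof -
  have "(\<Sum>j=n+1..2*n. \<epsilon> 0 * \<epsilon> j * B 0 i j x * B a j 0 x)
      = (\<Sum>j=n+1..2*n. - (\<epsilon> (j - n) * F (v (i - n)) (v (j - n)) x * F (v a) (v (j - n)) x))"
  proof (rule sum.cong[OF refl])
    fix j assume j: "j \<in> {n+1..2*n}"
    have "B a j 0 x = B 0 a j x"
      using plus.B_skew(2)[of a j 0 x] plus.B_skew(1)[of a 0 j x] j a by simp
    then show "\<epsilon> 0 * \<epsilon> j * B 0 i j x * B a j 0 x = - (\<epsilon> (j - n) * F (v (i - n)) (v (j - n)) x * F (v a) (v (j - n)) x)"
      using i j a B_unit[of i j x] B_unit[of a j x] by (simp add: anchor_e \<epsilon>_minus \<epsilon>_simps(1))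
  qed
  also have "\<dots> = (\<Sum>b=1..n. - (\<epsilon> b * F (v (i - n)) (v b) x * F (v a) (v b) x))"
    by (rule sum.reindex_bij_witness[of _ "\<lambda>b. b + n" "\<lambda>j. j - n"]) auto
  finally show ?thesis unfolding sum_from_0 by (simp add: sum_negf mult_ac)
qed

lemma quadratic_term_unit:
  assumes i: "i \<in> {n+1..2*n}"
  shows "(\<Sum>b=0..n. \<Sum>j=n+1..2*n. \<epsilon> b * \<epsilon> j * B b i j x * B 0 j b x)
    = - (\<Sum>b=1..n. \<Sum>j=n+1..2*n. \<epsilon> (j - n) * \<epsilon> b * F (v (j - n)) (v b) x * B b i j x)"
proof -
  have "(\<Sum>j=n+1..2*n. \<epsilon> 0 * \<epsilon> j * B 0 i j x * B 0 j 0 x) = 0"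
    by (intro sum.neutral ballI) (simp add: B_00)
  moreover have "(\<Sum>b=1..n. \<Sum>j=n+1..2*n. \<epsilon> b * \<epsilon> j * B b i j x * B 0 j b x)
      = (\<Sum>b=1..n. \<Sum>j=n+1..2*n. - (\<epsilon> (j - n) * \<epsilon> b * F (v (j - n)) (v b) x * B b i j x))"
  proof (intro sum.cong[OF refl])
    fix b j assume b: "b \<in> {1..n}" and j: "j \<in> {n+1..2*n}"
    show "\<epsilon> b * \<epsilon> j * B b i j x * B 0 j b x = - (\<epsilon> (j - n) * \<epsilon> b * F (v (j - n)) (v b) x * B b i j x)"
      using b j B_unit[of j b x] by (simp add: anchor_e \<epsilon>_minus)
  qed
  ultimately show ?thesis unfolding sum_from_0 by (simp add: sum_negf)
qed

lemma ricci_plus_frame: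
  assumes i: "i \<in> {n+1..2*n}" and a: "a \<in> {1..n}"
  shows "ricci_plus \<A> H F g D (e i) (e a) x =
    (\<Sum>b=1..n. (\<Sum>j=n+1..2*n. (\<epsilon> j * B b i j x) * (\<epsilon> b * B a j b x)) + (\<epsilon> b * B i a b x) * \<delta> (e b) x)
    + F (v (i - n)) (v a) x * \<delta> (e 0) x
    - (\<Sum>b=1..n. \<epsilon> b * F (v (i - n)) (v b) x * F (v a) (v b) x)"
proof -
  have "B i a 0 x = B 0 i a x"
    using plus.B_skew(2)[of i a 0 x] plus.B_skew(1)[of i 0 a x] i a by simp
  then have "B i a 0 x = F (v (i - n)) (v a) x" using i a B_unit[of i a x] by (simp add: anchor_e)
  moreover have "ricci_plus \<A> H F g D (e i) (e a) x =
    (\<Sum>b=0..n. \<Sum>j=n+1..2*n. \<epsilon> b * \<epsilon> j * B b i j x * B a j b x) + (\<Sum>b=0..n. \<epsilon> b * B i a b x * \<delta> (e b) x)"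
    using ricci_plus_components[OF i, of a x] a by (simp add: sum.distrib)
  ultimately show ?thesis
    unfolding quadratic_term[OF i a] sum_from_0[of "\<lambda>b. \<epsilon> b * B i a b x * \<delta> (e b) x"] sum.distrib
    by (simp add: \<epsilon>_simps(1))
qed

lemma ricci_minus_frame:
  assumes i: "i \<in> {n+1..2*n}" and a: "a \<in> {1..n}"
  shows "ricci_minus \<A> H F g D (e a) (e i) x =
    (\<Sum>b=1..n. \<Sum>j=n+1..2*n. (\<epsilon> j * B b i j x) * (\<epsilon> b * B a j b x))
    + (\<Sum>j=n+1..2*n. (\<epsilon> j * B a i j x) * \<delta> (e j) x)
    - (\<Sum>b=1..n. \<epsilon> b * F (v (i - n)) (v b) x * F (v a) (v b) x)"
proof -
  have "a \<in> {0..n}" using a by simp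
  from ricci_minus_components[OF i this, of x] show ?thesis unfolding quadratic_term[OF i a] by simp
qed

lemma ricci_plus_unit:
  assumes i: "i \<in> {n+1..2*n}"
  shows "ricci_plus \<A> H F g D (e i) (e 0) x =
    - (\<Sum>b=1..n. \<Sum>j=n+1..2*n. \<epsilon> (j - n) * \<epsilon> b * F (v (j - n)) (v b) x * B b i j x)
    - (\<Sum>b=1..n. F (v (i - n)) (v b) x * \<epsilon> b * \<delta> (e b) x)"
proof -
  have "(\<Sum>b=1..n. \<epsilon> b * B i 0 b x * \<delta> (e b) x) = (\<Sum>b=1..n. - (F (v (i - n)) (v b) x * \<epsilon> b * \<delta> (e b) x))"
  proof (rule sum.cong[OF refl])
    fix b assume b: "b \<in> {1..n}"
    show "\<epsilon> b * B i 0 b x * \<delta> (e b) x = - (F (v (i - n)) (v b) x * \<epsilon> b * \<delta> (e b) x)"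
      using plus.B_skew(1)[of 0 i b x] B_unit[of i b x] i b by (simp add: anchor_e)
  qed
  moreover have "ricci_plus \<A> H F g D (e i) (e 0) x =
    (\<Sum>b=0..n. \<Sum>j=n+1..2*n. \<epsilon> b * \<epsilon> j * B b i j x * B 0 j b x) + (\<Sum>b=0..n. \<epsilon> b * B i 0 b x * \<delta> (e b) x)"
    using ricci_plus_components[OF i, of 0 x] by (simp add: sum.distrib)
  moreover have "B i 0 0 x = 0" using B_00(2)[of i x] i by simp
  ultimately show ?thesis
    unfolding quadratic_term_unit[OF i] sum_from_0[of "\<lambda>b. \<epsilon> b * B i 0 b x * \<delta> (e b) x"]
    by (simp add: sum_negf)
qed

lemma ricci_minus_unit:
  assumes i: "i \<in> {n+1..2*n}"
  shows "ricci_minus \<A> H F g D (e 0) (e i) x =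
    - (\<Sum>b=1..n. \<Sum>j=n+1..2*n. \<epsilon> (j - n) * \<epsilon> b * F (v (j - n)) (v b) x * B b i j x)
    - (\<Sum>j=n+1..2*n. F (v (i - n)) (v (j - n)) x * \<epsilon> (j - n) * \<delta> (e j) x)"
proof -
  have "(\<Sum>j=n+1..2*n. \<epsilon> j * B 0 i j x * \<delta> (e j) x)
      = (\<Sum>j=n+1..2*n. - (F (v (i - n)) (v (j - n)) x * \<epsilon> (j - n) * \<delta> (e j) x))"
  proof (rule sum.cong[OF refl])
    fix j assume j: "j \<in> {n+1..2*n}"
    show "\<epsilon> j * B 0 i j x * \<delta> (e j) x = - (F (v (i - n)) (v (j - n)) x * \<epsilon> (j - n) * \<delta> (e j) x)"
      using B_unit[of i j x] i j by (simp add: anchor_e \<epsilon>_minus)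
  qed
  moreover have "0 \<in> {0..n}" by simp
  note ricci_minus_components[OF i this, of x]
  ultimately show ?thesis unfolding quadratic_term_unit[OF i] by (simp add: sum_negf)
qed

end

theorem theorem14:
  fixes \<A> :: "('g::{topological_group_add, t2_space, second_countable_topology},
                'e::euclidean_space) chart set"
    and n :: nat
    and H :: "'g cov3" and F :: "'g cov2" and g :: "'g cov2"
    and \<delta> :: "'g sec \<Rightarrow> 'g scal"
    and D :: "'g sec \<Rightarrow> 'g sec \<Rightarrow> 'g sec"
    and v :: "nat \<Rightarrow> 'g vf" and e :: "nat \<Rightarrow> 'g sec"
    and \<epsilon> \<epsilon>0 :: "nat \<Rightarrow> real"
    and B Bup :: "nat \<Rightarrow> nat \<Rightarrow> nat \<Rightarrow> 'g \<Rightarrow> real"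
  assumes "lie_group \<A>" and "DIM('e) = n" and "n \<ge> 2"
    and "courant_Bn_data \<A> H F" and "left_invariant3 \<A> H" and "left_invariant2 \<A> F"
    and "g \<in> pseudo_riemannian_metrics \<A>" and "left_invariant2 \<A> g"
    and "left_invariant_divergence \<A> \<delta>"
    and "levi_civita \<A> H F g D" and "\<forall>u\<in>sections \<A>. divergence_of \<A> D u = \<delta> u"
    and "orthonormal_basis \<A> g n v \<epsilon>0"
    and "e = induced_basis g n v" and "\<epsilon> = induced_sign n \<epsilon>0"
    and "B = (\<lambda>a b c. pairing (dorfman \<A> H F (e a) (e b)) (e c))"
    and "Bup = (\<lambda>a b c x. \<epsilon> c * B a b c x)"
  shows "\<forall>i\<in>{n+1..2*n}. \<forall>x.
      (\<forall>a\<in>{1..n}.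
         ricci_plus \<A> H F g D (e i) (e a) x =
           (\<Sum>b=1..n. (\<Sum>j=n+1..2*n. Bup b i j x * Bup a j b x) + Bup i a b x * \<delta> (e b) x)
           + F (v (i - n)) (v a) x * \<delta> (e 0) x
           - (\<Sum>b=1..n. \<epsilon> b * F (v (i - n)) (v b) x * F (v a) (v b) x) \<and>
         ricci_minus \<A> H F g D (e a) (e i) x =
           (\<Sum>b=1..n. \<Sum>j=n+1..2*n. Bup b i j x * Bup a j b x)
           + (\<Sum>j=n+1..2*n. Bup a i j x * \<delta> (e j) x)
           - (\<Sum>b=1..n. \<epsilon> b * F (v (i - n)) (v b) x * F (v a) (v b) x)) \<and>
      ricci_plus \<A> H F g D (e i) (e 0) x =
        - (\<Sum>b=1..n. \<Sum>j=n+1..2*n. \<epsilon> (j - n) * \<epsilon> b * F (v (j - n)) (v b) x * B b i j x)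
        - (\<Sum>b=1..n. F (v (i - n)) (v b) x * \<epsilon> b * \<delta> (e b) x) \<and>
      ricci_minus \<A> H F g D (e 0) (e i) x =
        - (\<Sum>b=1..n. \<Sum>j=n+1..2*n. \<epsilon> (j - n) * \<epsilon> b * F (v (j - n)) (v b) x * B b i j x)
        - (\<Sum>j=n+1..2*n. F (v (i - n)) (v (j - n)) x * \<epsilon> (j - n) * \<delta> (e j) x)"
proof -
  have basis: "inj_on v {1..n}" "independent (v ` {1..n})" "span (v ` {1..n}) = lie_algebra \<A>"
    and sign: "\<And>a. a \<in> {1..n} \<Longrightarrow> \<epsilon>0 a \<in> {1, - 1}"
    and gram: "\<And>a b. a \<in> {1..n} \<Longrightarrow> b \<in> {1..n} \<Longrightarrow> g (v a) (v b) = (\<lambda>_. if a = b then \<epsilon>0 a else 0)"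
    using assms(12) unfolding orthonormal_basis_def by blast+
  have inv: "v a \<in> lie_algebra \<A>" if "a \<in> {1..n}" for a
    using that basis(3) span_base[of "v a" "v ` {1..n}"] by auto
  interpret manifold \<A> using assms(1) by unfold_locales (simp add: lie_group_def)
  interpret homogeneous_levi_civita \<A> n v g \<epsilon>0 H F \<delta> D
  proof unfold_locales
    show vf: "v a \<in> vector_fields \<A>" if "a \<in> {1..n}" for a
      using inv[OF that] by (simp add: lie_algebra_def)
    show "c a = 0"
      if z: "\<And>f. f \<in> smooth_funs \<A> \<Longrightarrow> (\<Sum>a=1..n. c a * v a f x) = 0" and a: "a \<in> {1..n}" for c x a
    proof (rule invariant_frame_independent[OF basis _ a])
      show "(\<Sum>a=1..n. c a * v a f x) = 0" for f
        using z[of f] vf_nonsmooth[OF vf] by (cases "f \<in> smooth_funs \<A>") auto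
    qed
    show "\<epsilon>0 a * \<epsilon>0 a = 1" if "a \<in> {1..n}" for a using sign[OF that] by auto
    show "divergence_of \<A> D u = \<delta> u" if "u \<in> sections \<A>" for u using that assms(11) by blast
    show "H \<in> three_forms \<A>" "F \<in> two_forms \<A>" using assms(4) by (simp_all add: courant_Bn_data_def)
  qed (fact assms inv gram)+
  have B: "B = plus.B" by (simp add: assms(13,15) plus.B_def fun_eq_iff)
  show ?thesis
    unfolding assms(16) B unfolding assms(13,14)
    using ricci_plus_frame ricci_minus_frame ricci_plus_unit ricci_minus_unit by blast
qed

end
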